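(* Let $1<p<\infty$ and $F\in H^p(\Omega_+)$. Then $F(w)$ has a non-tangential boundary limit, denoted $F(\zeta)$, at almost every $\zeta\in\Gamma$; moreover $F(\zeta)\in L^p(\Gamma,|\mathrm{d}\zeta|)$, $\lVert F\rVert_{L^p(\Gamma,|\mathrm{d}\zeta|)}\leqslant\lVert F\rVert_{H^p(\Omega_+)}$, and $$\frac1{2\pi\mathrm{i}}\int_\Gamma\frac{F(\zeta)}{\zeta-w}\,\mathrm{d}\zeta=\begin{cases}F(w)&\text{if } w\in\Omega_+,\\ 0&\text{if } w\in\Omega_-.\end{cases}$$ Besides, for $0<\tau<\sigma$, $\lVert F_{\sigma-\tau,\tau}-\chi_\Gamma F\rVert_{L^p(\gamma,|\mathrm{d}\zeta|)}\to0$ as $\tau\to0$, which implies that $\lVert F_{\sigma-\tau,\tau}-F\rVert_{L^p(\Gamma,|\mathrm{d}\zeta|)}\to0$ as $\tau\to 0$.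
   Context: Fix $\sigma>0$. For $s>0$, $t\in\mathbb{R}$ let $D_{s,t}=\{u+\mathrm{i}v: |u|<s,\ v>t\}$ and let $\Gamma_{s,t}=\partial D_{s,t}=\Gamma_{s,t,1}\cup\Gamma_{s,t,2}\cup\Gamma_{s,t,3}$ with $\Gamma_{s,t,1}=\{-s+\mathrm{i}v: v>t\}$, $\Gamma_{s,t,2}=\{u+\mathrm{i}t: |u|\leqslant s\}$, $\Gamma_{s,t,3}=\{s+\mathrm{i}v: v>t\}$, oriented so that $D_{s,t}$ lies on its left. Put $\Omega_+=D_{\sigma,0}$, $\Omega_-=\mathbb{C}\setminus\overline{D_{\sigma,0}}$, $\Gamma=\Gamma_{\sigma,0}$, $\Gamma_j=\Gamma_{\sigma,0,j}$. $H^p(\Omega_+)$ is the set of $F$ analytic on $\Omega_+$ with $\lVert F\rVert_{H^p(\Omega_+)}=\sup_{0<s<\sigma,\,t>0}\big(\int_{\Gamma_{s,t}}|F(w)|^p|\mathrm{d}w|\big)^{1/p}<\infty$. Non-tangential limits: for $\alpha>0$ and $\zeta\in\Gamma\setminus\{\pm\sigma\}$ let $\Omega_{\alpha+}(\zeta)$ be $\zeta+\{x+\mathrm{i}y: x>0,|y|<\alpha x\}$ if $\zeta\in\Gamma_1$, $\zeta+\{x+\mathrm{i}y: y>0,|x|<\alpha y\}$ if $\zeta\in\Gamma_2\setminus\{\pm\sigma\}$, $\zeta+\{x+\mathrm{i}y: x<0,|y|<-\alpha x\}$ if $\zeta\in\Gamma_3$. $F$ on $\Omega_+$ has non-tangential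 boundary limit $F(\zeta_0)$ at $\zeta_0$ if for all $\alpha>0$, $F(w)\to F(\zeta_0)$ as $w\to\zeta_0$, $w\in\Omega_{\alpha+}(\zeta_0)\cap\Omega_+$. Transported functions: let $\gamma_1=\{\mathrm{Re}\,w=-\sigma\}$, $\gamma_2=\mathbb{R}$, $\gamma_3=\{\mathrm{Re}\,w=\sigma\}$, $\gamma=\gamma_1\cup\gamma_2\cup\gamma_3$; $\gamma_{s,t,1}=\gamma_1\cap\{\mathrm{Im}\,w>t\}$, $\gamma_{s,t,2}=\gamma_2\cap\{|\mathrm{Re}\,w|\leqslant s\}$, $\gamma_{s,t,3}=\gamma_3\cap\{\mathrm{Im}\,w>t\}$, $\gamma_{s,t}=\bigcup_j\gamma_{s,t,j}$. Define $P_{s,t}:\gamma_{s,t}\to\Gamma_{s,t}$ by $P_{s,t}(\zeta)=\zeta+(\sigma-s)$ on $\gamma_{s,t,1}$, $\zeta+\mathrm{i}t$ on $\gamma_{s,t,2}$, $\zeta-(\sigma-s)$ on $\gamma_{s,t,3}$. For $G$ defined on $\Gamma_{s,t}$, $G_{s,t}(\zeta)=G(P_{s,t}(\zeta))$ for $\zeta\in\gamma_{s,t}$ and $G_{s,t}(\zeta)=0$ for $\zeta\in\gamma\setminus\gamma_{s,t}$. $\chi_\Gamma F$ denotes $F$ on $\Gamma\subset\gamma$ extended by $0$ to $\gamma$. *)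

theory Defs
  imports "HOL-Analysis.Analysis"
begin

section \<open>The half-strip and its boundary\<close>

definition half_strip :: "real \<Rightarrow> real \<Rightarrow> complex set" where
  "half_strip s t = {w. \<bar>Re w\<bar> < s \<and> Im w > t}"

definition bdry1 :: "real \<Rightarrow> real \<Rightarrow> complex set" where
  "bdry1 s t = {w. Re w = - s \<and> Im w > t}"

definition bdry2 :: "real \<Rightarrow> real \<Rightarrow> complex set" where
  "bdry2 s t = {w. \<bar>Re w\<bar> \<le> s \<and> Im w = t}"

definition bdry3 :: "real \<Rightarrow> real \<Rightarrow> complex set" where
  "bdry3 s t = {w. Re w = s \<and> Im w > t}"

definition bdry :: "real \<Rightarrow> real \<Rightarrow> complex set" where
  "bdry s t = bdry1 s t \<union> bdry2 s t \<union> bdry3 s t"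

lemma closure_half_strip:
  assumes "s > 0"
  shows "closure (half_strip s t) = {w. \<bar>Re w\<bar> \<le> s \<and> Im w \<ge> t}"
proof -
  define A B C where "A = {w::complex. 1 \<bullet> w < s}" and "B = {w::complex. (-1) \<bullet> w < s}"
    and "C = {w::complex. (- \<i>) \<bullet> w < - t}"
  have op: "open A" "open B" "open C"
    by (simp_all only: A_def B_def C_def open_halfspace_lt)
  have cv: "convex A" "convex B" "convex C"
    by (simp_all only: A_def B_def C_def convex_halfspace_lt)
  have mem: "Complex 0 (t + 1) \<in> A \<inter> B \<inter> C"
    using assms by (simp add: A_def B_def C_def inner_complex_def)
  have "closure (\<Inter>{A, B, C}) = \<Inter>(closure ` {A, B, C})"
    using mem op cv by (intro closure_Inter_convex) (auto simp: rel_interior_open)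
  then have "closure (A \<inter> B \<inter> C) = closure A \<inter> closure B \<inter> closure C"
    by (simp add: Int_assoc)
  moreover have "half_strip s t = A \<inter> B \<inter> C"
    by (auto simp: half_strip_def A_def B_def C_def inner_complex_def)
  moreover have "closure A = {w. Re w \<le> s}" "closure B = {w. - s \<le> Re w}"
    "closure C = {w. Im w \<ge> t}"
    unfolding A_def B_def C_def
    by (subst closure_halfspace_lt; force simp: inner_complex_def complex_eq_iff)+
  ultimately show ?thesis by auto
qed

lemma open_half_strip: "open (half_strip s t)"
  unfolding half_strip_def by (intro open_Collect_conj open_Collect_less continuous_intros)

lemma frontier_half_strip:
  assumes "s > 0"
  shows "frontier (half_strip s t) = bdry s t"
  unfolding frontier_def interior_open[OF open_half_strip] closure_half_strip[OF assms]
  using assms by (auto simp: half_strip_def bdry_def bdry1_def bdry2_def bdry3_def)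

section \<open>Arc length and integration along the boundary\<close>

text \<open>
  \<open>three_lines s t\<close> is arc length, counted on each of the lines \<open>Re w = - s\<close>, \<open>Im w = t\<close> and
  \<open>Re w = s\<close>: the image of Lebesgue measure on three disjoint copies of the real line,
  completed. (The lines meet in null sets when \<open>s > 0\<close>.)  In particular \<open>three_lines \<sigma> 0\<close> is
  \<open>|d\<zeta>|\<close> on \<open>\<gamma>\<close>.
\<close>

definition line_point :: "real \<Rightarrow> real \<Rightarrow> nat \<times> real \<Rightarrow> complex" where
  "line_point s t = (\<lambda>(j, x). if j = 1 then Complex (- s) x
     else if j = 2 then Complex x t else Complex s x)"

definition three_lines :: "real \<Rightarrow> real \<Rightarrow> complex measure" where
  "three_lines s t =
     completion (distr (count_space {1, 2, 3} \<Otimes>\<^sub>M lborel) borel (line_point s t))"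

definition arc_length :: "real \<Rightarrow> real \<Rightarrow> complex measure" where
  "arc_length s t = restrict_space (three_lines s t) (bdry s t)"

lemma line_point_measurable [measurable]:
  "line_point s t \<in> borel_measurable (count_space {1, 2, 3} \<Otimes>\<^sub>M lborel)"
proof (rule measurable_pair_measure_countable1)
  fix j :: nat assume "j \<in> {1, 2, 3}"
  have [measurable]: "(\<lambda>x. Complex c x) \<in> borel_measurable lborel"
    "(\<lambda>x. Complex x c) \<in> borel_measurable lborel" for c
    by (simp_all, (intro borel_measurable_continuous_onI continuous_intros)+)
  show "(\<lambda>x. line_point s t (j, x)) \<in> borel_measurable lborel"
    by (cases "j = 1"; cases "j = 2") (simp_all add: line_point_def)
qed simp

lemma nn_integral_three_lines:
  assumes [measurable]: "f \<in> borel_measurable borel"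
  shows "(\<integral>\<^sup>+w. f w \<partial>three_lines s t) =
    (\<integral>\<^sup>+v. f (Complex (- s) v) \<partial>lborel) + (\<integral>\<^sup>+u. f (Complex u t) \<partial>lborel) +
    (\<integral>\<^sup>+v. f (Complex s v) \<partial>lborel)"
proof -
  let ?C = "count_space {1, 2, 3 :: nat}"
  have "(\<integral>\<^sup>+w. f w \<partial>three_lines s t) = (\<integral>\<^sup>+z. f (line_point s t z) \<partial>(?C \<Otimes>\<^sub>M lborel))"
    unfolding three_lines_def
    by (simp add: nn_integral_completion nn_integral_distr[OF line_point_measurable] del: One_nat_def)
  also have "\<dots> = (\<integral>\<^sup>+j. \<integral>\<^sup>+x. f (line_point s t (j, x)) \<partial>lborel \<partial>?C)"
    by (rule lborel.nn_integral_fst[symmetric])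
      (rule measurable_compose[OF line_point_measurable assms])
  also have "\<dots> = (\<Sum>j\<in>{1, 2, 3}. \<integral>\<^sup>+x. f (line_point s t (j, x)) \<partial>lborel)"
    by (rule nn_integral_count_space_finite) simp
  finally show ?thesis
    by (simp add: line_point_def add.assoc)
qed

text \<open>
  The unit tangent for the orientation of \<open>bdry s t\<close> that keeps \<open>half_strip s t\<close> on the left:
  down the left side, rightwards along the bottom, up the right side; thus
  \<open>d\<zeta> = tangent s t \<zeta> |d\<zeta>|\<close>.
\<close>

definition tangent :: "real \<Rightarrow> real \<Rightarrow> complex \<Rightarrow> complex" where
  "tangent s t \<zeta> = (if \<zeta> \<in> bdry1 s t then - \<i> else if \<zeta> \<in> bdry3 s t then \<i> else 1)"

definition bdry_integrable :: "real \<Rightarrow> real \<Rightarrow> (complex \<Rightarrow> complex) \<Rightarrow> bool" where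
  "bdry_integrable s t f \<longleftrightarrow> integrable (arc_length s t) (\<lambda>\<zeta>. f \<zeta> * tangent s t \<zeta>)"

definition bdry_integral :: "real \<Rightarrow> real \<Rightarrow> (complex \<Rightarrow> complex) \<Rightarrow> complex" where
  "bdry_integral s t f = (LINT \<zeta>|arc_length s t. f \<zeta> * tangent s t \<zeta>)"

section \<open>Lebesgue and Hardy spaces\<close>

definition Lp_norm :: "complex measure \<Rightarrow> real \<Rightarrow> (complex \<Rightarrow> complex) \<Rightarrow> ennreal" where
  "Lp_norm M p f =
     (let I = \<integral>\<^sup>+w. ennreal (cmod (f w) powr p) \<partial>M
      in if I = \<infinity> then \<infinity> else ennreal (enn2real I powr (1 / p)))"

definition Lp_space :: "complex measure \<Rightarrow> real \<Rightarrow> (complex \<Rightarrow> complex) set" where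
  "Lp_space M p = {f \<in> borel_measurable M. Lp_norm M p f < \<infinity>}"

definition Hp_norm :: "real \<Rightarrow> real \<Rightarrow> (complex \<Rightarrow> complex) \<Rightarrow> ennreal" where
  "Hp_norm \<sigma> p F = (SUP (s, t) \<in> {0<..<\<sigma>} \<times> {0<..}. Lp_norm (arc_length s t) p F)"

definition Hp_space :: "real \<Rightarrow> real \<Rightarrow> (complex \<Rightarrow> complex) set" where
  "Hp_space \<sigma> p = {F. F analytic_on half_strip \<sigma> 0 \<and> Hp_norm \<sigma> p F < \<infinity>}"

section \<open>Non-tangential limits\<close>

text \<open>Only used for boundary points \<open>\<zeta>\<close> other than the corners \<open>\<plusminus>\<sigma>\<close>.\<close>

definition approach_region :: "real \<Rightarrow> real \<Rightarrow> complex \<Rightarrow> complex set" where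
  "approach_region \<sigma> \<alpha> \<zeta> = (+) \<zeta> `
     (if \<zeta> \<in> bdry1 \<sigma> 0 then {z. Re z > 0 \<and> \<bar>Im z\<bar> < \<alpha> * Re z}
      else if \<zeta> \<in> bdry3 \<sigma> 0 then {z. Re z < 0 \<and> \<bar>Im z\<bar> < - \<alpha> * Re z}
      else {z. Im z > 0 \<and> \<bar>Re z\<bar> < \<alpha> * Im z})"

definition has_nt_limit :: "real \<Rightarrow> (complex \<Rightarrow> complex) \<Rightarrow> complex \<Rightarrow> complex \<Rightarrow> bool" where
  "has_nt_limit \<sigma> F \<zeta> L \<longleftrightarrow>
     \<zeta> \<in> bdry \<sigma> 0 - {- complex_of_real \<sigma>, complex_of_real \<sigma>} \<and>
     (\<forall>\<alpha>>0. (F \<longlongrightarrow> L) (at \<zeta> within approach_region \<sigma> \<alpha> \<zeta> \<inter> half_strip \<sigma> 0))"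

text \<open>
  The boundary function \<open>F(\<zeta>)\<close>; the value 0 where no non-tangential limit exists is a convention.
\<close>

definition nt_limit :: "real \<Rightarrow> (complex \<Rightarrow> complex) \<Rightarrow> complex \<Rightarrow> complex" where
  "nt_limit \<sigma> F \<zeta> = (if \<exists>L. has_nt_limit \<sigma> F \<zeta> L then THE L. has_nt_limit \<sigma> F \<zeta> L else 0)"

section \<open>Transport to the three lines\<close>

definition lines1 :: "real \<Rightarrow> real \<Rightarrow> complex set" where
  "lines1 \<sigma> t = {\<zeta>. Re \<zeta> = - \<sigma>} \<inter> {\<zeta>. Im \<zeta> > t}"

definition lines2 :: "real \<Rightarrow> complex set" where
  "lines2 s = {\<zeta>. Im \<zeta> = 0} \<inter> {\<zeta>. \<bar>Re \<zeta>\<bar> \<le> s}"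

definition lines3 :: "real \<Rightarrow> real \<Rightarrow> complex set" where
  "lines3 \<sigma> t = {\<zeta>. Re \<zeta> = \<sigma>} \<inter> {\<zeta>. Im \<zeta> > t}"

text \<open>
  \<open>shift \<sigma> s t\<close> is the map \<open>P\<^bsub>s,t\<^esub>\<close>; its three pieces are disjoint for \<open>\<sigma> > 0\<close> and \<open>t \<ge> 0\<close>.
\<close>

definition shift :: "real \<Rightarrow> real \<Rightarrow> real \<Rightarrow> complex \<Rightarrow> complex" where
  "shift \<sigma> s t \<zeta> =
     (if \<zeta> \<in> lines1 \<sigma> t then \<zeta> + of_real (\<sigma> - s)
      else if \<zeta> \<in> lines2 s then \<zeta> + \<i> * of_real t
      else \<zeta> - of_real (\<sigma> - s))"

definition transport :: "real \<Rightarrow> real \<Rightarrow> real \<Rightarrow> (complex \<Rightarrow> complex) \<Rightarrow> complex \<Rightarrow> complex" where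
  "transport \<sigma> s t G \<zeta> =
     (if \<zeta> \<in> lines1 \<sigma> t \<union> lines2 s \<union> lines3 \<sigma> t then G (shift \<sigma> s t \<zeta>) else 0)"

definition extend_by_zero :: "real \<Rightarrow> (complex \<Rightarrow> complex) \<Rightarrow> complex \<Rightarrow> complex" where
  "extend_by_zero \<sigma> G \<zeta> = (if \<zeta> \<in> bdry \<sigma> 0 then G \<zeta> else 0)"

end

theory Submission
  imports Defs "HOL-Complex_Analysis.Complex_Analysis" "HOL-Real_Asymp.Real_Asymp"
begin

text \<open>
  The boundary of the half-strip is identified with the real line by arc length (\<open>strip_curve\<close>), so
  that all boundary functions live in \<open>L\<^sup>p(\<real>)\<close>.

  \<^emph>\<open>The boundary function.\<close>  For \<open>s < \<sigma>\<close> and \<open>t > 0\<close>, Cauchy's formula holds on the boundary of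
  \<open>D\<^bsub>s,t\<^esub>\<close> (\<open>cauchy_integral_strip_curve\<close>): one integrates over rectangles, and the top side contributes
  nothing in the limit, because it is also the bottom of a half-strip \<open>D\<^bsub>s,T\<^esub>\<close>, on which \<open>F\<close> is bounded in
  \<open>L\<^sup>p\<close> independently of \<open>T\<close>.  When the inner half-strips exhaust \<open>\<Omega>\<^sub>+\<close>, the restrictions of \<open>F\<close> to
  their boundaries are a bounded sequence in \<open>L\<^sup>p(\<real>)\<close>.  Since \<open>p > 1\<close>, it has a weak limit \<open>f\<close>
  (\<open>Lp_weak_compactness\<close>), while the Cauchy kernels converge strongly in the dual space.  Hence the
  Cauchy integral of \<open>f\<close> over \<open>\<Gamma>\<close> is \<open>F\<close> in \<open>\<Omega>\<^sub>+\<close> and \<open>0\<close> in \<open>\<Omega>\<^sub>-\<close> (\<open>boundary_function_exists\<close>).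

  \<^emph>\<open>Non-tangential limits.\<close>  The vanishing in \<open>\<Omega>\<^sub>-\<close> is what identifies \<open>f\<close> as the boundary values of
  \<open>F\<close>.  Let \<open>w\<close> in \<open>\<Omega>\<^sub>+\<close> be close to a boundary point \<open>\<zeta>\<close> that is not a corner, and let \<open>w'\<close> be its reflection
  in the line that carries the side of \<open>\<zeta>\<close>.  Then \<open>w'\<close> lies in \<open>\<Omega>\<^sub>-\<close>, so \<open>F(w)\<close> is the difference of the
  Cauchy integrals of \<open>f\<close> at \<open>w\<close> and at \<open>w'\<close>.  On the side of \<open>\<zeta>\<close> the difference of the two kernels is the
  Poisson kernel; the Cauchy integral over the other two sides is continuous at \<open>\<zeta>\<close>, so its difference
  tends to \<open>0\<close>.  Fatou's theorem for Poisson integrals on the line (\<open>poisson_nontangential\<close>) gives the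
  non-tangential limit \<open>f\<close> almost everywhere (\<open>AE_has_nt_limit\<close>).

  \<^emph>\<open>Convergence in \<open>L\<^sup>p\<close>.\<close>  On the whole boundary, corners included, the difference of the two kernels
  is at most a constant times the Poisson kernel in the arc-length variable, plus a term of size \<open>O(\<tau>)\<close>
  coming from the opposite side (\<open>reflected_kernel_bound\<close>).  By Jensen's inequality
  \<open>|F\<^bsub>\<sigma>-\<tau>,\<tau>\<^esub>|\<^sup>p\<close> is dominated by Poisson integrals of \<open>|f|\<^sup>p\<close>.  These converge almost everywhere and
  their integrals over the line converge as well, so that the dominated convergence theorem with a varying
  majorant (\<open>generalized_dominated_convergence_null\<close>) turns the almost everywhere convergence into
  convergence in \<open>L\<^sup>p\<close>.
\<close>

section \<open>Young's inequality and \<open>L\<^sup>p\<close> bounds\<close>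

text \<open>
  The free weight \<open>l\<close> makes the first summand as small as desired at the price of a large constant in
  the second.  Integrated, this serves below in place of the sharp inequality between \<open>L\<^sup>p\<close> and \<open>L\<^sup>q\<close> norms.
\<close>

lemma young_weighted:
  fixes a b l p q :: real
  assumes "p > 1" "q > 1" "1 / p + 1 / q = 1" "a \<ge> 0" "b \<ge> 0" "l > 0"
  shows "a * b \<le> l * a powr p + l powr (- (q / p)) * b powr q"
proof -
  have "a * b = (l powr (1/p) * a) * (l powr (- (1/p)) * b)"
    using assms by (simp add: powr_minus field_simps)
  also have "\<dots> \<le> (l powr (1/p) * a) powr p / p + (l powr (- (1/p)) * b) powr q / q"
    using assms by (intro Youngs_inequality) auto
  also have "\<dots> = l * a powr p / p + l powr (- (q / p)) * b powr q / q"
    using assms by (simp add: powr_mult powr_powr)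
  also have "\<dots> \<le> l * a powr p + l powr (- (q / p)) * b powr q"
    using assms by (intro add_mono) (auto simp: divide_le_eq mult_le_cancel_left1 not_less)
  finally show ?thesis .
qed

text \<open>
  The graph of the \<open>p\<close>-th power lies above its tangent at \<open>b\<close>.  Deduced from Young's inequality, this
  holds at \<open>b = 0\<close> too; integrated against a probability measure it becomes Jensen's inequality.
\<close>

lemma powr_tangent:
  fixes a b p :: real
  assumes "p > 1" "a \<ge> 0" "b \<ge> 0"
  shows "b powr p + p * b powr (p - 1) * (a - b) \<le> a powr p"
proof -
  define q where "q = p / (p - 1)"
  have q: "q > 1" "1 / p + 1 / q = 1" "(p - 1) * q = p"
    using assms by (auto simp: q_def field_simps)
  have "a * b powr (p - 1) \<le> a powr p / p + (b powr (p - 1)) powr q / q"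
    using assms q by (intro Youngs_inequality) auto
  also have "(b powr (p - 1)) powr q = b powr p"
    using q by (simp add: powr_powr)
  finally have "p * (a * b powr (p - 1)) \<le> p * (a powr p / p + b powr p / q)"
    using assms by (intro mult_left_mono) auto
  also have "\<dots> = a powr p + (p - 1) * b powr p"
    using assms by (simp add: q_def field_simps)
  finally have "p * (a * b powr (p - 1)) \<le> a powr p + (p - 1) * b powr p" .
  moreover have "b powr (p - 1) * b = b powr p"
    using assms powr_mult_base[of b "p - 1"] by (simp add: mult.commute)
  ultimately show ?thesis by (simp add: algebra_simps)
qed

lemma powr_midpoint:
  fixes a b p :: real
  assumes "p > 1" "a \<ge> 0" "b \<ge> 0"
  shows "((a + b) / 2) powr p \<le> (a powr p + b powr p) / 2"
  using powr_tangent[of p a "(a+b)/2"] powr_tangent[of p b "(a+b)/2"] assms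
  by (simp add: field_simps)

lemma powr_add_le:
  fixes a b p :: real
  assumes "p > 1" "a \<ge> 0" "b \<ge> 0"
  shows "(a + b) powr p \<le> 2 powr p * (a powr p + b powr p)"
proof -
  have "((a + b) / 2) powr p \<le> (a powr p + b powr p)"
    by (rule order_trans[OF powr_midpoint[OF assms]]) simp
  then have "2 powr p * ((a + b) / 2) powr p \<le> 2 powr p * (a powr p + b powr p)"
    by (intro mult_left_mono) auto
  then show ?thesis using assms by (simp add: powr_divide)
qed

lemma le_one_plus_powr:
  fixes a p :: real
  assumes "p > 1" "a \<ge> 0"
  shows "a \<le> 1 + a powr p"
  using assms powr_mono[of 1 p a] by (cases "a \<le> 1") (auto intro: add_increasing2)

lemma integrable_mult_Lp_Lq:
  fixes f g :: "'a \<Rightarrow> complex"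
  assumes pq: "p > 1" "q > 1" "1 / p + 1 / q = 1"
    and [measurable]: "f \<in> borel_measurable M" "g \<in> borel_measurable M"
    and f: "integrable M (\<lambda>x. cmod (f x) powr p)" and g: "integrable M (\<lambda>x. cmod (g x) powr q)"
  shows "integrable M (\<lambda>x. f x * g x)"
    and "l > 0 \<Longrightarrow> (LINT x|M. cmod (f x * g x)) \<le>
      l * (LINT x|M. cmod (f x) powr p) + l powr (- (q / p)) * (LINT x|M. cmod (g x) powr q)"
proof -
  have le: "cmod (f x * g x) \<le> l * cmod (f x) powr p + l powr (- (q / p)) * cmod (g x) powr q"
    if "l > 0" for l x
    using young_weighted[OF pq, of "cmod (f x)" "cmod (g x)" l] that by (simp add: norm_mult)
  show int: "integrable M (\<lambda>x. f x * g x)"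
    by (rule Bochner_Integration.integrable_bound[of _ "\<lambda>x. cmod (f x) powr p + cmod (g x) powr q"])
      (use f g le[of 1] in auto)
  show "(LINT x|M. cmod (f x * g x)) \<le>
      l * (LINT x|M. cmod (f x) powr p) + l powr (- (q / p)) * (LINT x|M. cmod (g x) powr q)" if "l > 0"
  proof -
    have "(LINT x|M. cmod (f x * g x)) \<le> (LINT x|M. l * cmod (f x) powr p + l powr (- (q / p)) * cmod (g x) powr q)"
      using int f g le[OF that] by (intro integral_mono) auto
    then show ?thesis using f g by simp
  qed
qed

lemma Lp_Fatou:
  fixes f :: "'a \<Rightarrow> complex" and p B :: real
  assumes "p > 0" and [measurable]: "f \<in> borel_measurable M" "\<And>n. y n \<in> borel_measurable M"
    and y: "\<And>n. integrable M (\<lambda>x. cmod (y n x) powr p)" "\<And>n. (LINT x|M. cmod (y n x) powr p) \<le> B"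
    and lim: "AE x in M. (\<lambda>n. y n x) \<longlonglongrightarrow> f x"
  shows "integrable M (\<lambda>x. cmod (f x) powr p)" "(LINT x|M. cmod (f x) powr p) \<le> B"
proof -
  have B: "B \<ge> 0" by (rule order_trans[OF _ y(2)[of 0]]) simp
  have "(\<integral>\<^sup>+x. ennreal (cmod (f x) powr p) \<partial>M) = (\<integral>\<^sup>+x. liminf (\<lambda>n. ennreal (cmod (y n x) powr p)) \<partial>M)"
  proof (intro nn_integral_cong_AE)
    show "AE x in M. ennreal (cmod (f x) powr p) = liminf (\<lambda>n. ennreal (cmod (y n x) powr p))"
      using lim
    proof eventually_elim
      case (elim x)
      have "(\<lambda>n. cmod (y n x) powr p) \<longlonglongrightarrow> cmod (f x) powr p"
        using elim \<open>p > 0\<close> by (intro tendsto_powr2 tendsto_norm tendsto_const) auto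
      then have "(\<lambda>n. ennreal (cmod (y n x) powr p)) \<longlonglongrightarrow> ennreal (cmod (f x) powr p)"
        by (intro tendsto_ennrealI)
      then show ?case by (metis lim_imp_Liminf trivial_limit_sequentially)
    qed
  qed
  also have "\<dots> \<le> liminf (\<lambda>n. \<integral>\<^sup>+x. ennreal (cmod (y n x) powr p) \<partial>M)"
    by (rule nn_integral_liminf) auto
  also have "\<dots> \<le> liminf (\<lambda>n. ennreal B)"
    using y by (intro Liminf_mono always_eventually allI) (simp add: nn_integral_eq_integral ennreal_leI)
  finally have le: "(\<integral>\<^sup>+x. ennreal (cmod (f x) powr p) \<partial>M) \<le> ennreal B" by (simp add: Liminf_const)
  then show int: "integrable M (\<lambda>x. cmod (f x) powr p)"
    by (intro integrableI_nonneg) (auto simp: le_less_trans)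
  show "(LINT x|M. cmod (f x) powr p) \<le> B"
    using le B by (subst (asm) nn_integral_eq_integral[OF int]) auto
qed

text \<open>
  With \<open>z = y\<^sub>n - f\<close>, Young's inequality bounds the part of \<open>|z g|\<close> that exceeds \<open>l |z|\<^sup>p\<close> by a
  multiple of \<open>|g|\<^sup>q\<close>, so dominated convergence applies to that part.  What remains integrates to at most
  \<open>l\<close> times a fixed constant, and \<open>l\<close> is arbitrary.
\<close>

lemma Lp_bounded_AE_imp_weak_tendsto:
  fixes f :: "'a \<Rightarrow> complex" and p q B :: real
  assumes pq: "p > 1" "q > 1" "1 / p + 1 / q = 1"
    and mf[measurable]: "f \<in> borel_measurable M" and my[measurable]: "\<And>n. y n \<in> borel_measurable M"
    and mg[measurable]: "g \<in> borel_measurable M"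
    and y: "\<And>n. integrable M (\<lambda>x. cmod (y n x) powr p)" "\<And>n. (LINT x|M. cmod (y n x) powr p) \<le> B"
    and lim: "AE x in M. (\<lambda>n. y n x) \<longlonglongrightarrow> f x"
    and g: "integrable M (\<lambda>x. cmod (g x) powr q)"
  shows "(\<lambda>n. LINT x|M. y n x * g x) \<longlonglongrightarrow> (LINT x|M. f x * g x)"
proof -
  note f = Lp_Fatou[OF _ mf my y lim]
  have B: "B \<ge> 0" by (rule order_trans[OF _ y(2)[of 0]]) simp
  define z where "z n x = y n x - f x" for n x
  have [measurable]: "z n \<in> borel_measurable M" for n unfolding z_def by simp
  have z_le: "cmod (z n x) powr p \<le> 2 powr p * (cmod (y n x) powr p + cmod (f x) powr p)" for n x
  proof -
    have "cmod (z n x) powr p \<le> (cmod (y n x) + cmod (f x)) powr p"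
      using pq unfolding z_def by (intro powr_mono2 norm_triangle_ineq4) auto
    also have "\<dots> \<le> 2 powr p * (cmod (y n x) powr p + cmod (f x) powr p)"
      using pq by (intro powr_add_le) auto
    finally show ?thesis .
  qed
  have zi: "integrable M (\<lambda>x. cmod (z n x) powr p)" for n
    by (rule Bochner_Integration.integrable_bound[of _ "\<lambda>x. 2 powr p * (cmod (y n x) powr p + cmod (f x) powr p)"])
      (use y f pq z_le in auto)
  have zB: "(LINT x|M. cmod (z n x) powr p) \<le> 2 powr p * (2 * B)" for n
  proof -
    have "(LINT x|M. cmod (z n x) powr p) \<le> (LINT x|M. 2 powr p * (cmod (y n x) powr p + cmod (f x) powr p))"
      using zi z_le y f pq by (intro integral_mono) auto
    also have "\<dots> = 2 powr p * ((LINT x|M. cmod (y n x) powr p) + (LINT x|M. cmod (f x) powr p))"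
      using y f pq by simp
    also have "\<dots> \<le> 2 powr p * (2 * B)"
      using y(2)[of n] f(2) pq by (intro mult_left_mono) auto
    finally show ?thesis .
  qed
  have zg: "integrable M (\<lambda>x. z n x * g x)" for n
    by (rule integrable_mult_Lp_Lq(1)[OF pq _ _ zi g]) auto
  have yg: "integrable M (\<lambda>x. y n x * g x)" for n
    by (rule integrable_mult_Lp_Lq(1)[OF pq _ _ y(1) g]) auto
  have fg: "integrable M (\<lambda>x. f x * g x)"
    by (rule integrable_mult_Lp_Lq(1)[OF pq _ _ f(1) g]) (use pq in auto)
  have lim0: "(\<lambda>n. LINT x|M. max 0 (cmod (z n x * g x) - l * cmod (z n x) powr p)) \<longlonglongrightarrow> (LINT x|M. 0)"
    if l: "l > 0" for l
  proof (rule integral_dominated_convergence[where w = "\<lambda>x. l powr (- (q / p)) * cmod (g x) powr q"])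
    show "integrable M (\<lambda>x. l powr (- (q / p)) * cmod (g x) powr q)" using g by simp
    show "AE x in M. norm (max 0 (cmod (z n x * g x) - l * cmod (z n x) powr p)) \<le> l powr (- (q / p)) * cmod (g x) powr q" for n
    proof (rule AE_I2)
      fix x
      show "norm (max 0 (cmod (z n x * g x) - l * cmod (z n x) powr p)) \<le> l powr (- (q / p)) * cmod (g x) powr q"
        using young_weighted[OF pq, of "cmod (z n x)" "cmod (g x)" l] l by (auto simp: norm_mult max_def)
    qed
    show "AE x in M. (\<lambda>n. max 0 (cmod (z n x * g x) - l * cmod (z n x) powr p)) \<longlonglongrightarrow> 0"
      using lim
    proof eventually_elim
      case (elim x)
      have z0: "(\<lambda>n. z n x) \<longlonglongrightarrow> 0" using elim unfolding z_def by (simp add: LIM_zero)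
      have "(\<lambda>n. cmod (z n x) powr p) \<longlonglongrightarrow> 0 powr p"
        using tendsto_norm[OF z0] pq by (intro tendsto_powr2) auto
      then have "(\<lambda>n. max 0 (cmod (z n x * g x) - l * cmod (z n x) powr p)) \<longlonglongrightarrow> max 0 (cmod (0 * g x) - l * 0)"
        using pq by (intro tendsto_intros z0) auto
      then show ?case by simp
    qed
  qed auto
  have "(\<lambda>n. LINT x|M. cmod (z n x * g x)) \<longlonglongrightarrow> 0"
  proof (rule LIMSEQ_I)
    fix e :: real assume e: "e > 0"
    define K where "K = 2 powr p * (2 * B)"
    have "K \<ge> 0" using B by (simp add: K_def)
    define l where "l = e / 2 / (K + 1)"
    have l: "l > 0" "l * (2 powr p * (2 * B)) < e / 2"
      unfolding K_def[symmetric] using \<open>K \<ge> 0\<close> e by (auto simp: l_def field_simps)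
    from LIMSEQ_D[OF lim0[OF l(1)], of "e / 2"] e obtain N where N:
      "\<And>n. n \<ge> N \<Longrightarrow> norm (LINT x|M. max 0 (cmod (z n x * g x) - l * cmod (z n x) powr p)) < e / 2" by auto
    show "\<exists>N. \<forall>n\<ge>N. norm ((LINT x|M. cmod (z n x * g x)) - 0) < e"
    proof (intro exI allI impI)
      fix n assume n: "n \<ge> N"
      have mi: "integrable M (\<lambda>x. max 0 (cmod (z n x * g x) - l * cmod (z n x) powr p))"
        using zg zi by (intro integrable_max) auto
      have "(LINT x|M. cmod (z n x * g x)) \<le>
          (LINT x|M. max 0 (cmod (z n x * g x) - l * cmod (z n x) powr p) + l * cmod (z n x) powr p)"
        using zg zi mi by (intro integral_mono) auto
      also have "\<dots> = (LINT x|M. max 0 (cmod (z n x * g x) - l * cmod (z n x) powr p)) + l * (LINT x|M. cmod (z n x) powr p)"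
        using mi zi by simp
      also have "\<dots> < e / 2 + e / 2"
      proof (rule add_strict_mono)
        show "(LINT x|M. max 0 (cmod (z n x * g x) - l * cmod (z n x) powr p)) < e / 2"
          using N[OF n] by simp
        show "l * (LINT x|M. cmod (z n x) powr p) < e / 2"
          by (rule le_less_trans[OF mult_left_mono[OF zB] l(2)]) (use l in simp)
      qed
      finally show "norm ((LINT x|M. cmod (z n x * g x)) - 0) < e"
        by simp
    qed
  qed
  then have "(\<lambda>n. LINT x|M. z n x * g x) \<longlonglongrightarrow> 0"
    by (rule Lim_null_comparison[rotated]) (auto intro!: always_eventually integral_norm_bound)
  moreover have "(LINT x|M. z n x * g x) = (LINT x|M. y n x * g x) - (LINT x|M. f x * g x)" for n
    using yg fg by (simp add: z_def left_diff_distrib)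
  ultimately show ?thesis by (simp add: LIM_zero_iff)
qed

section \<open>Weak sequential compactness in \<open>L\<^sup>p\<close>\<close>

text \<open>
  The defect in the triangle inequality controls the angle between two vectors.  This is the strict
  convexity behind the compactness theorem below.
\<close>

lemma norm_add_defect_ge_sgn_dist:
  fixes a b :: "'a::real_inner"
  assumes "norm a \<ge> 1" "norm b \<ge> 1"
  shows "(norm (sgn a - sgn b))\<^sup>2 / 4 \<le> norm a + norm b - norm (a + b)"
proof -
  define d where "d = (norm (sgn a - sgn b))\<^sup>2"
  have pos: "norm a > 0" "norm b > 0" using assms by linarith+
  have "d = 2 - 2 * (inner a b / (norm a * norm b))"
  proof -
    have "norm (sgn a) = 1" "norm (sgn b) = 1" using pos by (auto simp: norm_sgn)
    then have "inner (sgn a) (sgn a) = 1" "inner (sgn b) (sgn b) = 1"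
      by (simp_all add: dot_square_norm)
    then have "d = 2 - 2 * inner (sgn a) (sgn b)"
      unfolding d_def by (simp add: power2_norm_eq_inner inner_diff inner_commute)
    then show ?thesis by (simp add: sgn_div_norm field_simps)
  qed
  then have d: "norm a * norm b * d = 2 * (norm a * norm b - inner a b)"
    using pos by (simp add: field_simps)
  have eq: "(norm a + norm b - norm (a + b)) * (norm a + norm b + norm (a + b)) = norm a * norm b * d"
  proof -
    have "(norm (a + b))\<^sup>2 = (norm a)\<^sup>2 + (norm b)\<^sup>2 + 2 * inner a b"
      by (simp add: power2_norm_eq_inner inner_add inner_commute)
    then show ?thesis unfolding d by (simp add: power2_eq_square algebra_simps)
  qed
  have ab: "(norm a + norm b) / 2 \<le> norm a * norm b"
  proof -
    have "0 \<le> (norm a - 1) * norm b + (norm b - 1) * norm a"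
      using assms by (intro add_nonneg_nonneg mult_nonneg_nonneg) auto
    then show ?thesis by (simp add: algebra_simps)
  qed
  have "d / 4 * (norm a + norm b + norm (a + b)) \<le> d / 4 * (2 * (norm a + norm b))"
    using norm_triangle_ineq[of a b] by (intro mult_left_mono) (auto simp: d_def)
  also have "\<dots> = d * ((norm a + norm b) / 2)" by simp
  also have "\<dots> \<le> d * (norm a * norm b)"
    using ab by (intro mult_left_mono) (auto simp: d_def)
  also have "\<dots> = (norm a + norm b - norm (a + b)) * (norm a + norm b + norm (a + b))"
    unfolding eq by simp
  finally have "d / 4 \<le> norm a + norm b - norm (a + b)"
    using pos by (simp add: add_pos_nonneg)
  then show ?thesis by (simp add: d_def)
qed

text \<open>
  The series of the integrals of \<open>4\<^sup>k w |s\<^sub>k - s\<^bsub>k+1\<^esub>|\<^sup>2\<close> converges; so almost everywhere these functions tend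
  to \<open>0\<close> and the increments are eventually below \<open>2\<^sup>-\<^sup>k\<close>.
\<close>

lemma AE_convergent_if_summable_increments:
  fixes s :: "nat \<Rightarrow> 'a \<Rightarrow> 'b::{banach, second_countable_topology}" and w :: "'a \<Rightarrow> real"
  assumes [measurable]: "\<And>k. s k \<in> borel_measurable M" "w \<in> borel_measurable M"
    and w: "\<And>x. w x > 0"
    and int: "\<And>k. integrable M (\<lambda>x. w x * (norm (s k x - s (Suc k) x))\<^sup>2)"
    and le: "\<And>k. (LINT x|M. w x * (norm (s k x - s (Suc k) x))\<^sup>2) \<le> C * (1 / 8) ^ k"
  shows "AE x in M. convergent (\<lambda>k. s k x)"
proof -
  define h where "h k x = 4 ^ k * (w x * (norm (s k x - s (Suc k) x))\<^sup>2)" for k x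
  have [measurable]: "h k \<in> borel_measurable M" for k unfolding h_def by measurable
  have h0: "h k x \<ge> 0" for k x using w[of x] by (simp add: h_def)
  have C: "C \<ge> 0" using order_trans[OF _ le[of 0]] w by (simp add: less_imp_le)
  have nh: "(\<integral>\<^sup>+x. ennreal (h k x) \<partial>M) \<le> ennreal (C * (1 / 2) ^ k)" for k
  proof -
    have "(\<integral>\<^sup>+x. ennreal (h k x) \<partial>M) = ennreal (LINT x|M. h k x)"
      using int h0 by (intro nn_integral_eq_integral) (auto simp: h_def)
    also have "(LINT x|M. h k x) = 4 ^ k * (LINT x|M. w x * (norm (s k x - s (Suc k) x))\<^sup>2)"
      unfolding h_def by simp
    also have "\<dots> \<le> 4 ^ k * (C * (1 / 8) ^ k)" by (intro mult_left_mono le) auto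
    also have "\<dots> = C * (1 / 2) ^ k"
      by (simp add: power_divide field_simps flip: power_mult_distrib)
    finally show ?thesis by (simp add: ennreal_leI)
  qed
  have "(\<integral>\<^sup>+x. (\<Sum>k. ennreal (h k x)) \<partial>M) = (\<Sum>k. \<integral>\<^sup>+x. ennreal (h k x) \<partial>M)"
    by (rule nn_integral_suminf) auto
  also have "\<dots> \<le> (\<Sum>k. ennreal (C * (1 / 2) ^ k))"
    by (intro suminf_le nh) auto
  also have "\<dots> = ennreal (\<Sum>k. C * (1 / 2) ^ k)"
    using C by (intro suminf_ennreal2 summable_mult) (auto intro!: summable_geometric)
  finally have "(\<integral>\<^sup>+x. (\<Sum>k. ennreal (h k x)) \<partial>M) \<noteq> \<infinity>"
    by (auto simp: top_unique)
  then have "AE x in M. (\<Sum>k. ennreal (h k x)) \<noteq> \<infinity>"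
    by (intro nn_integral_PInf_AE) auto
  then show ?thesis
  proof eventually_elim
    case (elim x)
    have "summable (\<lambda>k. h k x)" using elim h0 by (intro summable_suminf_not_top) auto
    then have "(\<lambda>k. h k x) \<longlonglongrightarrow> 0" by (rule summable_LIMSEQ_zero)
    then have ev: "eventually (\<lambda>k. h k x < w x) sequentially"
      using w by (rule order_tendstoD)
    have "summable (\<lambda>k. s (Suc k) x - s k x)"
    proof (rule summable_comparison_test_ev[where g = "\<lambda>k. (1 / 2) ^ k"])
      show "eventually (\<lambda>k. norm (s (Suc k) x - s k x) \<le> (1 / 2) ^ k) sequentially"
        using ev
      proof eventually_elim
        case (elim k)
        have "4 ^ k * (norm (s k x - s (Suc k) x))\<^sup>2 < 1"
          using elim w[of x] by (simp add: h_def mult.left_commute[of _ "w x"])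
        then have "(2 ^ k * norm (s k x - s (Suc k) x))\<^sup>2 < 1\<^sup>2"
          by (simp add: power_mult_distrib power2_eq_square[of "2 ^ k"] flip: power_mult_distrib[of 2 2 k])
        then have "2 ^ k * norm (s k x - s (Suc k) x) < 1"
          by (rule power2_less_imp_less) simp
        then show ?case by (simp add: norm_minus_commute power_divide field_simps)
      qed
    qed (auto intro!: summable_geometric)
    then have "convergent (\<lambda>n. \<Sum>k<n. s (Suc k) x - s k x)" by (simp add: summable_iff_convergent)
    then have "convergent (\<lambda>n. s n x - s 0 x)" by (simp add: sum_lessThan_telescope[of "\<lambda>n. s n x"])
    then have "convergent (\<lambda>n. (s n x - s 0 x) + s 0 x)" by (intro convergent_add convergent_const)
    then show ?case by simp
  qed
qed


text \<open>
  A bounded sequence in \<open>L\<^sup>p\<close>, \<open>p > 1\<close>, has a weak limit, as far as countably many test functions can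
  see it.  Instead of a diagonal subsequence and duality, the proof uses convexity.  Let \<open>K n\<close> be the convex
  set of the functions in the ball of \<open>L\<^sup>p\<close> whose pairings with the first \<open>n\<close> test functions are within
  \<open>1 / (n + 1)\<close> of the prescribed values.  Choose near minimisers \<open>u\<^sub>k\<close> of the strictly convex functional
  \<open>J u = \<integral> w sqrt (1 + |u|\<^sup>2)\<close>, where \<open>w\<close> is a positive integrable weight, over sets \<open>K (r k)\<close>.  Their midpoints stay in these sets, hence the vectors
  \<open>(1, u\<^sub>k)\<close>, whose norms \<open>J\<close> integrates, have small convexity defect and converge in direction almost
  everywhere.  The direction determines \<open>u\<^sub>k\<close> unless \<open>|u\<^sub>k|\<close> tends to infinity, which Fatou's lemma excludes.
  So \<open>u\<^sub>k\<close> converges almost everywhere, and its limit has the prescribed pairings.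
\<close>

lemma Lp_weak_compactness:
  fixes y g :: "nat \<Rightarrow> 'a \<Rightarrow> complex" and p q B :: real and c :: "nat \<Rightarrow> complex"
  assumes M: "sigma_finite_measure M" and pq: "p > 1" "q > 1" "1 / p + 1 / q = 1"
    and my[measurable]: "\<And>n. y n \<in> borel_measurable M" and mg[measurable]: "\<And>j. g j \<in> borel_measurable M"
    and y: "\<And>n. integrable M (\<lambda>x. cmod (y n x) powr p)" "\<And>n. (LINT x|M. cmod (y n x) powr p) \<le> B"
    and g: "\<And>j. integrable M (\<lambda>x. cmod (g j x) powr q)"
    and c: "\<And>j. (\<lambda>n. LINT x|M. y n x * g j x) \<longlonglongrightarrow> c j"
  obtains f where "f \<in> borel_measurable M" "integrable M (\<lambda>x. cmod (f x) powr p)"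
    "(LINT x|M. cmod (f x) powr p) \<le> B" "\<And>j. (LINT x|M. f x * g j x) = c j"
proof -
  interpret sigma_finite_measure M by (rule M)
  obtain w :: "'a \<Rightarrow> real" where [measurable]: "w \<in> borel_measurable M" and w0: "\<And>x. w x > 0"
    and w1: "\<And>x. w x \<le> 1" and wi: "integrable M w"
    using obtain_positive_integrable_function by blast
  \<comment> \<open>Prepending the coordinate \<open>1\<close> keeps the vectors away from the origin and makes their norm strictly convex in \<open>a\<close>.\<close>
  define A where "A a = (1::real, a)" for a :: complex
  have A1: "norm (A a) \<ge> 1" and A_le: "norm (A a) \<le> 1 + cmod a" and A_ge: "cmod a \<le> norm (A a)" for a
    using norm_fst_le[of "1::real" a] norm_snd_le[of a "1::real"] norm_Pair_le[of "1::real" a] by (auto simp: A_def)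
  have A0: "A a \<noteq> 0" for a by (simp add: A_def zero_prod_def)
  have [measurable]: "A \<in> borel_measurable borel"
    unfolding A_def by (intro borel_measurable_continuous_onI continuous_intros)
  have wA_le: "w x * norm (A a) \<le> 2 * w x + cmod a powr p" for x a
  proof -
    have "cmod a \<le> 1 + cmod a powr p"
      by (rule le_one_plus_powr) (use pq in auto)
    then have "norm (A a) \<le> 2 + cmod a powr p" using A_le[of a] by simp
    then have "w x * norm (A a) \<le> w x * (2 + cmod a powr p)"
      using w0[of x] by (intro mult_left_mono) auto
    also have "\<dots> \<le> 2 * w x + cmod a powr p"
      using w0[of x] w1[of x] mult_right_mono[of "w x" 1 "cmod a powr p"] by (simp add: algebra_simps)
    finally show ?thesis .
  qed
  define Lp where "Lp = {u \<in> borel_measurable M. integrable M (\<lambda>x. cmod (u x) powr p)}"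
  define J where "J u = (LINT x|M. w x * norm (A (u x)))" for u
  have Ji: "integrable M (\<lambda>x. w x * norm (A (u x)))" if "u \<in> Lp" for u
  proof (rule Bochner_Integration.integrable_bound[of _ "\<lambda>x. 2 * w x + cmod (u x) powr p"])
    show "integrable M (\<lambda>x. 2 * w x + cmod (u x) powr p)" using that wi by (auto simp: Lp_def)
    have [measurable]: "u \<in> borel_measurable M" using that by (simp add: Lp_def)
    show "(\<lambda>x. w x * norm (A (u x))) \<in> borel_measurable M" by measurable
    show "AE x in M. norm (w x * norm (A (u x))) \<le> norm (2 * w x + cmod (u x) powr p)"
      using wA_le w0 by (intro AE_I2) (simp add: abs_mult less_imp_le order_trans[OF _ abs_ge_self])
  qed
  have J0: "J u \<ge> 0" for u unfolding J_def using w0 by (simp add: less_imp_le)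
  define K where "K n = {u \<in> Lp. (LINT x|M. cmod (u x) powr p) \<le> B \<and>
    (\<forall>j<n. cmod ((LINT x|M. u x * g j x) - c j) \<le> 1 / Suc n)}" for n
  have K_Lp: "u \<in> Lp" if "u \<in> K n" for u n using that by (simp add: K_def)
  have K_mono: "K n \<subseteq> K m" if "m \<le> n" for m n
  proof
    fix u assume u: "u \<in> K n"
    have "1 / Suc n \<le> 1 / Suc m" using that by (intro divide_left_mono) auto
    then have "cmod ((LINT x|M. u x * g j x) - c j) \<le> 1 / Suc m" if "j < m" for j
      using u that \<open>m \<le> n\<close> unfolding K_def by (elim order_trans[rotated]) simp
    then show "u \<in> K m" using u unfolding K_def by blast
  qed
  have K_ne: "K n \<noteq> {}" for n
  proof -
    have "eventually (\<lambda>i. \<forall>j\<in>{..<n}. dist (LINT x|M. y i x * g j x) (c j) < 1 / Suc n) sequentially"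
      using c by (intro eventually_ball_finite ballI tendstoD) auto
    then obtain i where "\<forall>j\<in>{..<n}. dist (LINT x|M. y i x * g j x) (c j) < 1 / Suc n"
      by (auto simp: eventually_sequentially)
    then have "y i \<in> K n" using y unfolding K_def Lp_def dist_norm by (auto intro: less_imp_le)
    then show ?thesis by blast
  qed
  have K_mid: "(\<lambda>x. (u x + v x) / 2) \<in> K n" if u: "u \<in> K n" and v: "v \<in> K n" for u v n
  proof -
    have [measurable]: "u \<in> borel_measurable M" "v \<in> borel_measurable M" using u v by (auto simp: K_def Lp_def)
    have ui: "integrable M (\<lambda>x. cmod (u x) powr p)" and vi: "integrable M (\<lambda>x. cmod (v x) powr p)"
      using u v by (auto simp: K_def Lp_def)
    have le: "cmod ((u x + v x) / 2) powr p \<le> (cmod (u x) powr p + cmod (v x) powr p) / 2" for x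
    proof -
      have "cmod ((u x + v x) / 2) powr p \<le> ((cmod (u x) + cmod (v x)) / 2) powr p"
        using pq norm_triangle_ineq[of "u x" "v x"] by (intro powr_mono2) (auto simp: norm_divide)
      then show ?thesis using powr_midpoint[of p "cmod (u x)" "cmod (v x)"] pq by simp
    qed
    have int: "integrable M (\<lambda>x. cmod ((u x + v x) / 2) powr p)"
      by (rule Bochner_Integration.integrable_bound[of _ "\<lambda>x. (cmod (u x) powr p + cmod (v x) powr p) / 2"])
        (use ui vi le in \<open>auto simp del: norm_divide_numeral\<close>)
    have "(LINT x|M. cmod ((u x + v x) / 2) powr p) \<le> (LINT x|M. (cmod (u x) powr p + cmod (v x) powr p) / 2)"
      using int ui vi le by (intro integral_mono) auto
    also have "\<dots> = ((LINT x|M. cmod (u x) powr p) + (LINT x|M. cmod (v x) powr p)) / 2"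
      using ui vi by simp
    also have "\<dots> \<le> B" using u v by (auto simp: K_def)
    finally have B: "(LINT x|M. cmod ((u x + v x) / 2) powr p) \<le> B" .
    have "cmod ((LINT x|M. (u x + v x) / 2 * g j x) - c j) \<le> 1 / Suc n" if j: "j < n" for j
    proof -
      have ug: "integrable M (\<lambda>x. u x * g j x)" by (rule integrable_mult_Lp_Lq(1)[OF pq _ _ ui g]) auto
      have vg: "integrable M (\<lambda>x. v x * g j x)" by (rule integrable_mult_Lp_Lq(1)[OF pq _ _ vi g]) auto
      have "(LINT x|M. (u x + v x) / 2 * g j x) = (LINT x|M. (u x * g j x + v x * g j x) / 2)"
        by (simp add: algebra_simps add_divide_distrib)
      also have "\<dots> = ((LINT x|M. u x * g j x) + (LINT x|M. v x * g j x)) / 2" using ug vg by simp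
      finally have eq: "(LINT x|M. (u x + v x) / 2 * g j x) - c j =
          (((LINT x|M. u x * g j x) - c j) + ((LINT x|M. v x * g j x) - c j)) / 2"
        by (simp add: field_simps)
      have "cmod ((LINT x|M. (u x + v x) / 2 * g j x) - c j) \<le>
          (cmod ((LINT x|M. u x * g j x) - c j) + cmod ((LINT x|M. v x * g j x) - c j)) / 2"
        unfolding eq norm_divide norm_numeral by (intro divide_right_mono norm_triangle_ineq) simp
      also have "\<dots> \<le> (1 / Suc n + 1 / Suc n) / 2"
        using u v j unfolding K_def by (intro divide_right_mono add_mono) auto
      also have "\<dots> = 1 / Suc n" by (rule field_sum_of_halves[folded add_divide_distrib])
      finally show ?thesis .
    qed
    then show ?thesis using int B unfolding K_def Lp_def by auto
  qed
  define d where "d n = Inf (J ` K n)" for n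
  have bdd: "bdd_below (J ` K n)" for n by (intro bdd_belowI[of _ 0]) (auto simp: J0)
  have d_le: "d n \<le> J u" if "u \<in> K n" for n u
    unfolding d_def using that bdd by (intro cInf_lower) auto
  have d_mono: "incseq d"
    unfolding d_def using K_mono bdd K_ne by (intro incseq_def[THEN iffD2] allI impI cInf_superset_mono) auto
  have d_bdd: "d n \<le> 2 * (LINT x|M. w x) + B" for n
  proof -
    obtain u where u: "u \<in> K n" using K_ne by blast
    have "J u \<le> (LINT x|M. 2 * w x + cmod (u x) powr p)"
      unfolding J_def
    proof (intro integral_mono Ji K_Lp[OF u])
      show "integrable M (\<lambda>x. 2 * w x + cmod (u x) powr p)" using u wi by (auto simp: K_def Lp_def)
    qed (rule wA_le)
    also have "\<dots> = 2 * (LINT x|M. w x) + (LINT x|M. cmod (u x) powr p)"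
      using wi u by (auto simp: K_def Lp_def)
    also have "\<dots> \<le> 2 * (LINT x|M. w x) + B" using u by (auto simp: K_def)
    finally show ?thesis using d_le[OF u] by linarith
  qed
  obtain L where L: "d \<longlonglongrightarrow> L" "\<And>n. d n \<le> L"
    using incseq_convergent[OF d_mono] d_bdd by metis
  \<comment> \<open>The infima increase to \<open>L\<close>, so indices may be chosen at which they are already close to \<open>L\<close>.\<close>
  have ex: "\<exists>n u. n \<ge> k \<and> L - (1 / 8) ^ k \<le> d n \<and> u \<in> K n \<and> J u \<le> L + (1 / 8) ^ k" for k
  proof -
    have "eventually (\<lambda>n. L - (1 / 8) ^ k < d n) sequentially"
      by (rule order_tendstoD[OF L(1)]) simp
    then have "eventually (\<lambda>n. L - (1 / 8) ^ k < d n \<and> n \<ge> k) sequentially"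
      by (intro eventually_conj eventually_ge_at_top)
    then obtain n where n: "L - (1 / 8) ^ k < d n" "n \<ge> k"
      by (auto simp: eventually_sequentially)
    have "Inf (J ` K n) < d n + (1 / 8) ^ k" by (simp add: d_def)
    then obtain u where "u \<in> K n" "J u < d n + (1 / 8) ^ k"
      using K_ne by (subst (asm) cInf_less_iff) (auto intro: bdd)
    then show ?thesis using n L(2)[of n] by (intro exI[of _ n] exI[of _ u]) auto
  qed
  then obtain r u where r: "\<And>k. r k \<ge> k" "\<And>k. L - (1 / 8) ^ k \<le> d (r k)"
    and u: "\<And>k. u k \<in> K (r k)" "\<And>k. J (u k) \<le> L + (1 / 8) ^ k" by metis
  have uL: "u k \<in> Lp" for k using K_Lp[OF u(1)] .
  have [measurable]: "u k \<in> borel_measurable M" for k using uL by (simp add: Lp_def)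
  define s where "s k x = sgn (A (u k x))" for k x
  have ms[measurable]: "s k \<in> borel_measurable M" for k unfolding s_def sgn_div_norm by measurable
  have pw: "w x * (norm (s k x - s (Suc k) x))\<^sup>2 \<le>
     4 * (w x * norm (A (u k x)) + w x * norm (A (u (Suc k) x)) - 2 * (w x * norm (A ((u k x + u (Suc k) x) / 2))))" for k x
  proof -
    have "A (u k x) + A (u (Suc k) x) = 2 *\<^sub>R A ((u k x + u (Suc k) x) / 2)"
      by (simp add: A_def scaleR_conv_of_real)
    then have "norm (A (u k x) + A (u (Suc k) x)) = 2 * norm (A ((u k x + u (Suc k) x) / 2))"
      by simp
    then have "(norm (s k x - s (Suc k) x))\<^sup>2 / 4 \<le>
      norm (A (u k x)) + norm (A (u (Suc k) x)) - 2 * norm (A ((u k x + u (Suc k) x) / 2))"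
      unfolding s_def using norm_add_defect_ge_sgn_dist[OF A1[of "u k x"] A1[of "u (Suc k) x"]] by simp
    then have "(norm (s k x - s (Suc k) x))\<^sup>2 \<le>
      4 * (norm (A (u k x)) + norm (A (u (Suc k) x)) - 2 * norm (A ((u k x + u (Suc k) x) / 2)))"
      by simp
    then have "w x * (norm (s k x - s (Suc k) x))\<^sup>2 \<le>
      w x * (4 * (norm (A (u k x)) + norm (A (u (Suc k) x)) - 2 * norm (A ((u k x + u (Suc k) x) / 2))))"
      using w0[of x] by (intro mult_left_mono) auto
    then show ?thesis by (simp add: algebra_simps)
  qed
  define mid where "mid k x = (u k x + u (Suc k) x) / 2" for k x
  define m where "m k = min (r k) (r (Suc k))" for k
  have mid: "mid k \<in> K (m k)" for k
    unfolding mid_def m_def using u(1)[of k] u(1)[of "Suc k"] K_mono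
    by (intro K_mid) (meson min.cobounded1 min.cobounded2 subsetD)+
  have si: "integrable M (\<lambda>x. w x * (norm (s k x - s (Suc k) x))\<^sup>2)" for k
  proof (rule Bochner_Integration.integrable_bound[of _ "\<lambda>x. 4 * w x"])
    have "(norm (s k x - s (Suc k) x))\<^sup>2 \<le> 2\<^sup>2" for x
    proof -
      have "norm (s k x - s (Suc k) x) \<le> norm (s k x) + norm (s (Suc k) x)" by (rule norm_triangle_ineq4)
      also have "\<dots> \<le> 2" by (auto simp: s_def norm_sgn)
      finally show ?thesis by (intro power_mono) auto
    qed
    then show "AE x in M. norm (w x * (norm (s k x - s (Suc k) x))\<^sup>2) \<le> norm (4 * w x)"
      using w0 by (auto simp: abs_mult mult.commute intro!: AE_I2 mult_left_mono)
  qed (use wi in auto)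
  have "AE x in M. convergent (\<lambda>k. s k x)"
  proof (rule AE_convergent_if_summable_increments[where w = w and C = 16])
    show "integrable M (\<lambda>x. w x * (norm (s k x - s (Suc k) x))\<^sup>2)" for k by (rule si)
    fix k
    have "(LINT x|M. w x * (norm (s k x - s (Suc k) x))\<^sup>2) \<le>
      (LINT x|M. 4 * (w x * norm (A (u k x)) + w x * norm (A (u (Suc k) x)) - 2 * (w x * norm (A (mid k x)))))"
      using si pw Ji[OF uL] Ji[OF K_Lp[OF mid]] by (intro integral_mono) (auto simp: mid_def)
    also have "\<dots> = 4 * (J (u k) + J (u (Suc k)) - 2 * J (mid k))"
      unfolding J_def using Ji[OF uL] Ji[OF K_Lp[OF mid]] by simp
    also have "\<dots> \<le> 4 * ((L + (1 / 8) ^ k) + (L + (1 / 8) ^ k) - 2 * (L - (1 / 8) ^ k))"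
    proof -
      define a b where "a = ((1::real) / 8) ^ k" and "b = ((1::real) / 8) ^ Suc k"
      note ab_def = a_def b_def
      have e: "b \<le> a" unfolding ab_def by (intro power_decreasing) auto
      have "L - a \<le> d (m k)"
        using r(2)[of k, folded ab_def] r(2)[of "Suc k", folded ab_def] e unfolding m_def min_def
        by (cases "r k \<le> r (Suc k)") simp_all
      then have "L - a \<le> J (mid k)" using d_le[OF mid[of k]] by linarith
      then show ?thesis
        using u(2)[of k, folded ab_def] u(2)[of "Suc k", folded ab_def] e
        unfolding a_def[symmetric] by (intro mult_left_mono) auto
    qed
    finally show "(LINT x|M. w x * (norm (s k x - s (Suc k) x))\<^sup>2) \<le> 16 * (1 / 8) ^ k" by simp
  qed (auto simp: w0)
  moreover have "AE x in M. liminf (\<lambda>k. ennreal (cmod (u k x) powr p)) \<noteq> \<infinity>"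
  proof (rule nn_integral_PInf_AE)
    have "(\<integral>\<^sup>+x. liminf (\<lambda>k. ennreal (cmod (u k x) powr p)) \<partial>M) \<le> liminf (\<lambda>k. \<integral>\<^sup>+x. ennreal (cmod (u k x) powr p) \<partial>M)"
      by (rule nn_integral_liminf) auto
    also have "\<dots> \<le> liminf (\<lambda>k. ennreal B)"
      using u(1) by (intro Liminf_mono always_eventually allI) (simp add: nn_integral_eq_integral ennreal_leI K_def Lp_def)
    finally have "(\<integral>\<^sup>+x. liminf (\<lambda>k. ennreal (cmod (u k x) powr p)) \<partial>M) \<le> ennreal B" by (simp add: Liminf_const)
    then show "(\<integral>\<^sup>+x. liminf (\<lambda>k. ennreal (cmod (u k x) powr p)) \<partial>M) \<noteq> \<infinity>" by (auto simp: top_unique)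
  qed auto
  ultimately have conv: "AE x in M. (\<lambda>k. u k x) \<longlonglongrightarrow> lim (\<lambda>k. u k x)"
  proof eventually_elim
    case (elim x)
    obtain l where l: "(\<lambda>k. s k x) \<longlonglongrightarrow> l" using elim(1) by (auto simp: convergent_def)
    have fst_s: "fst (s k x) = inverse (norm (A (u k x)))" and snd_s: "snd (s k x) = u k x /\<^sub>R norm (A (u k x))" for k
      by (simp_all add: s_def sgn_div_norm A_def)
    have l1: "(\<lambda>k. inverse (norm (A (u k x)))) \<longlonglongrightarrow> fst l" using tendsto_fst[OF l] by (simp add: fst_s)
    have l2: "(\<lambda>k. u k x /\<^sub>R norm (A (u k x))) \<longlonglongrightarrow> snd l" using tendsto_snd[OF l] by (simp add: snd_s)
    \<comment> \<open>A horizontal limit direction would mean that \<open>|u\<^sub>k|\<close> tends to infinity.\<close>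
    have "fst l \<noteq> 0"
    proof
      assume l0: "fst l = 0"
      have "filterlim (\<lambda>k. inverse (inverse (norm (A (u k x))))) at_top sequentially"
        by (rule filterlim_inverse_at_top[OF l1[unfolded l0]]) (simp add: A0)
      then have "filterlim (\<lambda>k. norm (A (u k x))) at_top sequentially" by simp
      then have "filterlim (\<lambda>k. 1 + cmod (u k x)) at_top sequentially"
        by (rule filterlim_at_top_mono) (use A_le in auto)
      then have "filterlim (\<lambda>k. - 1 + (1 + cmod (u k x))) at_top sequentially"
        by (rule filterlim_tendsto_add_at_top[OF tendsto_const])
      then have "filterlim (\<lambda>k. cmod (u k x)) at_top sequentially" by simp
      moreover from this have "eventually (\<lambda>k. cmod (u k x) \<ge> 1) sequentially"
        by (auto simp: filterlim_at_top)
      then have "eventually (\<lambda>k. cmod (u k x) \<le> cmod (u k x) powr p) sequentially"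
        by eventually_elim (use pq powr_mono[of 1 p] in fastforce)
      ultimately have "filterlim (\<lambda>k. cmod (u k x) powr p) at_top sequentially"
        by (rule filterlim_at_top_mono)
      then have "(\<lambda>k. ennreal (cmod (u k x) powr p)) \<longlonglongrightarrow> \<infinity>"
        by (simp add: ennreal_tendsto_top_eq_at_top)
      then have "liminf (\<lambda>k. ennreal (cmod (u k x) powr p)) = \<infinity>"
        by (intro lim_imp_Liminf) auto
      then show False using elim(2) by simp
    qed
    then have "(\<lambda>k. (u k x /\<^sub>R norm (A (u k x))) /\<^sub>R inverse (norm (A (u k x)))) \<longlonglongrightarrow> snd l /\<^sub>R fst l"
      by (intro tendsto_scaleR tendsto_inverse l1 l2)
    moreover have "(u k x /\<^sub>R norm (A (u k x))) /\<^sub>R inverse (norm (A (u k x))) = u k x" for k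
      by (simp add: A0)
    ultimately show ?case by (simp add: convergent_LIMSEQ_iff[symmetric] convergentI)
  qed
  define f where "f x = lim (\<lambda>k. u k x)" for x
  have mf[measurable]: "f \<in> borel_measurable M" unfolding f_def by (rule borel_measurable_lim_metric) simp
  have ui: "integrable M (\<lambda>x. cmod (u k x) powr p)" "(LINT x|M. cmod (u k x) powr p) \<le> B" for k
    using u(1)[of k] by (auto simp: K_def Lp_def)
  have "f \<in> borel_measurable M" by simp
  moreover have "integrable M (\<lambda>x. cmod (f x) powr p)" "(LINT x|M. cmod (f x) powr p) \<le> B"
    using Lp_Fatou[of p f M u B] pq ui conv by (auto simp: f_def)
  moreover have "(LINT x|M. f x * g j x) = c j" for j
  proof (rule LIMSEQ_unique)
    show "(\<lambda>k. LINT x|M. u k x * g j x) \<longlonglongrightarrow> (LINT x|M. f x * g j x)"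
      using conv by (intro Lp_bounded_AE_imp_weak_tendsto[OF pq _ _ _ ui _ g]) (auto simp: f_def)
    show "(\<lambda>k. LINT x|M. u k x * g j x) \<longlonglongrightarrow> c j"
    proof (rule LIM_zero_cancel, rule Lim_null_comparison[where g = "\<lambda>k. 1 / Suc k"])
      have "cmod ((LINT x|M. u k x * g j x) - c j) \<le> 1 / Suc k" if "k > j" for k
      proof -
        have "cmod ((LINT x|M. u k x * g j x) - c j) \<le> 1 / Suc (r k)"
          using u(1)[of k] r(1)[of k] that unfolding K_def by simp
        also have "\<dots> \<le> 1 / Suc k" using r(1)[of k] by (intro divide_left_mono) auto
        finally show ?thesis .
      qed
      then show "eventually (\<lambda>k. norm ((LINT x|M. u k x * g j x) - c j) \<le> 1 / Suc k) sequentially"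
        using eventually_gt_at_top[of j] by (rule eventually_mono[rotated]) auto
      show "(\<lambda>k. 1 / real (Suc k)) \<longlonglongrightarrow> 0"
        using LIMSEQ_inverse_real_of_nat by (simp add: inverse_eq_divide)
    qed
  qed
  ultimately show ?thesis by (rule that)
qed

section \<open>Lebesgue points and Poisson integrals\<close>

text \<open>
  The Poisson kernel of the upper half-plane at height \<open>b\<close>.
\<close>

definition poisson :: "real \<Rightarrow> real \<Rightarrow> real" where
  "poisson b t = b / (pi * (b\<^sup>2 + t\<^sup>2))"

lemma poisson_measurable [measurable]: "poisson b \<in> borel_measurable borel"
  unfolding poisson_def by measurable

lemma poisson_nonneg: "b > 0 \<Longrightarrow> poisson b t \<ge> 0"
  by (simp add: poisson_def)

lemma nn_integral_poisson:
  assumes b: "b > 0"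
  shows "(\<integral>\<^sup>+t. ennreal (poisson b (t - c)) \<partial>lborel) = 1"
proof -
  let ?I = "\<integral>\<^sup>+t. ennreal (poisson b t) * indicator {0..} t \<partial>lborel"
  have half: "?I = ennreal (1 / 2 - arctan (0 / b) / pi)"
  proof (rule nn_integral_FTC_atLeast)
    fix x :: real
    show "((\<lambda>t. arctan (t / b) / pi) has_real_derivative poisson b x) (at x)"
      using b by (auto intro!: derivative_eq_intros simp: poisson_def divide_simps power2_eq_square) 
    show "poisson b x \<ge> 0" using b by (rule poisson_nonneg)
    have "filterlim (\<lambda>t. t / b) at_top at_top" using b by real_asymp
    then have "((\<lambda>t. arctan (t / b) / pi) \<longlongrightarrow> (pi / 2) / pi) at_top"
      by (intro tendsto_divide tendsto_const filterlim_compose[OF tendsto_arctan_at_top]) auto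
    then show "((\<lambda>t. arctan (t / b) / pi) \<longlongrightarrow> 1 / 2) at_top" by simp
  qed auto
  have "(\<integral>\<^sup>+t. ennreal (poisson b (t - c)) \<partial>lborel) = (\<integral>\<^sup>+t. ennreal (poisson b t) \<partial>lborel)"
    by (subst nn_integral_real_affine[where c = 1 and t = c]) auto
  also have "\<dots> = (\<integral>\<^sup>+t. ennreal (poisson b t) * indicator {0..} t + ennreal (poisson b t) * indicator {..0} t \<partial>lborel)"
    by (rule nn_integral_cong_AE, rule AE_mp[OF AE_lborel_singleton[of 0]]) (auto simp: indicator_def)
  also have "\<dots> = ?I + (\<integral>\<^sup>+t. ennreal (poisson b t) * indicator {..0} t \<partial>lborel)"
    by (rule nn_integral_add) auto
  also have "(\<integral>\<^sup>+t. ennreal (poisson b t) * indicator {..0} t \<partial>lborel) = ?I"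
    by (subst nn_integral_real_affine[where c = "-1" and t = 0])
      (auto intro!: nn_integral_cong simp: poisson_def indicator_def)
  also have "?I + ?I = ennreal (1 / 2 + 1 / 2)" unfolding half by (subst ennreal_plus) auto
  also have "\<dots> = 1" by simp
  finally show ?thesis .
qed

lemma integrable_poisson: "b > 0 \<Longrightarrow> integrable lborel (\<lambda>t. poisson b (t - c))"
  by (rule integrableI_nonneg) (auto simp: nn_integral_poisson poisson_nonneg)

lemma integral_poisson: "b > 0 \<Longrightarrow> (LINT t|lborel. poisson b (t - c)) = 1"
  using nn_integral_eq_integral[OF integrable_poisson, of b c] nn_integral_poisson[of b c]
  by (simp add: poisson_nonneg)

lemma one_plus_square_le:
  fixes t c :: real
  shows "1 + t\<^sup>2 \<le> 1 + 2 * c\<^sup>2 + 2 * (t - c)\<^sup>2"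
  using sum_squares_ge_zero[of 0 "t - 2 * c"] by (simp add: power2_eq_square algebra_simps)

lemma poisson_decay:
  assumes b: "b > 0"
  obtains C where "C > 0" "\<And>t. poisson b (t - c) \<le> C / (1 + t\<^sup>2)"
proof
  define K where "K = 2 + (1 + 2 * c\<^sup>2) / b\<^sup>2"
  have K: "K > 0" unfolding K_def by (intro add_pos_nonneg) auto
  show "b * K / pi > 0" using K b by simp
  fix t
  have "1 + t\<^sup>2 \<le> 1 + 2 * c\<^sup>2 + 2 * (t - c)\<^sup>2" by (rule one_plus_square_le)
  also have "\<dots> \<le> K * (b\<^sup>2 + (t - c)\<^sup>2)"
  proof -
    have "K * b\<^sup>2 = 2 * b\<^sup>2 + (1 + 2 * c\<^sup>2)" using b by (simp add: K_def field_simps)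
    moreover have "2 * (t - c)\<^sup>2 \<le> K * (t - c)\<^sup>2" by (intro mult_right_mono) (auto simp: K_def)
    ultimately show ?thesis unfolding distrib_left using zero_le_power2[of b] by linarith
  qed
  finally have le: "1 + t\<^sup>2 \<le> K * (b\<^sup>2 + (t - c)\<^sup>2)" .
  have p: "1 + t\<^sup>2 > 0" "b\<^sup>2 + (t - c)\<^sup>2 > 0" using b by (auto intro: add_pos_nonneg)
  have "poisson b (t - c) = b / pi * (1 / (b\<^sup>2 + (t - c)\<^sup>2))" by (simp add: poisson_def)
  also have "\<dots> \<le> b / pi * (K / (1 + t\<^sup>2))"
    using b le p by (intro mult_left_mono) (auto simp: divide_simps mult.commute)
  finally show "poisson b (t - c) \<le> b * K / pi / (1 + t\<^sup>2)" by simp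
qed

text \<open>
  Inside a cone of opening \<open>\<alpha>\<close> the kernel may be centred at the vertex, at the price of a
  constant factor: this reduces non-tangential limits to perpendicular ones.
\<close>

lemma poisson_shift_le:
  assumes b: "b > 0" and a: "\<bar>a\<bar> \<le> \<alpha> * b"
  shows "poisson b (t - a) \<le> (2 + 2 * \<alpha>\<^sup>2) * poisson b t"
proof -
  have "a\<^sup>2 \<le> (\<alpha> * b)\<^sup>2" using a by (rule abs_le_square_iff[THEN iffD1, OF order_trans]) (rule abs_ge_self)
  then have "t\<^sup>2 \<le> 2 * \<alpha>\<^sup>2 * b\<^sup>2 + 2 * (t - a)\<^sup>2"
    using one_plus_square_le[of t a] by (simp add: power_mult_distrib)
  moreover have "(2 + 2 * \<alpha>\<^sup>2) * (b\<^sup>2 + (t - a)\<^sup>2) =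
      2 * b\<^sup>2 + 2 * \<alpha>\<^sup>2 * b\<^sup>2 + 2 * (t - a)\<^sup>2 + 2 * \<alpha>\<^sup>2 * (t - a)\<^sup>2" by (simp add: algebra_simps)
  moreover have "b\<^sup>2 \<ge> 0" "\<alpha>\<^sup>2 * (t - a)\<^sup>2 \<ge> 0" by auto
  ultimately have le: "b\<^sup>2 + t\<^sup>2 \<le> (2 + 2 * \<alpha>\<^sup>2) * (b\<^sup>2 + (t - a)\<^sup>2)" by linarith
  have p: "b\<^sup>2 + t\<^sup>2 > 0" "b\<^sup>2 + (t - a)\<^sup>2 > 0" using b by (auto intro: add_pos_nonneg)
  have "poisson b (t - a) = b / pi * (1 / (b\<^sup>2 + (t - a)\<^sup>2))" by (simp add: poisson_def)
  also have "\<dots> \<le> b / pi * ((2 + 2 * \<alpha>\<^sup>2) / (b\<^sup>2 + t\<^sup>2))"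
    using b le p by (intro mult_left_mono) (auto simp: divide_simps mult.commute)
  also have "\<dots> = (2 + 2 * \<alpha>\<^sup>2) * poisson b t" by (simp add: poisson_def mult.commute)
  finally show ?thesis .
qed

text \<open>
  The kernel is dominated by a superposition of interval indicators whose weights shrink by a factor of
  \<open>4\<close> while the intervals double, so bounds for interval means add up.
\<close>

lemma poisson_le_dyadic_sum:
  assumes b: "b > 0"
  shows "ennreal (poisson b t) \<le>
    (\<Sum>k. ennreal (4 / (pi * b) * (1 / 4) ^ k) * indicator {- (2 ^ k * b)..2 ^ k * b} t)" (is "_ \<le> (\<Sum>k. ?c k)")
proof -
  define P where "P k \<longleftrightarrow> \<bar>t\<bar> \<le> 2 ^ k * b" for k :: nat
  obtain n where "\<bar>t\<bar> / b < 2 ^ n" using real_arch_pow[of 2 "\<bar>t\<bar> / b"] by auto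
  then have "P n" using b by (simp add: P_def field_simps)
  define k where "k = (LEAST k. P k)"
  have k: "P k" unfolding k_def by (rule LeastI[of P n]) fact
  have "poisson b t \<le> 4 / (pi * b) * (1 / 4) ^ k"
  proof (cases k)
    case 0
    have "poisson b t \<le> b / (pi * b\<^sup>2)" unfolding poisson_def
      using b by (intro divide_left_mono mult_left_mono mult_pos_pos) (auto intro: add_pos_nonneg)
    also have "\<dots> \<le> 4 / (pi * b)" using b by (simp add: power2_eq_square field_simps)
    finally show ?thesis using 0 by simp
  next
    case (Suc j)
    have "\<not> P j" using not_less_Least[of j P] Suc by (simp add: k_def)
    then have "(2 ^ j * b)\<^sup>2 \<le> \<bar>t\<bar>\<^sup>2" using b by (intro power_mono) (auto simp: P_def)
    moreover have "(2::real) ^ j * 2 ^ j = 4 ^ j" by (simp flip: power_mult_distrib)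
    then have "(2 ^ j * b)\<^sup>2 = 4 ^ j * b\<^sup>2" by (simp add: power_mult_distrib power2_eq_square[of "2 ^ j"])
    ultimately have "4 ^ j * b\<^sup>2 \<le> b\<^sup>2 + t\<^sup>2" by (simp add: add_increasing)
    then have "poisson b t \<le> b / (pi * (4 ^ j * b\<^sup>2))" unfolding poisson_def
      using b by (intro divide_left_mono mult_left_mono mult_pos_pos) (auto intro: add_pos_nonneg)
    also have "\<dots> = 4 / (pi * b) * (1 / 4) ^ k" using b Suc by (simp add: power2_eq_square power_divide field_simps)
    finally show ?thesis .
  qed
  moreover have "indicator {- (2 ^ k * b)..2 ^ k * b} t = (1::ennreal)" using k by (auto simp: P_def abs_le_iff minus_le_iff)
  ultimately have "ennreal (poisson b t) \<le> ?c k" by (simp only: mult_1_right ennreal_leI)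
  also have "\<dots> \<le> (\<Sum>k. ?c k)" using sum_le_suminf[of ?c "{k}"] unfolding sum.insert_remove[OF finite.emptyI] by simp
  finally show ?thesis .
qed

text \<open>
  The deviation is measured by a nonnegative integral, so that the notion makes sense for every \<open>g\<close>.
\<close>

definition lebesgue_point :: "(real \<Rightarrow> complex) \<Rightarrow> real \<Rightarrow> bool" where
  "lebesgue_point g x \<longleftrightarrow> (\<forall>\<epsilon>>0. \<exists>\<delta>>0. \<forall>h. 0 < h \<and> h < \<delta> \<longrightarrow>
     (\<integral>\<^sup>+t. ennreal (cmod (g t - g x)) * indicator {x - h..x + h} t \<partial>lborel) \<le> ennreal (\<epsilon> * h))"

text \<open>
  On an interval around \<open>x\<close> that is small, but independent of \<open>b\<close>, the dyadic majorant reduces the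
  estimate to interval means.  Outside that interval the kernel is at most a constant times
  \<open>b / (1 + t\<^sup>2)\<close>.
\<close>

lemma poisson_average_at_lebesgue_point:
  assumes [measurable]: "g \<in> borel_measurable borel" and x: "lebesgue_point g x"
    and int: "integrable lborel (\<lambda>t. cmod (g t - g x) / (1 + t\<^sup>2))" and e: "e > 0"
  shows "\<exists>\<delta>>0. \<forall>b. 0 < b \<and> b < \<delta> \<longrightarrow>
     (\<integral>\<^sup>+t. ennreal (poisson b (t - x) * cmod (g t - g x)) \<partial>lborel) \<le> ennreal e"
proof -
  define G where "G t = cmod (g t - g x)" for t
  have [measurable]: "G \<in> borel_measurable borel" unfolding G_def by measurable
  have G0: "G t \<ge> 0" for t by (simp add: G_def)
  define I where "I = (LINT t|lborel. G t / (1 + t\<^sup>2))"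
  have I0: "I \<ge> 0" unfolding I_def using G0 by simp
  have I: "(\<integral>\<^sup>+t. ennreal (G t / (1 + t\<^sup>2)) \<partial>lborel) = ennreal I"
    unfolding I_def G_def by (intro nn_integral_eq_integral int) auto
  define e' where "e' = e / 8"
  have e': "e' > 0" using e by (simp add: e'_def)
  obtain d where d: "d > 0" "\<And>h. 0 < h \<Longrightarrow> h < d \<Longrightarrow>
     (\<integral>\<^sup>+t. ennreal (G t) * indicator {x - h..x + h} t \<partial>lborel) \<le> ennreal (e' * h)"
    using x[unfolded lebesgue_point_def, rule_format, OF e'] unfolding G_def by blast
  define h where "h = d / 2"
  have h: "0 < h" "h < d" using d by (auto simp: h_def)
  \<comment> \<open>The constant for which \<open>1 + t\<^sup>2 \<le> C (t - x)\<^sup>2\<close> holds outside the interval of radius \<open>h\<close>.\<close>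
  define C where "C = 2 + (1 + 2 * x\<^sup>2) / h\<^sup>2"
  have C: "C > 0" unfolding C_def by (intro add_pos_nonneg) auto
  define \<delta> where "\<delta> = e / 2 / (C * I + 1)"
  have \<delta>: "\<delta> > 0" using e C I0 by (auto simp: \<delta>_def intro!: divide_pos_pos add_nonneg_pos)
  have near: "(\<integral>\<^sup>+t. ennreal (poisson b (t - x)) * (ennreal (G t) * indicator {x - h..x + h} t) \<partial>lborel) \<le> ennreal (e / 2)"
    if b: "b > 0" for b
  proof -
    let ?c = "\<lambda>k. 4 / (pi * b) * (1 / 4) ^ k"
    have "(\<integral>\<^sup>+t. ennreal (poisson b (t - x)) * (ennreal (G t) * indicator {x - h..x + h} t) \<partial>lborel) \<le>
      (\<integral>\<^sup>+t. (\<Sum>k. ennreal (?c k) * indicator {- (2 ^ k * b)..2 ^ k * b} (t - x)) *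
        (ennreal (G t) * indicator {x - h..x + h} t) \<partial>lborel)"
      by (intro nn_integral_mono mult_right_mono poisson_le_dyadic_sum b) auto
    also have "\<dots> = (\<integral>\<^sup>+t. (\<Sum>k. ennreal (?c k) * indicator {- (2 ^ k * b)..2 ^ k * b} (t - x) *
        (ennreal (G t) * indicator {x - h..x + h} t)) \<partial>lborel)"
      by (simp only: ennreal_suminf_multc)
    also have "\<dots> = (\<Sum>k. \<integral>\<^sup>+t. ennreal (?c k) * indicator {- (2 ^ k * b)..2 ^ k * b} (t - x) *
        (ennreal (G t) * indicator {x - h..x + h} t) \<partial>lborel)"
      by (rule nn_integral_suminf) measurable
    also have "\<dots> \<le> (\<Sum>k. ennreal (4 / pi * e' * (1 / 2) ^ k))"
    proof (intro suminf_le)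
      fix k :: nat
      define r where "r = min (2 ^ k * b) h"
      have r: "0 < r" "r < d" "r \<le> 2 ^ k * b" using h b by (auto simp: r_def)
      have "(\<integral>\<^sup>+t. ennreal (?c k) * indicator {- (2 ^ k * b)..2 ^ k * b} (t - x) *
        (ennreal (G t) * indicator {x - h..x + h} t) \<partial>lborel) =
        (\<integral>\<^sup>+t. ennreal (?c k) * (ennreal (G t) * indicator {x - r..x + r} t) \<partial>lborel)"
        by (intro nn_integral_cong) (auto simp: indicator_def r_def)
      also have "\<dots> = ennreal (?c k) * (\<integral>\<^sup>+t. ennreal (G t) * indicator {x - r..x + r} t \<partial>lborel)"
        by (rule nn_integral_cmult) measurable
      also have "\<dots> \<le> ennreal (?c k) * ennreal (e' * r)"
        by (intro mult_left_mono d r) auto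
      also have "\<dots> \<le> ennreal (?c k) * ennreal (e' * (2 ^ k * b))"
        using r e' by (intro mult_left_mono ennreal_leI) auto
      also have "\<dots> = ennreal (?c k * (e' * (2 ^ k * b)))"
        using b e' by (intro ennreal_mult[symmetric]) auto
      also have "?c k * (e' * (2 ^ k * b)) = 4 / pi * e' * (1 / 2) ^ k"
      proof -
        have "(2::real) ^ k * 2 ^ k = 4 ^ k" by (simp flip: power_mult_distrib)
        then show ?thesis using b by (simp add: power_divide field_simps)
      qed
      finally show "(\<integral>\<^sup>+t. ennreal (?c k) * indicator {- (2 ^ k * b)..2 ^ k * b} (t - x) *
        (ennreal (G t) * indicator {x - h..x + h} t) \<partial>lborel) \<le> ennreal (4 / pi * e' * (1 / 2) ^ k)" .
    qed auto
    also have "\<dots> = ennreal (\<Sum>k. 4 / pi * e' * (1 / 2) ^ k)"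
      using e' by (intro suminf_ennreal2 summable_mult) (auto intro!: summable_geometric)
    also have "(\<Sum>k. 4 / pi * e' * (1 / 2) ^ k) = 4 / pi * e' * 2"
      by (subst suminf_mult) (auto simp: suminf_geometric intro!: summable_geometric)
    also have "\<dots> \<le> e / 2"
      using e pi_ge_two by (simp add: e'_def field_simps)
    finally show ?thesis by (simp add: ennreal_leI)
  qed
  have far: "(\<integral>\<^sup>+t. ennreal (poisson b (t - x)) * (ennreal (G t) * indicator (- {x - h..x + h}) t) \<partial>lborel) \<le> ennreal (e / 2)"
    if b: "0 < b" "b < \<delta>" for b
  proof -
    have le: "poisson b (t - x) \<le> b * C / (1 + t\<^sup>2)" if t: "t \<notin> {x - h..x + h}" for t
    proof -
      have "\<bar>h\<bar> \<le> \<bar>t - x\<bar>" using t h by auto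
      then have th: "h\<^sup>2 \<le> (t - x)\<^sup>2" by (simp add: abs_le_square_iff)
      have h2: "h\<^sup>2 > 0" using h by simp
      have "1 + t\<^sup>2 \<le> (1 + 2 * x\<^sup>2) + 2 * (t - x)\<^sup>2" by (rule one_plus_square_le)
      also have "(1 + 2 * x\<^sup>2) \<le> (1 + 2 * x\<^sup>2) / h\<^sup>2 * (t - x)\<^sup>2"
        using th h2 mult_left_mono[OF th, of "1 + 2 * x\<^sup>2"] by (simp add: pos_le_divide_eq)
      finally have 1: "1 + t\<^sup>2 \<le> C * (t - x)\<^sup>2" by (simp add: C_def algebra_simps)
      have p: "1 + t\<^sup>2 > 0" "(t - x)\<^sup>2 > 0" "b\<^sup>2 + (t - x)\<^sup>2 > 0" using less_le_trans[OF h2 th] by (simp_all add: add_pos_nonneg add_nonneg_pos)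
      have "1 / (b\<^sup>2 + (t - x)\<^sup>2) \<le> 1 / (t - x)\<^sup>2" using p by (intro divide_left_mono) auto
      also have "\<dots> \<le> C / (1 + t\<^sup>2)" using 1 p by (simp add: divide_simps mult.commute)
      finally have "b * (1 / (b\<^sup>2 + (t - x)\<^sup>2)) \<le> b * (C / (1 + t\<^sup>2))" using b by (intro mult_left_mono) auto
      moreover have "poisson b (t - x) \<le> b * (1 / (b\<^sup>2 + (t - x)\<^sup>2))"
        unfolding poisson_def using b p pi_ge_two by (simp add: divide_simps)
      ultimately show ?thesis by simp
    qed
    have "(\<integral>\<^sup>+t. ennreal (poisson b (t - x)) * (ennreal (G t) * indicator (- {x - h..x + h}) t) \<partial>lborel) \<le>
      (\<integral>\<^sup>+t. ennreal (b * C) * ennreal (G t / (1 + t\<^sup>2)) \<partial>lborel)"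
    proof (rule nn_integral_mono)
      fix t
      show "ennreal (poisson b (t - x)) * (ennreal (G t) * indicator (- {x - h..x + h}) t) \<le> ennreal (b * C) * ennreal (G t / (1 + t\<^sup>2))"
      proof (cases "t \<in> {x - h..x + h}")
        case False
        have "poisson b (t - x) * G t \<le> (b * C / (1 + t\<^sup>2)) * G t"
          using le[OF False] G0 by (intro mult_right_mono) auto
        then have "ennreal (poisson b (t - x) * G t) \<le> ennreal (b * C * (G t / (1 + t\<^sup>2)))"
          by (intro ennreal_leI) simp
        then show ?thesis using False b C G0 poisson_nonneg[of b]
          by (subst ennreal_mult[symmetric]) (auto simp flip: ennreal_mult)
      qed auto
    qed
    also have "\<dots> = ennreal (b * C) * ennreal I" using I by (simp add: nn_integral_cmult)
    also have "\<dots> = ennreal (b * (C * I))" using b C I0 by (simp flip: ennreal_mult)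
    also have "\<dots> \<le> ennreal (e / 2)"
    proof (rule ennreal_leI)
      have "b * (C * I) \<le> \<delta> * (C * I)" using b C I0 by (intro mult_right_mono) auto
      also have "\<dots> \<le> \<delta> * (C * I + 1)" using \<delta> by (intro mult_left_mono) auto
      also have "\<dots> = e / 2"
      proof -
        have "C * I \<ge> 0" using C I0 by simp
        then have "C * I + 1 \<noteq> 0" by linarith
        then show ?thesis
          unfolding \<delta>_def by (rule nonzero_eq_divide_eq[THEN iffD1, OF _ refl])
      qed
      finally show "b * (C * I) \<le> e / 2" .
    qed
    finally show ?thesis .
  qed
  show ?thesis
  proof (intro exI[of _ \<delta>] conjI allI impI \<delta>)
    fix b assume b: "0 < b \<and> b < \<delta>"
    have "(\<integral>\<^sup>+t. ennreal (poisson b (t - x) * cmod (g t - g x)) \<partial>lborel) =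
      (\<integral>\<^sup>+t. ennreal (poisson b (t - x)) * (ennreal (G t) * indicator {x - h..x + h} t) +
             ennreal (poisson b (t - x)) * (ennreal (G t) * indicator (- {x - h..x + h}) t) \<partial>lborel)"
      using b G0 poisson_nonneg[of b]
      by (intro nn_integral_cong) (auto simp: indicator_def G_def ennreal_mult)
    also have "\<dots> = (\<integral>\<^sup>+t. ennreal (poisson b (t - x)) * (ennreal (G t) * indicator {x - h..x + h} t) \<partial>lborel) +
      (\<integral>\<^sup>+t. ennreal (poisson b (t - x)) * (ennreal (G t) * indicator (- {x - h..x + h}) t) \<partial>lborel)"
      by (rule nn_integral_add) measurable
    also have "\<dots> \<le> ennreal (e / 2) + ennreal (e / 2)"
      using near far b by (intro add_mono) auto
    also have "\<dots> = ennreal e" using e by (simp flip: ennreal_plus)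
    finally show "(\<integral>\<^sup>+t. ennreal (poisson b (t - x) * cmod (g t - g x)) \<partial>lborel) \<le> ennreal e" .
  qed
qed


lemma AE_lborel_if_negligible: "negligible N \<Longrightarrow> AE x in lborel. x \<notin> N"
  by (metis AE_completion_iff AE_not_in negligible_iff_null_sets)

lemma AE_right_average_le:
  fixes \<phi> :: "real \<Rightarrow> real"
  assumes nonneg: "\<And>t. \<phi> t \<ge> 0" and int: "\<And>a b. set_integrable lborel {a..b} \<phi>"
  shows "AE x in lborel. \<forall>\<epsilon>>0. \<exists>\<delta>>0. \<forall>h. 0 < h \<and> h < \<delta> \<longrightarrow>
    (\<integral>\<^sup>+t. ennreal (\<phi> t) * indicator {x..x + h} t \<partial>lborel) \<le> ennreal ((\<phi> x + \<epsilon>) * h)"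
proof -
  have io: "\<phi> integrable_on {a..b}" for a b
    using int by (rule set_borel_integral_eq_integral)
  then obtain N where N: "negligible N" "\<And>x e. x \<notin> N \<Longrightarrow> 0 < e \<Longrightarrow>
      \<exists>d>0. \<forall>h. 0 < h \<and> h < d \<longrightarrow> norm (integral (cbox x (x + h *\<^sub>R One)) \<phi> /\<^sub>R h ^ DIM(real) - \<phi> x) < e"
    using integrable_ccontinuous_explicit[of \<phi>] by auto
  from AE_lborel_if_negligible[OF N(1)] show ?thesis
  proof eventually_elim
    case (elim x)
    show ?case
    proof (intro allI impI)
      fix e :: real assume "e > 0"
      from N(2)[OF elim this] obtain d where d: "d > 0"
        "\<And>h. 0 < h \<Longrightarrow> h < d \<Longrightarrow> \<bar>integral {x..x + h} \<phi> / h - \<phi> x\<bar> < e"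
        by (auto simp: divide_inverse mult.commute)
      show "\<exists>\<delta>>0. \<forall>h. 0 < h \<and> h < \<delta> \<longrightarrow>
        (\<integral>\<^sup>+t. ennreal (\<phi> t) * indicator {x..x + h} t \<partial>lborel) \<le> ennreal ((\<phi> x + e) * h)"
      proof (intro exI[of _ d] conjI allI impI d(1))
        fix h assume h: "0 < h \<and> h < d"
        have "(\<integral>\<^sup>+t. ennreal (\<phi> t) * indicator {x..x + h} t \<partial>lborel) =
            (\<integral>\<^sup>+t. ennreal (indicator {x..x + h} t * \<phi> t) \<partial>lborel)"
          by (intro nn_integral_cong) (auto simp: indicator_def)
        also have "\<dots> = ennreal (integral {x..x + h} \<phi>)"
          using io nonneg by (intro nn_integral_has_integral_lebesgue) (auto simp: has_integral_integral)
        also have "\<dots> \<le> ennreal ((\<phi> x + e) * h)"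
        proof (rule ennreal_leI)
          have "integral {x..x + h} \<phi> / h \<le> \<phi> x + e" using d(2)[of h] h by linarith
          then show "integral {x..x + h} \<phi> \<le> (\<phi> x + e) * h" using h by (simp add: pos_divide_le_eq)
        qed
        finally show "(\<integral>\<^sup>+t. ennreal (\<phi> t) * indicator {x..x + h} t \<partial>lborel) \<le> ennreal ((\<phi> x + e) * h)" .
      qed
    qed
  qed
qed

text \<open>
  The differentiation theorem for one-sided intervals, applied to \<open>\<phi>\<close> and to its reflection.
\<close>

lemma AE_two_sided_average_le:
  fixes \<phi> :: "real \<Rightarrow> real"
  assumes [measurable]: "\<phi> \<in> borel_measurable borel"
    and nonneg: "\<And>t. \<phi> t \<ge> 0" and int: "\<And>a b. set_integrable lborel {a..b} \<phi>"
  shows "AE x in lborel. \<forall>\<epsilon>>0. \<exists>\<delta>>0. \<forall>h. 0 < h \<and> h < \<delta> \<longrightarrow>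
    (\<integral>\<^sup>+t. ennreal (\<phi> t) * indicator {x - h..x + h} t \<partial>lborel) \<le> ennreal (2 * (\<phi> x + \<epsilon>) * h)"
proof -
  let ?P = "\<lambda>\<phi> x. \<forall>\<epsilon>>0. \<exists>\<delta>>0. \<forall>h. 0 < h \<and> h < \<delta> \<longrightarrow>
    (\<integral>\<^sup>+t. ennreal (\<phi> t) * indicator {x..x + h} t \<partial>lborel) \<le> ennreal ((\<phi> x + \<epsilon>) * h)"
  have int': "set_integrable lborel {a..b} (\<lambda>t. \<phi> (- t))" for a b
  proof -
    have "integrable lborel (\<lambda>t. (\<lambda>u. indicator {-b..-a} u *\<^sub>R \<phi> u) (0 + (-1) * t))"
      using int[of "-b" "-a"] unfolding set_integrable_def by (intro lborel_integrable_real_affine) auto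
    then show ?thesis unfolding set_integrable_def
      by (rule Bochner_Integration.integrable_cong[THEN iffD1, rotated 2]) (auto simp: indicator_def)
  qed
  have R: "AE x in lborel. ?P \<phi> x" by (rule AE_right_average_le[OF nonneg int])
  have "AE x in lborel. ?P (\<lambda>t. \<phi> (- t)) x" by (rule AE_right_average_le[OF nonneg int'])
  then obtain N where N: "N \<in> null_sets lborel" "\<And>x. x \<notin> N \<Longrightarrow> ?P (\<lambda>t. \<phi> (- t)) x"
    by (elim AE_E3) auto
  have "AE x in lborel. x \<notin> N" using N(1) by (rule AE_not_in)
  then have "AE x in lborel. (0 + (-1) * x) \<notin> N"
    using N(1) by (intro AE_borel_affine) (auto simp: null_sets_def)
  with R show ?thesis
  proof eventually_elim
    case (elim x)
    show ?case
    proof (intro allI impI)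
      fix e :: real assume e: "e > 0"
      obtain d1 where d1: "d1 > 0" "\<And>h. 0 < h \<Longrightarrow> h < d1 \<Longrightarrow>
        (\<integral>\<^sup>+t. ennreal (\<phi> t) * indicator {x..x + h} t \<partial>lborel) \<le> ennreal ((\<phi> x + e) * h)"
        using elim(1) e by meson
      have "?P (\<lambda>t. \<phi> (- t)) (- x)" using N(2)[of "- x"] elim(2) by simp
      then obtain d2 where d2: "d2 > 0" "\<And>h. 0 < h \<Longrightarrow> h < d2 \<Longrightarrow>
        (\<integral>\<^sup>+t. ennreal (\<phi> (- t)) * indicator {- x..- x + h} t \<partial>lborel) \<le> ennreal ((\<phi> (- (- x)) + e) * h)"
        using e by meson
      show "\<exists>\<delta>>0. \<forall>h. 0 < h \<and> h < \<delta> \<longrightarrow>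
        (\<integral>\<^sup>+t. ennreal (\<phi> t) * indicator {x - h..x + h} t \<partial>lborel) \<le> ennreal (2 * (\<phi> x + e) * h)"
      proof (intro exI[of _ "min d1 d2"] conjI allI impI)
        fix h assume h: "0 < h \<and> h < min d1 d2"
        have "(\<integral>\<^sup>+t. ennreal (\<phi> t) * indicator {x - h..x + h} t \<partial>lborel) \<le>
          (\<integral>\<^sup>+t. ennreal (\<phi> t) * indicator {x..x + h} t + ennreal (\<phi> t) * indicator {x - h..x} t \<partial>lborel)"
          by (intro nn_integral_mono) (auto simp: indicator_def)
        also have "\<dots> = (\<integral>\<^sup>+t. ennreal (\<phi> t) * indicator {x..x + h} t \<partial>lborel) + (\<integral>\<^sup>+t. ennreal (\<phi> t) * indicator {x - h..x} t \<partial>lborel)"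
          by (rule nn_integral_add) measurable
        also have "(\<integral>\<^sup>+t. ennreal (\<phi> t) * indicator {x - h..x} t \<partial>lborel) =
          (\<integral>\<^sup>+t. ennreal (\<phi> (- t)) * indicator {- x..- x + h} t \<partial>lborel)"
          by (subst nn_integral_real_affine[where c = "-1" and t = 0])
            (auto intro!: nn_integral_cong simp: indicator_def)
        also have "(\<integral>\<^sup>+t. ennreal (\<phi> t) * indicator {x..x + h} t \<partial>lborel) + \<dots> \<le>
          ennreal ((\<phi> x + e) * h) + ennreal ((\<phi> x + e) * h)"
          using d1(2)[of h] d2(2)[of h] h by (intro add_mono) auto
        also have "\<dots> = ennreal ((\<phi> x + e) * h + (\<phi> x + e) * h)"
          using nonneg[of x] e h by (intro ennreal_plus[symmetric]) auto
        also have "(\<phi> x + e) * h + (\<phi> x + e) * h = 2 * (\<phi> x + e) * h" by (simp add: algebra_simps)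
        finally show "(\<integral>\<^sup>+t. ennreal (\<phi> t) * indicator {x - h..x + h} t \<partial>lborel) \<le> ennreal (2 * (\<phi> x + e) * h)" .
      qed (use d1 d2 in auto)
    qed
  qed
qed

text \<open>
  Differentiate the integrals of \<open>|g - q|\<close> for all \<open>q\<close> in a countable dense set, and approximate
  \<open>g x\<close> by such a \<open>q\<close>.
\<close>

lemma AE_lebesgue_point:
  assumes [measurable]: "g \<in> borel_measurable borel" and int: "\<And>a b. set_integrable lborel {a..b} g"
  shows "AE x in lborel. lebesgue_point g x"
proof -
  obtain D :: "complex set" where D: "countable D" "\<And>X. open X \<Longrightarrow> X \<noteq> {} \<Longrightarrow> \<exists>d\<in>D. d \<in> X"
    using countable_dense_setE by blast
  have int_q: "set_integrable lborel {a..b} (\<lambda>t. cmod (g t - q))" for a b q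
  proof -
    have "set_integrable lborel {a..b} (\<lambda>t. q)"
      by (rule borel_integrable_compact[unfolded set_integrable_def[symmetric]]) auto
    then have "set_integrable lborel {a..b} (\<lambda>t. g t - q)" by (rule set_integral_diff(1)[OF int])
    then show ?thesis by (rule set_integrable_norm)
  qed
  have "AE x in lborel. \<forall>q\<in>D. \<forall>\<epsilon>>0. \<exists>\<delta>>0. \<forall>h. 0 < h \<and> h < \<delta> \<longrightarrow>
    (\<integral>\<^sup>+t. ennreal (cmod (g t - q)) * indicator {x - h..x + h} t \<partial>lborel) \<le> ennreal (2 * (cmod (g x - q) + \<epsilon>) * h)"
    using AE_two_sided_average_le[OF _ _ int_q] by (subst AE_ball_countable[OF D(1)]) auto
  then show ?thesis
  proof eventually_elim
    case (elim x)
    show ?case unfolding lebesgue_point_def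
    proof (intro allI impI)
      fix e :: real assume e: "e > 0"
      obtain q where q: "q \<in> D" "cmod (g x - q) < e / 8"
        using D(2)[of "ball (g x) (e / 8)"] e by (auto simp: dist_norm)
      obtain d where d: "d > 0" "\<And>h. 0 < h \<Longrightarrow> h < d \<Longrightarrow>
        (\<integral>\<^sup>+t. ennreal (cmod (g t - q)) * indicator {x - h..x + h} t \<partial>lborel) \<le> ennreal (2 * (cmod (g x - q) + e / 8) * h)"
        using elim[rule_format, OF q(1), of "e / 8"] e by auto
      show "\<exists>\<delta>>0. \<forall>h. 0 < h \<and> h < \<delta> \<longrightarrow>
        (\<integral>\<^sup>+t. ennreal (cmod (g t - g x)) * indicator {x - h..x + h} t \<partial>lborel) \<le> ennreal (e * h)"
      proof (intro exI[of _ d] conjI allI impI d(1))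
        fix h assume h: "0 < h \<and> h < d"
        have "(\<integral>\<^sup>+t. ennreal (cmod (g t - g x)) * indicator {x - h..x + h} t \<partial>lborel) \<le>
          (\<integral>\<^sup>+t. ennreal (cmod (g t - q)) * indicator {x - h..x + h} t + ennreal (e / 8) * indicator {x - h..x + h} t \<partial>lborel)"
        proof (intro nn_integral_mono)
          fix t
          have "cmod (g t - g x) \<le> cmod (g t - q) + e / 8"
            using norm_triangle_ineq4[of "g t - q" "g x - q"] q(2) by simp
          then have "ennreal (cmod (g t - g x)) \<le> ennreal (cmod (g t - q)) + ennreal (e / 8)"
            using e by (simp add: ennreal_leI flip: ennreal_plus)
          then show "ennreal (cmod (g t - g x)) * indicator {x - h..x + h} t \<le>
            ennreal (cmod (g t - q)) * indicator {x - h..x + h} t + ennreal (e / 8) * indicator {x - h..x + h} t"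
            by (auto simp: indicator_def)
        qed
        also have "\<dots> = (\<integral>\<^sup>+t. ennreal (cmod (g t - q)) * indicator {x - h..x + h} t \<partial>lborel) + ennreal (e / 8) * ennreal (2 * h)"
          using h by (subst nn_integral_add) (auto simp: nn_integral_cmult_indicator)
        also have "\<dots> \<le> ennreal (2 * (cmod (g x - q) + e / 8) * h) + ennreal (e / 8) * ennreal (2 * h)"
          using d(2)[of h] h by (intro add_right_mono) auto
        also have "\<dots> = ennreal (2 * (cmod (g x - q) + e / 8) * h + e / 8 * (2 * h))"
        proof -
          have n: "0 \<le> 2 * (cmod (g x - q) + e / 8) * h" "0 \<le> e / 8 * (2 * h)"
            using e h by (auto intro!: mult_nonneg_nonneg add_nonneg_nonneg)
          have "ennreal (e / 8) * ennreal (2 * h) = ennreal (e / 8 * (2 * h))"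
            using e h by (intro ennreal_mult[symmetric]) auto
          then show ?thesis unfolding ennreal_plus[OF n] by simp
        qed
        also have "\<dots> \<le> ennreal (e * h)"
        proof (rule ennreal_leI)
          have "cmod (g x - q) * h \<le> e / 8 * h" using q(2) h by (intro mult_right_mono) auto
          moreover have "0 \<le> e * h" using e h by simp
          ultimately show "2 * (cmod (g x - q) + e / 8) * h + e / 8 * (2 * h) \<le> e * h"
            by (simp add: algebra_simps)
        qed
        finally show "(\<integral>\<^sup>+t. ennreal (cmod (g t - g x)) * indicator {x - h..x + h} t \<partial>lborel) \<le> ennreal (e * h)" .
      qed
    qed
  qed
qed

lemma integrable_inverse_one_plus_square: "integrable lborel (\<lambda>t::real. 1 / (1 + t\<^sup>2))"
proof -
  have "integrable lborel (\<lambda>t. pi * poisson 1 (t - 0))" by (intro integrable_mult_right integrable_poisson) simp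
  then show ?thesis by (simp add: poisson_def)
qed

lemma integrable_poisson_mult:
  fixes g :: "real \<Rightarrow> complex"
  assumes [measurable]: "g \<in> borel_measurable borel"
    and int: "integrable lborel (\<lambda>t. cmod (g t) / (1 + t\<^sup>2))" and b: "b > 0"
  shows "integrable lborel (\<lambda>t. of_real (poisson b (t - c)) * g t)"
proof -
  obtain C where C: "C > 0" "\<And>t. poisson b (t - c) \<le> C / (1 + t\<^sup>2)" using poisson_decay[OF b] by blast
  show ?thesis
  proof (rule Bochner_Integration.integrable_bound[where f = "\<lambda>t. C * (cmod (g t) / (1 + t\<^sup>2))"])
    show "AE t in lborel. norm (of_real (poisson b (t - c)) * g t) \<le> norm (C * (cmod (g t) / (1 + t\<^sup>2)))"
    proof (rule AE_I2)
      fix t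
      have "poisson b (t - c) * cmod (g t) \<le> C / (1 + t\<^sup>2) * cmod (g t)" by (intro mult_right_mono C) auto
      then show "norm (of_real (poisson b (t - c)) * g t) \<le> norm (C * (cmod (g t) / (1 + t\<^sup>2)))"
        using b C poisson_nonneg[of b] by (simp add: norm_mult abs_mult)
    qed
    show "integrable lborel (\<lambda>t. C * (cmod (g t) / (1 + t\<^sup>2)))" by (intro integrable_mult_right int)
  qed auto
qed

text \<open>
  Fatou's theorem on the half-plane: at every Lebesgue point of \<open>g\<close> the Poisson integral converges
  non-tangentially.
\<close>

theorem poisson_nontangential:
  fixes g :: "real \<Rightarrow> complex"
  assumes [measurable]: "g \<in> borel_measurable borel"
    and int: "integrable lborel (\<lambda>t. cmod (g t) / (1 + t\<^sup>2))"
  shows "AE x in lborel. \<forall>\<alpha>>0. \<forall>\<epsilon>>0. \<exists>\<delta>>0. \<forall>a b. 0 < b \<and> b < \<delta> \<and> \<bar>a\<bar> \<le> \<alpha> * b \<longrightarrow>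
    cmod ((LINT t|lborel. of_real (poisson b (t - (x + a))) * g t) - g x) \<le> \<epsilon>"
proof -
  have loc: "set_integrable lborel {a..b} g" for a b
  proof -
    define K where "K = 1 + (\<bar>a\<bar> + \<bar>b\<bar>)\<^sup>2"
    show ?thesis unfolding set_integrable_def
    proof (rule Bochner_Integration.integrable_bound[where f = "\<lambda>t. K * (cmod (g t) / (1 + t\<^sup>2))"])
      show "AE t in lborel. norm (indicator {a..b} t *\<^sub>R g t) \<le> norm (K * (cmod (g t) / (1 + t\<^sup>2)))"
      proof (rule AE_I2)
        fix t
        show "norm (indicator {a..b} t *\<^sub>R g t) \<le> norm (K * (cmod (g t) / (1 + t\<^sup>2)))"
        proof (cases "t \<in> {a..b}")
          case True
          then have "\<bar>t\<bar>\<^sup>2 \<le> (\<bar>a\<bar> + \<bar>b\<bar>)\<^sup>2" by (intro power_mono) auto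
          then have "1 + t\<^sup>2 \<le> K" by (simp add: K_def)
          then have "(1 + t\<^sup>2) * cmod (g t) \<le> K * cmod (g t)" by (intro mult_right_mono) auto
          then show ?thesis using True by (simp add: abs_mult pos_le_divide_eq add_pos_nonneg K_def mult.commute)
        qed auto
      qed
      show "integrable lborel (\<lambda>t. K * (cmod (g t) / (1 + t\<^sup>2)))" by (intro integrable_mult_right int)
    qed auto
  qed
  from AE_lebesgue_point[OF assms(1) loc] show ?thesis
  proof eventually_elim
    case (elim x)
    have int': "integrable lborel (\<lambda>t. cmod (g t - g x) / (1 + t\<^sup>2))"
    proof (rule Bochner_Integration.integrable_bound[where f = "\<lambda>t. cmod (g t) / (1 + t\<^sup>2) + cmod (g x) * (1 / (1 + t\<^sup>2))"])
      show "integrable lborel (\<lambda>t. cmod (g t) / (1 + t\<^sup>2) + cmod (g x) * (1 / (1 + t\<^sup>2)))"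
        by (intro Bochner_Integration.integrable_add int integrable_mult_right integrable_inverse_one_plus_square)
      show "AE t in lborel. norm (cmod (g t - g x) / (1 + t\<^sup>2)) \<le> norm (cmod (g t) / (1 + t\<^sup>2) + cmod (g x) * (1 / (1 + t\<^sup>2)))"
      proof (rule AE_I2)
        fix t
        have "cmod (g t - g x) / (1 + t\<^sup>2) \<le> (cmod (g t) + cmod (g x)) / (1 + t\<^sup>2)"
          by (intro divide_right_mono norm_triangle_ineq4) auto
        then show "norm (cmod (g t - g x) / (1 + t\<^sup>2)) \<le> norm (cmod (g t) / (1 + t\<^sup>2) + cmod (g x) * (1 / (1 + t\<^sup>2)))"
          by (simp add: add_divide_distrib)
      qed
    qed auto
    show ?case
    proof (intro allI impI)
      fix \<alpha> e :: real assume \<alpha>: "\<alpha> > 0" and e: "e > 0"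
      define K where "K = 2 + 2 * \<alpha>\<^sup>2"
      have K: "K > 0" unfolding K_def by (intro add_pos_nonneg) auto
      have eK: "e / K > 0" using e K by simp
      obtain d where d: "d > 0" "\<And>b. 0 < b \<Longrightarrow> b < d \<Longrightarrow>
         (\<integral>\<^sup>+t. ennreal (poisson b (t - x) * cmod (g t - g x)) \<partial>lborel) \<le> ennreal (e / K)"
        using poisson_average_at_lebesgue_point[OF assms(1) elim int' eK] by blast
      show "\<exists>\<delta>>0. \<forall>a b. 0 < b \<and> b < \<delta> \<and> \<bar>a\<bar> \<le> \<alpha> * b \<longrightarrow>
        cmod ((LINT t|lborel. of_real (poisson b (t - (x + a))) * g t) - g x) \<le> e"
      proof (intro exI[of _ d] conjI allI impI d(1))
        fix a b assume ab: "0 < b \<and> b < d \<and> \<bar>a\<bar> \<le> \<alpha> * b"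
        then have b: "b > 0" by simp
        let ?P = "\<lambda>t. poisson b (t - (x + a))"
        have i1: "integrable lborel (\<lambda>t. of_real (?P t) * g t)" by (rule integrable_poisson_mult[OF assms(1) int b])
        have i2: "integrable lborel (\<lambda>t. of_real (?P t) * g x)" using b by (intro integrable_mult_left integrable_of_real integrable_poisson)
        have "(LINT t|lborel. of_real (?P t) * g x) = (LINT t|lborel. of_real (?P t)) * g x"
          by (rule integral_mult_left_zero)
        also have "(LINT t|lborel. of_real (?P t)) = (of_real (LINT t|lborel. ?P t) :: complex)" by (rule integral_complex_of_real)
        also have "\<dots> = 1" using b by (simp add: integral_poisson)
        finally have "(LINT t|lborel. of_real (?P t) * g t) - g x = (LINT t|lborel. of_real (?P t) * (g t - g x))"
          using i1 i2 by (simp add: right_diff_distrib)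
        also have "ennreal (cmod \<dots>) \<le> (\<integral>\<^sup>+t. ennreal (norm (of_real (?P t) * (g t - g x))) \<partial>lborel)"
          by (rule integral_norm_bound_ennreal) (use i1 i2 in \<open>simp add: right_diff_distrib\<close>)
        also have "\<dots> \<le> (\<integral>\<^sup>+t. ennreal K * ennreal (poisson b (t - x) * cmod (g t - g x)) \<partial>lborel)"
        proof (rule nn_integral_mono)
          fix t
          have "?P t \<le> K * poisson b (t - x)"
            using poisson_shift_le[of b a \<alpha> "t - x"] ab by (simp add: K_def algebra_simps)
          then have "?P t * cmod (g t - g x) \<le> K * poisson b (t - x) * cmod (g t - g x)"
            by (intro mult_right_mono) auto
          then show "ennreal (norm (of_real (?P t) * (g t - g x))) \<le> ennreal K * ennreal (poisson b (t - x) * cmod (g t - g x))"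
            using K b poisson_nonneg[of b] by (simp add: norm_mult ennreal_leI mult.assoc flip: ennreal_mult)
        qed
        also have "\<dots> = ennreal K * (\<integral>\<^sup>+t. ennreal (poisson b (t - x) * cmod (g t - g x)) \<partial>lborel)"
          by (rule nn_integral_cmult) measurable
        also have "\<dots> \<le> ennreal K * ennreal (e / K)" using d(2) ab by (intro mult_left_mono) auto
        also have "\<dots> = ennreal e" using K e by (simp flip: ennreal_mult)
        finally show "cmod ((LINT t|lborel. of_real (?P t) * g t) - g x) \<le> e" using e by simp
      qed
    qed
  qed
qed

section \<open>The boundary of a half-strip parametrised by arc length\<close>

text \<open>
  Arc-length parametrisation of \<open>bdry s t\<close> with the half-strip on the left: down the left side for
  \<open>x < - s\<close>, along the bottom for \<open>|x| \<le> s\<close>, up the right side for \<open>x > s\<close>.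
\<close>

definition strip_curve :: "real \<Rightarrow> real \<Rightarrow> real \<Rightarrow> complex" where
  "strip_curve s t x = Complex (max (- s) (min s x)) (t + max 0 (\<bar>x\<bar> - s))"

text \<open>
  The unit tangent of \<open>strip_curve\<close>; multiplied by \<open>\<i>\<close> it is the inward normal.
\<close>

definition strip_dir :: "real \<Rightarrow> real \<Rightarrow> complex" where
  "strip_dir s x = (if x < - s then - \<i> else if x \<le> s then 1 else \<i>)"

text \<open>
  The inverse of \<open>strip_curve\<close>, extended to a Borel function on the plane so that functions of the
  parameter can be read as functions of the boundary point.
\<close>

definition strip_param :: "real \<Rightarrow> real \<Rightarrow> complex \<Rightarrow> real" where
  "strip_param s t \<zeta> = (if Im \<zeta> > t then (if Re \<zeta> > 0 then s + (Im \<zeta> - t) else - s - (Im \<zeta> - t)) else Re \<zeta>)"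

lemma continuous_strip_curve: "continuous_on UNIV (strip_curve s t)"
  unfolding strip_curve_def Complex_eq by (intro continuous_intros)

lemma measurable_strip_curve [measurable]: "strip_curve s t \<in> borel_measurable borel"
  by (rule borel_measurable_continuous_onI[OF continuous_strip_curve])

lemma measurable_strip_dir [measurable]: "strip_dir s \<in> borel_measurable borel"
  unfolding strip_dir_def by measurable

lemma measurable_strip_param [measurable]: "strip_param s t \<in> borel_measurable borel"
  unfolding strip_param_def by measurable

lemma cmod_strip_dir [simp]: "cmod (strip_dir s x) = 1"
  by (simp add: strip_dir_def)

lemma strip_curve_in_bdry: "s > 0 \<Longrightarrow> strip_curve s t x \<in> bdry s t"
  by (auto simp: strip_curve_def bdry_def bdry1_def bdry2_def bdry3_def max_def min_def abs_if)

lemma strip_param_curve: "s > 0 \<Longrightarrow> strip_param s t (strip_curve s t x) = x"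
  by (auto simp: strip_curve_def strip_param_def max_def min_def abs_if)

lemma strip_curve_param: "s > 0 \<Longrightarrow> \<zeta> \<in> bdry s t \<Longrightarrow> strip_curve s t (strip_param s t \<zeta>) = \<zeta>"
  by (auto simp: strip_curve_def strip_param_def bdry_def bdry1_def bdry2_def bdry3_def complex_eq_iff max_def min_def abs_if)

lemma tangent_strip_curve: "s > 0 \<Longrightarrow> tangent s t (strip_curve s t x) = strip_dir s x"
  by (auto simp: strip_curve_def strip_dir_def tangent_def bdry1_def bdry3_def max_def min_def abs_if)

lemma dist_strip_curve:
  "dist (strip_curve s t x) (strip_curve s' t' x) \<le> 2 * \<bar>s - s'\<bar> + \<bar>t - t'\<bar>"
proof -
  have "dist (strip_curve s t x) (strip_curve s' t' x) \<le>
    \<bar>max (- s) (min s x) - max (- s') (min s' x)\<bar> + \<bar>(t + max 0 (\<bar>x\<bar> - s)) - (t' + max 0 (\<bar>x\<bar> - s'))\<bar>"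
    using cmod_le[of "strip_curve s t x - strip_curve s' t' x"] by (simp add: strip_curve_def dist_norm)
  also have "\<dots> \<le> \<bar>s - s'\<bar> + (\<bar>t - t'\<bar> + \<bar>s - s'\<bar>)"
    by (intro add_mono) (auto simp: max_def min_def abs_if)
  finally show ?thesis by simp
qed

lemma bdry_borel [measurable]: "bdry s t \<in> sets borel"
proof -
  have "bdry s t = {w. Re w = - s \<and> Im w > t} \<union> {w. \<bar>Re w\<bar> \<le> s \<and> Im w = t} \<union> {w. Re w = s \<and> Im w > t}"
    by (simp add: bdry_def bdry1_def bdry2_def bdry3_def)
  then show ?thesis by simp
qed

lemma nn_integral_three_lines_bdry:
  assumes s: "s > 0" and f[measurable]: "f \<in> borel_measurable borel"
  shows "(\<integral>\<^sup>+w. f w * indicator (bdry s t) w \<partial>three_lines s t) = (\<integral>\<^sup>+x. f (strip_curve s t x) \<partial>lborel)"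
proof -
  have [measurable]: "(\<lambda>x. Complex c x) \<in> borel_measurable borel" "(\<lambda>x. Complex x c) \<in> borel_measurable borel" for c
    unfolding Complex_eq by (rule borel_measurable_continuous_onI, intro continuous_intros)+
  have [measurable]: "(\<lambda>x. f (Complex c x)) \<in> borel_measurable borel" "(\<lambda>x. f (Complex x c)) \<in> borel_measurable borel" for c
    by measurable
  let ?g = "\<lambda>x. f (strip_curve s t x)"
  have 1: "(\<integral>\<^sup>+v. f (Complex (- s) v) * indicator (bdry s t) (Complex (- s) v) \<partial>lborel) = (\<integral>\<^sup>+x. ?g x * indicator {..<- s} x \<partial>lborel)"
  proof -
    have "(\<integral>\<^sup>+v. f (Complex (- s) v) * indicator (bdry s t) (Complex (- s) v) \<partial>lborel) =
      (\<integral>\<^sup>+v. f (Complex (- s) v) * indicator {t<..} v \<partial>lborel)"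
      by (rule nn_integral_cong_AE, rule AE_mp[OF AE_lborel_singleton[of t]])
        (use s in \<open>auto simp: indicator_def bdry_def bdry1_def bdry2_def bdry3_def\<close>)
    also have "\<dots> = (\<integral>\<^sup>+x. f (Complex (- s) (t - s - x)) * indicator {t<..} (t - s - x) \<partial>lborel)"
      using nn_integral_real_affine[of "\<lambda>v. f (Complex (- s) v) * indicator {t<..} v" "-1" "t - s"] by simp
    also have "\<dots> = (\<integral>\<^sup>+x. ?g x * indicator {..<- s} x \<partial>lborel)"
    proof (rule nn_integral_cong)
      fix x
      have "strip_curve s t x = Complex (- s) (t - s - x)" if "x < - s"
        using that s by (simp add: strip_curve_def)
      then show "f (Complex (- s) (t - s - x)) * indicator {t<..} (t - s - x) = ?g x * indicator {..<- s} x"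
        by (cases "x < - s") simp_all
    qed
    finally show ?thesis .
  qed
  have 2: "(\<integral>\<^sup>+u. f (Complex u t) * indicator (bdry s t) (Complex u t) \<partial>lborel) = (\<integral>\<^sup>+x. ?g x * indicator {- s..s} x \<partial>lborel)"
  proof (rule nn_integral_cong)
    fix u
    have "strip_curve s t u = Complex u t" if "u \<in> {- s..s}"
      using that s by (simp add: strip_curve_def abs_le_iff)
    then show "f (Complex u t) * indicator (bdry s t) (Complex u t) = ?g u * indicator {- s..s} u"
      by (cases "u \<in> {- s..s}") (auto simp: indicator_def bdry_def bdry1_def bdry2_def bdry3_def)
  qed
  have 3: "(\<integral>\<^sup>+v. f (Complex s v) * indicator (bdry s t) (Complex s v) \<partial>lborel) = (\<integral>\<^sup>+x. ?g x * indicator {s<..} x \<partial>lborel)"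
  proof -
    have "(\<integral>\<^sup>+v. f (Complex s v) * indicator (bdry s t) (Complex s v) \<partial>lborel) =
      (\<integral>\<^sup>+v. f (Complex s v) * indicator {t<..} v \<partial>lborel)"
      by (rule nn_integral_cong_AE, rule AE_mp[OF AE_lborel_singleton[of t]])
        (use s in \<open>auto simp: indicator_def bdry_def bdry1_def bdry2_def bdry3_def\<close>)
    also have "\<dots> = (\<integral>\<^sup>+x. f (Complex s (t - s + x)) * indicator {t<..} (t - s + x) \<partial>lborel)"
      using nn_integral_real_affine[of "\<lambda>v. f (Complex s v) * indicator {t<..} v" 1 "t - s"] by simp
    also have "\<dots> = (\<integral>\<^sup>+x. ?g x * indicator {s<..} x \<partial>lborel)"
    proof (rule nn_integral_cong)
      fix x
      have "strip_curve s t x = Complex s (t - s + x)" if "s < x"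
        using that s by (simp add: strip_curve_def)
      then show "f (Complex s (t - s + x)) * indicator {t<..} (t - s + x) = ?g x * indicator {s<..} x"
        by (cases "s < x") simp_all
    qed
    finally show ?thesis .
  qed
  have "(\<integral>\<^sup>+x. ?g x \<partial>lborel) = (\<integral>\<^sup>+x. (?g x * indicator {..<- s} x + ?g x * indicator {- s..s} x) + ?g x * indicator {s<..} x \<partial>lborel)"
    using s by (intro nn_integral_cong) (auto simp: indicator_def)
  also have "\<dots> = (\<integral>\<^sup>+x. ?g x * indicator {..<- s} x \<partial>lborel) + (\<integral>\<^sup>+x. ?g x * indicator {- s..s} x \<partial>lborel) + (\<integral>\<^sup>+x. ?g x * indicator {s<..} x \<partial>lborel)"
    by (simp add: nn_integral_add)
  finally show ?thesis
    by (subst nn_integral_three_lines) (simp_all add: 1 2 3)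
qed

lemma sets_three_lines_borel: "A \<in> sets borel \<Longrightarrow> A \<in> sets (three_lines s t)"
  unfolding three_lines_def by (rule sets_completionI_sets) simp

lemma space_three_lines [simp]: "space (three_lines s t) = UNIV"
  by (simp add: three_lines_def)

lemma space_arc_length [simp]: "space (arc_length s t) = bdry s t"
  by (simp add: arc_length_def space_restrict_space)

lemma nn_integral_arc_length_eq_three_lines:
  "(\<integral>\<^sup>+w. f w \<partial>arc_length s t) = (\<integral>\<^sup>+w. f w * indicator (bdry s t) w \<partial>three_lines s t)"
  unfolding arc_length_def by (intro nn_integral_restrict_space) (simp add: sets_three_lines_borel)

lemma nn_integral_arc_length:
  "s > 0 \<Longrightarrow> f \<in> borel_measurable borel \<Longrightarrow> (\<integral>\<^sup>+w. f w \<partial>arc_length s t) = (\<integral>\<^sup>+x. f (strip_curve s t x) \<partial>lborel)"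
  by (simp add: nn_integral_arc_length_eq_three_lines nn_integral_three_lines_bdry)

text \<open>
  A null set \<open>N\<close> of parameters is the preimage under \<open>strip_curve\<close> of a Borel set of boundary points,
  namely of the points whose parameter lies in \<open>N\<close>.
\<close>

lemma AE_arc_length:
  assumes s: "s > 0" and P: "AE x in lborel. P (strip_curve s t x)"
  shows "AE \<zeta> in arc_length s t. P \<zeta>"
proof -
  obtain N where N: "N \<in> null_sets lborel" "\<And>x. x \<notin> N \<Longrightarrow> P (strip_curve s t x)"
    using P by (elim AE_E3) auto
  have [measurable]: "N \<in> sets borel" using N(1) by (auto simp: null_sets_def)
  define N' where "N' = {\<zeta> \<in> bdry s t. strip_param s t \<zeta> \<in> N}"
  have mN: "N' \<in> sets borel" unfolding N'_def by measurable
  have mN': "N' \<in> sets (arc_length s t)"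
    using sets_three_lines_borel[OF mN] unfolding arc_length_def
    by (intro sets_restrict_space_iff[THEN iffD2]) (auto simp: sets_three_lines_borel N'_def)
  have "emeasure (arc_length s t) N' = (\<integral>\<^sup>+\<zeta>. indicator N' \<zeta> \<partial>arc_length s t)"
    using mN' by simp
  also have "\<dots> = (\<integral>\<^sup>+x. indicator N' (strip_curve s t x) \<partial>lborel)"
    using s mN by (intro nn_integral_arc_length) auto
  also have "\<dots> = (\<integral>\<^sup>+x. indicator N x \<partial>lborel)"
    using s by (intro nn_integral_cong) (auto simp: N'_def indicator_def strip_param_curve strip_curve_in_bdry)
  also have "\<dots> = 0" using N(1) by (simp add: null_sets_def)
  finally have "N' \<in> null_sets (arc_length s t)" using mN' by (simp add: null_sets_def)
  then show ?thesis
  proof (rule AE_I')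
    show "{\<zeta> \<in> space (arc_length s t). \<not> P \<zeta>} \<subseteq> N'"
    proof safe
      fix \<zeta> assume "\<zeta> \<in> space (arc_length s t)" "\<not> P \<zeta>"
      then show "\<zeta> \<in> N'" using N(2)[of "strip_param s t \<zeta>"] s by (auto simp: N'_def strip_curve_param)
    qed
  qed
qed

lemma AE_arc_length_param:
  assumes s: "s > 0" and k: "AE x in lborel. k (strip_curve s t x) = f x"
  shows "AE \<zeta> in arc_length s t. k \<zeta> = f (strip_param s t \<zeta>)"
  using s k by (intro AE_arc_length) (simp_all add: strip_param_curve)

text \<open>
  Functions such as \<open>nt_limit\<close> need not be Borel, but agree with a Borel function almost everywhere;
  this suffices because \<open>three_lines\<close> is a completed measure.
\<close>

lemma measurable_arc_length:
  fixes k :: "complex \<Rightarrow> complex"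
  assumes s: "s > 0" and [measurable]: "f \<in> borel_measurable borel"
    and k: "AE x in lborel. k (strip_curve s t x) = f x"
  shows "k \<in> borel_measurable (arc_length s t)"
proof (rule measurableI)
  fix S :: "complex set" assume [measurable]: "S \<in> sets borel"
  interpret complete_measure "three_lines s t" unfolding three_lines_def by (rule completion.complete_measure_axioms)
  have "AE \<zeta> in three_lines s t. \<zeta> \<in> bdry s t \<longrightarrow> k \<zeta> = f (strip_param s t \<zeta>)"
    using AE_arc_length_param[OF s k] unfolding arc_length_def
    by (subst (asm) AE_restrict_space_iff) (auto simp: sets_three_lines_borel)
  then have "AE \<zeta> in three_lines s t. \<zeta> \<in> {\<zeta> \<in> bdry s t. f (strip_param s t \<zeta>) \<in> S} \<longleftrightarrow> \<zeta> \<in> {\<zeta> \<in> bdry s t. k \<zeta> \<in> S}"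
    by eventually_elim auto
  then have "{\<zeta> \<in> bdry s t. k \<zeta> \<in> S} \<in> sets (three_lines s t)"
    by (rule in_sets_AE) (auto intro!: sets_three_lines_borel)
  then show "k -` S \<inter> space (arc_length s t) \<in> sets (arc_length s t)"
    unfolding arc_length_def by (subst sets_restrict_space_iff) (auto simp: sets_three_lines_borel space_restrict_space vimage_def Int_def conj_commute)
qed simp

lemma
  fixes h :: "complex \<Rightarrow> complex"
  assumes s: "s > 0" and [measurable]: "h \<in> borel_measurable borel"
  shows integrable_arc_length_borel: "integrable (arc_length s t) h \<longleftrightarrow> integrable lborel (\<lambda>x. h (strip_curve s t x))" (is ?A)
    and integral_arc_length_borel: "(LINT \<zeta>|arc_length s t. h \<zeta>) = (LINT x|lborel. h (strip_curve s t x))" (is ?B)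
proof -
  \<comment> \<open>Restricted to the boundary, the measure before completion is the image of Lebesgue measure under the curve.\<close>
  let ?D = "distr (count_space {1, 2, 3} \<Otimes>\<^sub>M lborel) borel (line_point s t)"
  have eq: "density ?D (\<lambda>\<zeta>. ennreal (indicator (bdry s t) \<zeta>)) = distr lborel borel (strip_curve s t)"
  proof (rule measure_eqI)
    fix A assume "A \<in> sets (density ?D (\<lambda>\<zeta>. ennreal (indicator (bdry s t) \<zeta>)))"
    then have [measurable]: "A \<in> sets borel" by simp
    have "emeasure (density ?D (\<lambda>\<zeta>. ennreal (indicator (bdry s t) \<zeta>))) A = (\<integral>\<^sup>+\<zeta>. ennreal (indicator (bdry s t) \<zeta>) * indicator A \<zeta> \<partial>?D)"
      by (rule emeasure_density) auto
    also have "\<dots> = (\<integral>\<^sup>+\<zeta>. indicator A \<zeta> * indicator (bdry s t) \<zeta> \<partial>three_lines s t)"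
      unfolding three_lines_def nn_integral_completion by (intro nn_integral_cong) (auto simp: indicator_def)
    also have "\<dots> = (\<integral>\<^sup>+x. indicator A (strip_curve s t x) \<partial>lborel)"
      by (rule nn_integral_three_lines_bdry[OF s]) simp
    also have "\<dots> = (\<integral>\<^sup>+x. indicator A x \<partial>distr lborel borel (strip_curve s t))"
      by (subst nn_integral_distr) auto
    finally show "emeasure (density ?D (\<lambda>\<zeta>. ennreal (indicator (bdry s t) \<zeta>))) A = emeasure (distr lborel borel (strip_curve s t)) A"
      by simp
  qed simp
  have r: "bdry s t \<inter> space (completion ?D) \<in> sets (completion ?D)" by (intro sets_completionI_sets) simp
  have "integrable (arc_length s t) h \<longleftrightarrow> integrable (completion ?D) (\<lambda>\<zeta>. indicator (bdry s t) \<zeta> *\<^sub>R h \<zeta>)"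
    unfolding arc_length_def three_lines_def by (rule integrable_restrict_space[OF r])
  also have "\<dots> \<longleftrightarrow> integrable ?D (\<lambda>\<zeta>. indicator (bdry s t) \<zeta> *\<^sub>R h \<zeta>)"
    by (rule integrable_completion) simp
  also have "\<dots> \<longleftrightarrow> integrable (density ?D (\<lambda>\<zeta>. ennreal (indicator (bdry s t) \<zeta>))) h"
    by (rule integrable_density[symmetric]) auto
  finally show ?A unfolding eq by (simp add: integrable_distr_eq)
  have "(LINT \<zeta>|arc_length s t. h \<zeta>) = (LINT \<zeta>|completion ?D. indicator (bdry s t) \<zeta> *\<^sub>R h \<zeta>)"
    unfolding arc_length_def three_lines_def by (rule integral_restrict_space[OF r])
  also have "\<dots> = (LINT \<zeta>|?D. indicator (bdry s t) \<zeta> *\<^sub>R h \<zeta>)"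
    by (rule integral_completion) simp
  also have "\<dots> = (LINT \<zeta>|density ?D (\<lambda>\<zeta>. ennreal (indicator (bdry s t) \<zeta>)). h \<zeta>)"
    by (rule integral_density[symmetric]) auto
  finally show ?B unfolding eq by (simp add: integral_distr)
qed

lemma
  fixes k :: "complex \<Rightarrow> complex"
  assumes s: "s > 0" and f[measurable]: "f \<in> borel_measurable borel"
    and k: "AE x in lborel. k (strip_curve s t x) = f x"
  shows integrable_arc_length: "integrable (arc_length s t) k \<longleftrightarrow> integrable lborel f" (is ?A)
    and integral_arc_length: "(LINT \<zeta>|arc_length s t. k \<zeta>) = (LINT x|lborel. f x)" (is ?B)
proof -
  have [measurable]: "k \<in> borel_measurable (arc_length s t)" by (rule measurable_arc_length[OF s f k])
  have [measurable]: "(\<lambda>\<zeta>. f (strip_param s t \<zeta>)) \<in> borel_measurable (arc_length s t)"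
    by (rule measurable_arc_length[OF s f]) (simp add: strip_param_curve s)
  have "integrable (arc_length s t) k \<longleftrightarrow> integrable (arc_length s t) (\<lambda>\<zeta>. f (strip_param s t \<zeta>))"
    by (rule integrable_cong_AE[OF _ _ AE_arc_length_param[OF s k]]) simp_all
  also have "\<dots> \<longleftrightarrow> integrable lborel f"
    by (subst integrable_arc_length_borel[OF s]) (simp_all add: strip_param_curve s)
  finally show ?A .
  have "(LINT \<zeta>|arc_length s t. k \<zeta>) = (LINT \<zeta>|arc_length s t. f (strip_param s t \<zeta>))"
    by (rule integral_cong_AE[OF _ _ AE_arc_length_param[OF s k]]) simp_all
  also have "\<dots> = (LINT x|lborel. f x)"
    by (subst integral_arc_length_borel[OF s]) (simp_all add: strip_param_curve s)
  finally show ?B .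
qed

lemma nn_integral_arc_length_AE:
  fixes k :: "complex \<Rightarrow> ennreal"
  assumes s: "s > 0" and f[measurable]: "f \<in> borel_measurable borel"
    and k: "AE x in lborel. k (strip_curve s t x) = f x"
  shows "(\<integral>\<^sup>+\<zeta>. k \<zeta> \<partial>arc_length s t) = (\<integral>\<^sup>+x. f x \<partial>lborel)"
proof -
  have "(\<integral>\<^sup>+\<zeta>. k \<zeta> \<partial>arc_length s t) = (\<integral>\<^sup>+\<zeta>. f (strip_param s t \<zeta>) \<partial>arc_length s t)"
    by (rule nn_integral_cong_AE[OF AE_arc_length_param[OF s k]])
  then show ?thesis by (simp add: nn_integral_arc_length s strip_param_curve)
qed

section \<open>Cauchy's formula on the inner half-strips\<close>

lemma strip_curve_bottom: "\<bar>x\<bar> \<le> s \<Longrightarrow> strip_curve s t x = Complex x t"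
  by (simp add: strip_curve_def abs_le_iff)

lemma strip_curve_right: "0 < s \<Longrightarrow> s \<le> x \<Longrightarrow> strip_curve s t x = Complex s (t + x - s)"
  by (simp add: strip_curve_def)

lemma strip_curve_left: "0 < s \<Longrightarrow> x \<le> - s \<Longrightarrow> strip_curve s t x = Complex (- s) (t - s - x)"
  by (simp add: strip_curve_def)

lemma integrable_one_plus_abs_powr:
  assumes q: "(q::real) > 1"
  shows "integrable lborel (\<lambda>x::real. (1 + \<bar>x\<bar>) powr (- q))"
proof (rule integrableI_nonneg)
  let ?f = "\<lambda>x::real. (1 + \<bar>x\<bar>) powr (- q)"
  show "?f \<in> borel_measurable lborel" by measurable
  have half: "(\<integral>\<^sup>+x. ennreal (?f x) * indicator {0..} x \<partial>lborel) = ennreal (0 - (- ((1 + 0) powr (1 - q) / (q - 1))))"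
  proof (rule nn_integral_FTC_atLeast[where F = "\<lambda>x. - ((1 + x) powr (1 - q) / (q - 1))"])
    fix x :: real assume x: "0 \<le> x"
    have "((\<lambda>x. (1 + x) powr (1 - q)) has_real_derivative (1 - q) * (1 + x) powr (1 - q - 1) * 1) (at x)"
      using x by (intro DERIV_chain2[OF has_real_derivative_powr]) (auto intro!: derivative_eq_intros)
    then have "((\<lambda>x. - ((1 + x) powr (1 - q) / (q - 1))) has_real_derivative - ((1 - q) * (1 + x) powr (1 - q - 1) * 1 / (q - 1))) (at x)"
      by (intro DERIV_minus DERIV_cdivide)
    moreover have "- ((1 - q) * (1 + x) powr (1 - q - 1) * 1 / (q - 1)) = (1 + x) powr (- q)"
      using q by (simp add: field_simps)
    ultimately show "((\<lambda>x. - ((1 + x) powr (1 - q) / (q - 1))) has_real_derivative ?f x) (at x)" using x by simp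
  next
    show "((\<lambda>x. - ((1 + x) powr (1 - q) / (q - 1))) \<longlongrightarrow> 0) at_top" using q by real_asymp
  qed auto
  have "(\<integral>\<^sup>+x. ennreal (?f x) \<partial>lborel) \<le> (\<integral>\<^sup>+x. ennreal (?f x) * indicator {0..} x + ennreal (?f x) * indicator {..0} x \<partial>lborel)"
    by (intro nn_integral_mono) (auto simp: indicator_def)
  also have "\<dots> = (\<integral>\<^sup>+x. ennreal (?f x) * indicator {0..} x \<partial>lborel) + (\<integral>\<^sup>+x. ennreal (?f x) * indicator {..0} x \<partial>lborel)"
    by (rule nn_integral_add) auto
  also have "(\<integral>\<^sup>+x. ennreal (?f x) * indicator {..0} x \<partial>lborel) = (\<integral>\<^sup>+x. ennreal (?f x) * indicator {0..} x \<partial>lborel)"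
    by (subst nn_integral_real_affine[where c = "-1" and t = 0]) (auto intro!: nn_integral_cong simp: indicator_def)
  finally show "(\<integral>\<^sup>+x. ennreal (?f x) \<partial>lborel) < \<infinity>" unfolding half by (rule le_less_trans) simp
qed auto

text \<open>
  Two bounds are combined: the distance from \<open>w\<close> is at least \<open>d\<close>, and it grows like \<open>|x|\<close>.
\<close>

lemma strip_curve_lower_bound:
  assumes s: "s > 0" and d: "d > 0" "\<And>x. x \<in> A \<Longrightarrow> cmod (strip_curve s t x - w) \<ge> d"
  obtains c where "c > 0" "\<And>x. x \<in> A \<Longrightarrow> cmod (strip_curve s t x - w) \<ge> c * (1 + \<bar>x\<bar>)"
proof
  define R where "R = s + \<bar>t\<bar> + cmod w"
  have R: "R > 0" unfolding R_def using s by (intro add_pos_nonneg) auto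
  show "d / (1 + R + d) > 0" using R d by simp
  fix x assume x: "x \<in> A"
  have "\<bar>x\<bar> - s - \<bar>t\<bar> \<le> \<bar>Im (strip_curve s t x)\<bar>" by (auto simp: strip_curve_def max_def abs_if)
  also have "\<dots> \<le> cmod (strip_curve s t x)" by (rule abs_Im_le_cmod)
  also have "\<dots> \<le> cmod (strip_curve s t x - w) + cmod w" by (metis norm_triangle_sub add.commute)
  finally have far: "\<bar>x\<bar> - R \<le> cmod (strip_curve s t x - w)" by (simp add: R_def)
  have "d * (1 + \<bar>x\<bar>) \<le> cmod (strip_curve s t x - w) * (1 + R + d)"
  proof (cases "\<bar>x\<bar> \<le> R + d")
    case True
    then have "d * (1 + \<bar>x\<bar>) \<le> d * (1 + R + d)" using d by (intro mult_left_mono) auto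
    also have "\<dots> \<le> cmod (strip_curve s t x - w) * (1 + R + d)" using d R x by (intro mult_right_mono) auto
    finally show ?thesis .
  next
    case False
    then have "0 \<le> (\<bar>x\<bar> - R - d) * (1 + R)" using R by (intro mult_nonneg_nonneg) auto
    then have "d * (1 + \<bar>x\<bar>) \<le> (\<bar>x\<bar> - R) * (1 + R + d)" by (simp add: algebra_simps)
    also have "\<dots> \<le> cmod (strip_curve s t x - w) * (1 + R + d)" using far d R by (intro mult_right_mono) auto
    finally show ?thesis .
  qed
  then show "d / (1 + R + d) * (1 + \<bar>x\<bar>) \<le> cmod (strip_curve s t x - w)"
    using R d by (simp add: pos_divide_le_eq)
qed

lemma cauchy_kernel_Lq:
  assumes s: "s > 0" and d: "d > 0" "\<And>x. x \<in> A \<Longrightarrow> cmod (strip_curve s t x - w) \<ge> d"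
    and q: "q > 1" and [measurable]: "A \<in> sets borel"
  shows "integrable lborel (\<lambda>x. cmod (indicator A x *\<^sub>R (strip_dir s x / (strip_curve s t x - w))) powr q)"
proof -
  obtain c where c: "c > 0" "\<And>x. x \<in> A \<Longrightarrow> cmod (strip_curve s t x - w) \<ge> c * (1 + \<bar>x\<bar>)"
    using strip_curve_lower_bound[where A = A, OF s d] by blast
  show ?thesis
  proof (rule Bochner_Integration.integrable_bound[where f = "\<lambda>x. (1 / c) powr q * (1 + \<bar>x\<bar>) powr (- q)"])
    show "integrable lborel (\<lambda>x. (1 / c) powr q * (1 + \<bar>x\<bar>) powr (- q))"
      using q by (intro integrable_mult_right integrable_one_plus_abs_powr)
    show "AE x in lborel. norm (cmod (indicator A x *\<^sub>R (strip_dir s x / (strip_curve s t x - w))) powr q) \<le> norm ((1 / c) powr q * (1 + \<bar>x\<bar>) powr (- q))"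
    proof (rule AE_I2)
      fix x
      show "norm (cmod (indicator A x *\<^sub>R (strip_dir s x / (strip_curve s t x - w))) powr q) \<le> norm ((1 / c) powr q * (1 + \<bar>x\<bar>) powr (- q))"
      proof (cases "x \<in> A")
        case True
        have pos: "c * (1 + \<bar>x\<bar>) > 0" using c by (intro mult_pos_pos) auto
        have "cmod (strip_dir s x / (strip_curve s t x - w)) \<le> 1 / (c * (1 + \<bar>x\<bar>))"
          using c(2)[OF True] pos by (auto simp: norm_divide intro!: divide_left_mono mult_pos_pos)
        then have "cmod (strip_dir s x / (strip_curve s t x - w)) powr q \<le> (1 / (c * (1 + \<bar>x\<bar>))) powr q"
          using q by (intro powr_mono2) auto
        also have "\<dots> = (1 / c) powr q * (1 + \<bar>x\<bar>) powr (- q)"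
          using c by (simp add: powr_mult inverse_powr powr_minus divide_inverse)
        finally show ?thesis using True by simp
      qed (use q in auto)
    qed
  qed (use c in measurable)
qed

lemma contour_integral_linepath_same_Im:
  assumes ab: "a < b" and cont: "continuous_on {a..b} (\<lambda>u. G (Complex u c))"
  shows "contour_integral (linepath (Complex a c) (Complex b c)) G = integral {a..b} (\<lambda>u. G (Complex u c))"
proof (rule contour_integral_unique)
  let ?J = "integral {a..b} (\<lambda>u. G (Complex u c))"
  have "((\<lambda>u. G (Complex u c)) has_integral ?J) (cbox a b)"
    using cont by (simp add: integrable_integral integrable_continuous_real)
  then have "((\<lambda>x. G (Complex ((b - a) *\<^sub>R x + a) c)) has_integral (?J /\<^sub>R (b - a) ^ DIM(real))) (cbox ((a - a) /\<^sub>R (b - a)) ((b - a) /\<^sub>R (b - a)))"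
    using ab by (intro has_integral_affinity') auto
  then have "((\<lambda>x. G (Complex ((b - a) * x + a) c)) has_integral (?J /\<^sub>R (b - a))) {0..1}"
    using ab by simp
  then have "((\<lambda>x. G (Complex ((b - a) * x + a) c) * of_real (b - a)) has_integral (?J /\<^sub>R (b - a)) * of_real (b - a)) {0..1}"
    by (rule has_integral_mult_left)
  moreover have "(?J /\<^sub>R (b - a)) * of_real (b - a) = ?J"
    using ab by (simp add: scaleR_conv_of_real)
  moreover have "linepath (Complex a c) (Complex b c) x = Complex ((b - a) * x + a) c" for x
    by (simp add: linepath_def complex_eq_iff algebra_simps)
  moreover have "Complex b c - Complex a c = of_real (b - a)" by (simp add: complex_eq_iff)
  ultimately show "(G has_contour_integral ?J) (linepath (Complex a c) (Complex b c))"
    by (simp only: has_contour_integral_linepath)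
qed

lemma rectangle_contour_integral:
  assumes ab: "a < b" and cd: "c < d"
    and cont: "continuous_on {z. Re z \<in> {a..b} \<and> Im z \<in> {c..d} \<and> (Re z \<in> {a, b} \<or> Im z \<in> {c, d})} G"
    and I: "(G has_contour_integral I) (rectpath (Complex a c) (Complex b d))"
  shows "I = integral {a..b} (\<lambda>u. G (Complex u c)) + \<i> * integral {c..d} (\<lambda>v. G (Complex b v))
    - integral {a..b} (\<lambda>u. G (Complex u d)) - \<i> * integral {c..d} (\<lambda>v. G (Complex a v))"
proof -
  let ?S = "{z. Re z \<in> {a..b} \<and> Im z \<in> {c..d} \<and> (Re z \<in> {a, b} \<or> Im z \<in> {c, d})}"
  let ?p1 = "Complex a c" and ?p2 = "Complex b c" and ?p3 = "Complex b d" and ?p4 = "Complex a d"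
  have cc: "continuous_on A (\<lambda>x. Complex x c)" for A c unfolding Complex_eq by (intro continuous_intros)
  have seg: "closed_segment ?p1 ?p2 \<subseteq> ?S" "closed_segment ?p2 ?p3 \<subseteq> ?S" "closed_segment ?p4 ?p3 \<subseteq> ?S" "closed_segment ?p1 ?p4 \<subseteq> ?S"
    using ab cd by (auto simp: closed_segment_same_Re closed_segment_same_Im closed_segment_eq_real_ivl)
  note cs = continuous_on_subset[OF cont seg(1)] continuous_on_subset[OF cont seg(2)]
    continuous_on_subset[OF cont seg(3)] continuous_on_subset[OF cont seg(4)]
  have cs': "continuous_on (closed_segment ?p3 ?p4) G" "continuous_on (closed_segment ?p4 ?p1) G"
    using cs(3,4) by (simp_all add: closed_segment_commute)
  have ci: "G contour_integrable_on linepath ?p1 ?p2" "G contour_integrable_on linepath ?p2 ?p3"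
     "G contour_integrable_on linepath ?p3 ?p4" "G contour_integrable_on linepath ?p4 ?p1"
     "G contour_integrable_on linepath ?p4 ?p3"
    by (intro contour_integrable_continuous_linepath cs cs')+
  have "I = contour_integral (rectpath ?p1 ?p3) G" using I by (rule contour_integral_unique[symmetric])
  also have "\<dots> = contour_integral (linepath ?p1 ?p2) G + (contour_integral (linepath ?p2 ?p3) G +
    (contour_integral (linepath ?p3 ?p4) G + contour_integral (linepath ?p4 ?p1) G))"
    using ci by (simp add: rectpath_def Let_def contour_integrable_joinI)
  also have "contour_integral (linepath ?p3 ?p4) G = - contour_integral (linepath ?p4 ?p3) G"
    using cs' by (intro contour_integral_reverse_linepath)
  also have "contour_integral (linepath ?p4 ?p1) G = - contour_integral (linepath ?p1 ?p4) G"
    using cs' by (intro contour_integral_reverse_linepath)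
  also have "contour_integral (linepath ?p2 ?p3) G = \<i> * integral {c..d} (\<lambda>v. G (Complex b v))"
    using cd by (intro contour_integral_linepath_same_Re) auto
  also have "contour_integral (linepath ?p1 ?p4) G = \<i> * integral {c..d} (\<lambda>v. G (Complex a v))"
    using cd by (intro contour_integral_linepath_same_Re) auto
  also have "contour_integral (linepath ?p1 ?p2) G = integral {a..b} (\<lambda>u. G (Complex u c))"
    by (intro contour_integral_linepath_same_Im ab continuous_on_compose2[OF cont cc]) (use cd in auto)
  also have "contour_integral (linepath ?p4 ?p3) G = integral {a..b} (\<lambda>u. G (Complex u d))"
    by (intro contour_integral_linepath_same_Im ab continuous_on_compose2[OF cont cc]) (use cd in auto)
  finally show ?thesis by (simp add: algebra_simps)
qed

lemma has_integral_strip_curve: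
  assumes s: "s > 0" and L: "L > 0" and cont: "continuous_on (bdry s t) G"
  shows "((\<lambda>x. G (strip_curve s t x) * strip_dir s x) has_integral
    integral {- s..s} (\<lambda>u. G (Complex u t)) + \<i> * integral {t..t + L} (\<lambda>v. G (Complex s v))
      - \<i> * integral {t..t + L} (\<lambda>v. G (Complex (- s) v))) {- (s + L)..s + L}"
proof -
  let ?h = "\<lambda>x. G (strip_curve s t x) * strip_dir s x"
  have cc: "continuous_on A (\<lambda>x. Complex c x)" "continuous_on A (\<lambda>x. Complex x c)" for A c
    unfolding Complex_eq by (intro continuous_intros)+
  have int: "((\<lambda>u. G (Complex u t)) has_integral integral {- s..s} (\<lambda>u. G (Complex u t))) {- s..s}"
    "((\<lambda>v. G (Complex s v)) has_integral integral {t..t + L} (\<lambda>v. G (Complex s v))) {t..t + L}"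
    "((\<lambda>v. G (Complex (- s) v)) has_integral integral {t..t + L} (\<lambda>v. G (Complex (- s) v))) {t..t + L}"
    by (intro integrable_integral integrable_continuous_real continuous_on_compose2[OF cont] cc;
        use s in \<open>force simp: bdry_def bdry1_def bdry2_def bdry3_def\<close>)+
  have mid: "(?h has_integral integral {- s..s} (\<lambda>u. G (Complex u t))) {- s..s}"
    using int(1) by (rule has_integral_eq[rotated]) (auto simp: strip_curve_bottom strip_dir_def abs_le_iff)
  have right: "(?h has_integral \<i> * integral {t..t + L} (\<lambda>v. G (Complex s v))) {s..s + L}"
  proof -
    have "((\<lambda>x. G (Complex s (1 *\<^sub>R x + (t - s)))) has_integral integral {t..t + L} (\<lambda>v. G (Complex s v))) {s..s + L}"
      using has_integral_affinity'[of "\<lambda>v. G (Complex s v)" _ t "t + L" 1 "t - s"] int(2) by (simp add: algebra_simps)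
    then have "((\<lambda>x. \<i> * G (Complex s (1 *\<^sub>R x + (t - s)))) has_integral \<i> * integral {t..t + L} (\<lambda>v. G (Complex s v))) {s..s + L}"
      by (rule has_integral_mult_right)
    then show ?thesis
      by (rule has_integral_spike_finite[of "{s}", rotated 2])
        (use s in \<open>auto simp: strip_curve_left strip_curve_right strip_dir_def algebra_simps\<close>)
  qed
  have left: "(?h has_integral - (\<i> * integral {t..t + L} (\<lambda>v. G (Complex (- s) v)))) {- (s + L)..- s}"
  proof -
    have "((\<lambda>x. G (Complex (- s) (1 *\<^sub>R x + (t - s)))) has_integral integral {t..t + L} (\<lambda>v. G (Complex (- s) v))) {s..s + L}"
      using has_integral_affinity'[of "\<lambda>v. G (Complex (- s) v)" _ t "t + L" 1 "t - s"] int(3) by (simp add: algebra_simps)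
    then have "((\<lambda>x. G (Complex (- s) (1 *\<^sub>R (- x) + (t - s)))) has_integral integral {t..t + L} (\<lambda>v. G (Complex (- s) v))) {- (s + L)..- s}"
      by (rule has_integral_reflect_real[THEN iffD2])
    then have "((\<lambda>x. (- \<i>) * G (Complex (- s) (1 *\<^sub>R (- x) + (t - s)))) has_integral (- \<i>) * integral {t..t + L} (\<lambda>v. G (Complex (- s) v))) {- (s + L)..- s}"
      by (rule has_integral_mult_right)
    then have "(?h has_integral (- \<i>) * integral {t..t + L} (\<lambda>v. G (Complex (- s) v))) {- (s + L)..- s}"
      by (rule has_integral_spike_finite[of "{- s}", rotated 2])
        (use s in \<open>auto simp: strip_curve_left strip_curve_right strip_dir_def algebra_simps\<close>)
    then show ?thesis by simp
  qed
  have lm: "(?h has_integral - (\<i> * integral {t..t + L} (\<lambda>v. G (Complex (- s) v))) + integral {- s..s} (\<lambda>u. G (Complex u t))) {- (s + L)..s}"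
    by (rule has_integral_combine[OF _ _ left mid]) (use s L in auto)
  have "(?h has_integral (- (\<i> * integral {t..t + L} (\<lambda>v. G (Complex (- s) v))) + integral {- s..s} (\<lambda>u. G (Complex u t)))
     + \<i> * integral {t..t + L} (\<lambda>v. G (Complex s v))) {- (s + L)..s + L}"
    by (rule has_integral_combine[OF _ _ lm right]) (use s L in auto)
  then show ?thesis by (simp add: algebra_simps)
qed

text \<open>
  A function of the Hardy space, with its norm condition read in the arc-length parameters of the inner
  half-strips; \<open>B\<close> is the \<open>p\<close>-th power of a bound for the norm.
\<close>

locale strip_Hp =
  fixes \<sigma> p B :: real and F :: "complex \<Rightarrow> complex"
  assumes \<sigma>: "\<sigma> > 0" and p: "p > 1" and analytic: "F analytic_on half_strip \<sigma> 0"
    and Lp: "\<And>s t. 0 < s \<Longrightarrow> s < \<sigma> \<Longrightarrow> 0 < t \<Longrightarrow> integrable lborel (\<lambda>x. cmod (F (strip_curve s t x)) powr p)"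
    and Lp_le: "\<And>s t. 0 < s \<Longrightarrow> s < \<sigma> \<Longrightarrow> 0 < t \<Longrightarrow> (LINT x|lborel. cmod (F (strip_curve s t x)) powr p) \<le> B"
begin

text \<open>The exponent conjugate to \<open>p\<close>.\<close>

definition q :: real where "q = p / (p - 1)"

lemma q: "q > 1" "1 / p + 1 / q = 1"
  using p by (auto simp: q_def field_simps)

lemma bdry_subset_half_strip: "0 < s \<Longrightarrow> s < \<sigma> \<Longrightarrow> 0 < t \<Longrightarrow> bdry s t \<subseteq> half_strip \<sigma> 0"
  by (auto simp: bdry_def bdry1_def bdry2_def bdry3_def half_strip_def)

lemma continuous_F: "A \<subseteq> half_strip \<sigma> 0 \<Longrightarrow> continuous_on A F"
  using analytic by (meson analytic_imp_holomorphic continuous_on_subset holomorphic_on_imp_continuous_on)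

lemma measurable_F_curve:
  assumes "0 < s" "s < \<sigma>" "0 < t"
  shows "(\<lambda>x. F (strip_curve s t x)) \<in> borel_measurable borel"
  by (rule borel_measurable_continuous_onI, rule continuous_on_compose2[OF continuous_F continuous_strip_curve])
    (use assms bdry_subset_half_strip[OF assms] strip_curve_in_bdry in auto)

lemma convex_half_strip: "convex (half_strip s t)"
proof -
  have "half_strip s t = {z. Re z < s} \<inter> {z. Re z > - s} \<inter> {z. Im z > t}"
    by (auto simp: half_strip_def)
  then show ?thesis by (simp add: convex_Int convex_halfspace_Re_lt convex_halfspace_Re_gt convex_halfspace_Im_gt)
qed

text \<open>
  The segment at height \<open>T\<close> is part of the boundary of \<open>D\<^bsub>s,T\<^esub>\<close>, so the \<open>L\<^sup>p\<close> bound of \<open>F\<close> controls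
  it uniformly in \<open>T\<close>, while the Cauchy kernel decays.
\<close>

lemma top_side_bound:
  assumes st: "0 < s" "s < \<sigma>" "0 < T" and w: "Im w < T" and nw: "\<And>u. Complex u T \<noteq> w"
  shows "cmod (integral {- s..s} (\<lambda>u. F (Complex u T) / (Complex u T - w))) \<le> (2 * s + B) / (T - Im w)"
proof -
  have cc: "continuous_on A (\<lambda>x. Complex x c)" for A c unfolding Complex_eq by (intro continuous_intros)
  have cF: "continuous_on {- s..s} (\<lambda>u. F (Complex u T))"
    by (rule continuous_on_compose2[OF continuous_F[OF order_refl] cc]) (use st in \<open>auto simp: half_strip_def\<close>)
  have cFp: "continuous_on {- s..s} (\<lambda>u. cmod (F (Complex u T)) powr p)"
    by (rule continuous_on_powr'[OF continuous_on_norm[OF cF] continuous_on_const]) (use p in auto)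
  have int: "(\<lambda>u. F (Complex u T) / (Complex u T - w)) integrable_on {- s..s}"
    by (intro integrable_continuous_real continuous_intros cF cc) (use nw in auto)
  let ?g = "\<lambda>u. (1 + cmod (F (Complex u T)) powr p) / (T - Im w)"
  have ig: "?g integrable_on {- s..s}"
    by (intro integrable_continuous_real continuous_on_divide continuous_on_add continuous_on_const cFp) (use w in auto)
  have "cmod (integral {- s..s} (\<lambda>u. F (Complex u T) / (Complex u T - w))) \<le> integral {- s..s} ?g"
  proof (rule integral_norm_bound_integral[OF int ig])
    fix u
    have "T - Im w \<le> cmod (Complex u T - w)" using abs_Im_le_cmod[of "Complex u T - w"] by simp
    moreover have "cmod (F (Complex u T)) \<le> 1 + cmod (F (Complex u T)) powr p"
      by (rule le_one_plus_powr) (use p in auto)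
    ultimately show "norm (F (Complex u T) / (Complex u T - w)) \<le> ?g u"
      unfolding norm_divide using w by (intro frac_le) auto
  qed
  also have "integral {- s..s} ?g = (2 * s + integral {- s..s} (\<lambda>u. cmod (F (Complex u T)) powr p)) / (T - Im w)"
  proof -
    have i: "(\<lambda>u. cmod (F (Complex u T)) powr p) integrable_on {- s..s}"
      by (intro integrable_continuous_real cFp)
    have "integral {- s..s} (\<lambda>u. 1 + cmod (F (Complex u T)) powr p) = 2 * s + integral {- s..s} (\<lambda>u. cmod (F (Complex u T)) powr p)"
      using i st by (subst integral_add) auto
    then show ?thesis by (simp add: divide_inverse)
  qed
  also have "\<dots> \<le> (2 * s + B) / (T - Im w)"
  proof -
    have "integral {- s..s} (\<lambda>u. cmod (F (Complex u T)) powr p) = integral {- s..s} (\<lambda>u. cmod (F (strip_curve s T u)) powr p)"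
      by (intro integral_cong) (auto simp: strip_curve_bottom abs_le_iff)
    also have "\<dots> = (LINT u:{- s..s}|lborel. cmod (F (strip_curve s T u)) powr p)"
      by (rule set_borel_integral_eq_integral(2)[symmetric], unfold set_integrable_def)
        (intro integrable_mult_indicator Lp[OF st], simp)
    also have "\<dots> \<le> (LINT u|lborel. cmod (F (strip_curve s T u)) powr p)"
      unfolding set_lebesgue_integral_def
      using Lp[OF st] by (intro integral_mono integrable_mult_indicator) (auto simp: indicator_def)
    also have "\<dots> \<le> B" by (rule Lp_le[OF st])
    finally show ?thesis using w by (intro divide_right_mono) auto
  qed
  finally show ?thesis .
qed

lemma bdry_dist_pos:
  assumes s: "s > 0" and w: "w \<notin> bdry s t"
  obtains d where "d > 0" "\<And>x. cmod (strip_curve s t x - w) \<ge> d"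
proof -
  have "closed (bdry s t)" using frontier_half_strip[OF s, of t] by (metis frontier_closed)
  then obtain d where d: "d > 0" "\<And>\<zeta>. \<zeta> \<in> bdry s t \<Longrightarrow> d \<le> dist w \<zeta>"
    using separate_point_closed[of "bdry s t" w] w by blast
  show ?thesis
  proof (rule that[OF d(1)])
    show "cmod (strip_curve s t x - w) \<ge> d" for x
      using d(2)[OF strip_curve_in_bdry[OF s, of t x]] by (simp add: dist_norm norm_minus_commute)
  qed
qed

text \<open>
  The formula holds on rectangles with a top side at height \<open>t + n\<close>; for \<open>n \<rightarrow> \<infinity>\<close> the top side
  disappears.
\<close>

theorem cauchy_integral_strip_curve:
  assumes st: "0 < s" "s < \<sigma>" "0 < t" and w: "w \<in> half_strip s t \<or> w \<notin> closure (half_strip \<sigma> 0)"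
  shows "(LINT x|lborel. F (strip_curve s t x) * (strip_dir s x / (strip_curve s t x - w))) =
    (if w \<in> half_strip \<sigma> 0 then 2 * pi * \<i> * F w else 0)"
proof -
  define c where "c = (if w \<in> half_strip \<sigma> 0 then 2 * pi * \<i> * F w else 0)"
  let ?G = "\<lambda>\<zeta>. F \<zeta> / (\<zeta> - w)"
  let ?h = "\<lambda>x. F (strip_curve s t x) * (strip_dir s x / (strip_curve s t x - w))"
  have cl: "closure (half_strip \<sigma> 0) = {w. \<bar>Re w\<bar> \<le> \<sigma> \<and> Im w \<ge> 0}" using \<sigma> by (rule closure_half_strip)
  have w': "w \<in> half_strip s t \<or> \<not> (\<bar>Re w\<bar> \<le> \<sigma> \<and> Im w \<ge> 0)" using w unfolding cl by simp
  have wb: "w \<notin> bdry s t"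
    using w' st by (auto simp: half_strip_def bdry_def bdry1_def bdry2_def bdry3_def)
  have contG: "continuous_on A (\<lambda>\<zeta>. F \<zeta> / (\<zeta> - w))" if "A \<subseteq> half_strip \<sigma> 0" "w \<notin> A" for A
    by (intro continuous_on_divide continuous_on_diff continuous_on_id continuous_on_const continuous_F that(1))
      (use that in auto)
  obtain d where d: "d > 0" "\<And>x. cmod (strip_curve s t x - w) \<ge> d" using bdry_dist_pos[OF st(1) wb] by blast
  have kq: "integrable lborel (\<lambda>x. cmod (strip_dir s x / (strip_curve s t x - w)) powr q)"
    using cauchy_kernel_Lq[OF st(1) d(1), of UNIV t w q] d(2) q by simp
  note [measurable] = measurable_F_curve[OF st]
  have hi: "integrable lborel ?h"
    by (rule integrable_mult_Lp_Lq(1)[OF p q _ _ Lp[OF st] kq]) auto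
  \<comment> \<open>The rectangle of height \<open>n\<close> above the bottom; its top side lies above \<open>w\<close>.\<close>
  have trunc: "(LINT x:{- (s + real n)..s + real n}|lborel. ?h x) =
      c + integral {- s..s} (\<lambda>u. ?G (Complex u (t + real n)))" if n: "real n > 0" "real n > Im w - t" for n
  proof -
    let ?T = "t + real n"
    let ?S = "{z. Re z \<in> {- s..s} \<and> Im z \<in> {t..?T} \<and> (Re z \<in> {- s, s} \<or> Im z \<in> {t, ?T})}"
    have Ssub: "?S \<subseteq> half_strip \<sigma> 0" using st n by (auto simp: half_strip_def)
    have wS: "w \<notin> ?S" using w' st n by (auto simp: half_strip_def)
    have pi: "path_image (rectpath (Complex (- s) t) (Complex s ?T)) = ?S"
      using st n by (subst path_image_rectpath) auto
    have hc: "(?G has_contour_integral c) (rectpath (Complex (- s) t) (Complex s ?T))"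
    proof (cases "w \<in> half_strip \<sigma> 0")
      case True
      then have wst: "w \<in> half_strip s t" using w closure_subset by auto
      have "(?G has_contour_integral 2 * pi * \<i> * winding_number (rectpath (Complex (- s) t) (Complex s ?T)) w * F w) (rectpath (Complex (- s) t) (Complex s ?T))"
      proof (rule Cauchy_integral_formula_convex_simple)
        show "convex (half_strip \<sigma> 0)" by (rule convex_half_strip)
        show "F holomorphic_on half_strip \<sigma> 0" using analytic by (rule analytic_imp_holomorphic)
        show "w \<in> interior (half_strip \<sigma> 0)" using True by (simp add: interior_open open_half_strip)
        show "path_image (rectpath (Complex (- s) t) (Complex s ?T)) \<subseteq> half_strip \<sigma> 0 - {w}"
          unfolding pi using Ssub wS by blast
      qed auto
      moreover have "winding_number (rectpath (Complex (- s) t) (Complex s ?T)) w = 1"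
        using wst n by (intro winding_number_rectpath) (auto simp: in_box_complex_iff half_strip_def)
      ultimately show ?thesis using True by (simp add: c_def)
    next
      case False
      have "(?G has_contour_integral 0) (rectpath (Complex (- s) t) (Complex s ?T))"
      proof (rule Cauchy_theorem_convex_simple)
        show "?G holomorphic_on half_strip \<sigma> 0"
          using False analytic by (intro holomorphic_intros analytic_imp_holomorphic) auto
        show "convex (half_strip \<sigma> 0)" by (rule convex_half_strip)
        show "path_image (rectpath (Complex (- s) t) (Complex s ?T)) \<subseteq> half_strip \<sigma> 0" unfolding pi by (rule Ssub)
      qed auto
      then show ?thesis using False by (simp add: c_def)
    qed
    have c_eq: "c = integral {- s..s} (\<lambda>u. ?G (Complex u t)) + \<i> * integral {t..?T} (\<lambda>v. ?G (Complex s v))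
       - integral {- s..s} (\<lambda>u. ?G (Complex u ?T)) - \<i> * integral {t..?T} (\<lambda>v. ?G (Complex (- s) v))"
      by (rule rectangle_contour_integral[OF _ _ contG[OF Ssub wS] hc]) (use st n in auto)
    have "((\<lambda>x. ?G (strip_curve s t x) * strip_dir s x) has_integral
      integral {- s..s} (\<lambda>u. ?G (Complex u t)) + \<i> * integral {t..?T} (\<lambda>v. ?G (Complex s v))
      - \<i> * integral {t..?T} (\<lambda>v. ?G (Complex (- s) v))) {- (s + real n)..s + real n}"
      using st n wb by (intro has_integral_strip_curve contG bdry_subset_half_strip) auto
    then have "(?h has_integral c + integral {- s..s} (\<lambda>u. ?G (Complex u ?T))) {- (s + real n)..s + real n}"
      unfolding c_eq by (simp add: algebra_simps)
    moreover have "set_integrable lborel {- (s + real n)..s + real n} ?h"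
      unfolding set_integrable_def using hi by (intro integrable_mult_indicator) auto
    ultimately show ?thesis by (simp add: set_borel_integral_eq_integral(2) integral_unique)
  qed
  have "(\<lambda>n. LINT x:{- (s + real n)..s + real n}|lborel. ?h x) \<longlonglongrightarrow> (LINT x|lborel. ?h x)"
    unfolding set_lebesgue_integral_def
  proof (rule integral_dominated_convergence[where w = "\<lambda>x. norm (?h x)"])
    show "AE x in lborel. (\<lambda>n. indicator {- (s + real n)..s + real n} x *\<^sub>R ?h x) \<longlonglongrightarrow> ?h x"
    proof (rule AE_I2, rule tendsto_eventually)
      fix x
      obtain N where N: "\<bar>x\<bar> \<le> real N" using real_arch_simple by blast
      show "eventually (\<lambda>n. indicator {- (s + real n)..s + real n} x *\<^sub>R ?h x = ?h x) sequentially"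
        using eventually_ge_at_top[of N]
      proof eventually_elim
        case (elim n)
        then have "x \<in> {- (s + real n)..s + real n}" using N st by (auto simp: abs_le_iff)
        then show ?case by simp
      qed
    qed
  qed (use hi in \<open>auto simp: indicator_def\<close>)
  moreover have "(\<lambda>n. LINT x:{- (s + real n)..s + real n}|lborel. ?h x) \<longlonglongrightarrow> c"
  proof -
    have "eventually (\<lambda>n. real n > max 0 (Im w - t)) sequentially"
      by (rule eventually_compose_filterlim[OF eventually_gt_at_top filterlim_real_sequentially])
    then have ev: "eventually (\<lambda>n. real n > 0 \<and> real n > Im w - t) sequentially" by eventually_elim auto
    have "(\<lambda>n. integral {- s..s} (\<lambda>u. ?G (Complex u (t + real n)))) \<longlonglongrightarrow> 0"
    proof (rule Lim_null_comparison[where g = "\<lambda>n. (2 * s + B) / (t + real n - Im w)"])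
      show "eventually (\<lambda>n. norm (integral {- s..s} (\<lambda>u. ?G (Complex u (t + real n)))) \<le> (2 * s + B) / (t + real n - Im w)) sequentially"
        using ev
      proof eventually_elim
        case (elim n)
        then show ?case using st by (intro top_side_bound) auto
      qed
      show "(\<lambda>n. (2 * s + B) / (t + real n - Im w)) \<longlonglongrightarrow> 0" by real_asymp
    qed
    then have "(\<lambda>n. c + integral {- s..s} (\<lambda>u. ?G (Complex u (t + real n)))) \<longlonglongrightarrow> c + 0"
      by (intro tendsto_add tendsto_const)
    then show ?thesis
      using ev trunc by (subst tendsto_cong[where g = "\<lambda>n. c + integral {- s..s} (\<lambda>u. ?G (Complex u (t + real n)))"])
        (auto elim: eventually_mono)
  qed
  ultimately show ?thesis unfolding c_def by (rule LIMSEQ_unique)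
qed

end

section \<open>The boundary function as a weak limit\<close>

lemma Lp_bounded_Lq_null_imp_integral_tendsto_0:
  fixes y g :: "nat \<Rightarrow> 'a \<Rightarrow> complex"
  assumes pq: "p > 1" "q > 1" "1 / p + 1 / q = 1"
    and [measurable]: "\<And>n. y n \<in> borel_measurable M" "\<And>n. g n \<in> borel_measurable M"
    and y: "\<And>n. integrable M (\<lambda>x. cmod (y n x) powr p)" "\<And>n. (LINT x|M. cmod (y n x) powr p) \<le> B"
    and g: "\<And>n. integrable M (\<lambda>x. cmod (g n x) powr q)" "(\<lambda>n. LINT x|M. cmod (g n x) powr q) \<longlonglongrightarrow> 0"
  shows "(\<lambda>n. LINT x|M. y n x * g n x) \<longlonglongrightarrow> 0"
proof (rule LIMSEQ_I)
  fix e :: real assume e: "e > 0"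
  have B: "B \<ge> 0" by (rule order_trans[OF _ y(2)[of 0]]) simp
  define l where "l = e / 2 / (B + 1)"
  have l: "l > 0" "l * B < e / 2" using B e by (auto simp: l_def field_simps)
  define C where "C = l powr (- (q / p))"
  have C: "C > 0" using l by (simp add: C_def)
  have "eventually (\<lambda>n. (LINT x|M. cmod (g n x) powr q) < e / 2 / C) sequentially"
    using g(2) by (rule order_tendstoD) (use e C in simp)
  then obtain N where N: "\<And>n. n \<ge> N \<Longrightarrow> (LINT x|M. cmod (g n x) powr q) < e / 2 / C"
    by (auto simp: eventually_sequentially)
  show "\<exists>N. \<forall>n\<ge>N. norm ((LINT x|M. y n x * g n x) - 0) < e"
  proof (intro exI allI impI)
    fix n assume n: "n \<ge> N"
    have "norm (LINT x|M. y n x * g n x) \<le> (LINT x|M. cmod (y n x * g n x))"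
      by (rule integral_norm_bound)
    also have "\<dots> \<le> l * (LINT x|M. cmod (y n x) powr p) + C * (LINT x|M. cmod (g n x) powr q)"
      unfolding C_def by (rule integrable_mult_Lp_Lq(2)[OF pq _ _ y(1) g(1) l(1)]) auto
    also have "\<dots> < e / 2 + e / 2"
    proof (rule add_strict_mono)
      show "l * (LINT x|M. cmod (y n x) powr p) < e / 2"
        by (rule le_less_trans[OF mult_left_mono[OF y(2)] l(2)]) (use l in simp)
      show "C * (LINT x|M. cmod (g n x) powr q) < e / 2"
        using N[OF n] C by (simp add: pos_less_divide_eq mult.commute)
    qed
    finally show "norm ((LINT x|M. y n x * g n x) - 0) < e" by simp
  qed
qed

text \<open>
  The Cauchy integral over the part of the boundary with parameters in \<open>A\<close>, without the factor
  \<open>1 / (2 \<pi> \<i>)\<close>.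
\<close>

definition cauchy_part :: "real \<Rightarrow> real set \<Rightarrow> (real \<Rightarrow> complex) \<Rightarrow> complex \<Rightarrow> complex" where
  "cauchy_part s A f w = (LINT x|lborel. f x * (indicator A x *\<^sub>R (strip_dir s x / (strip_curve s 0 x - w))))"

lemma integrable_cauchy_part:
  assumes pq: "p > 1" "q > 1" "1 / p + 1 / q = 1" and s: "s > 0"
    and [measurable]: "f \<in> borel_measurable borel" "A \<in> sets borel"
    and f: "integrable lborel (\<lambda>x. cmod (f x) powr p)"
    and d: "d > 0" "\<And>x. x \<in> A \<Longrightarrow> cmod (strip_curve s 0 x - w) \<ge> d"
  shows "integrable lborel (\<lambda>x. f x * (indicator A x *\<^sub>R (strip_dir s x / (strip_curve s 0 x - w))))"
  by (rule integrable_mult_Lp_Lq(1)[OF pq _ _ f cauchy_kernel_Lq[OF s d pq(2)]]) auto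

text \<open>
  Near \<open>w\<^sub>0\<close> the kernel at \<open>w\<close> differs from the one at \<open>w\<^sub>0\<close> by at most \<open>2 |w - w\<^sub>0| / d\<close> times the
  modulus of the latter, which is integrable against \<open>f\<close>.
\<close>

lemma isCont_cauchy_part:
  assumes pq: "p > 1" "q > 1" "1 / p + 1 / q = 1" and s: "s > 0"
    and [measurable]: "f \<in> borel_measurable borel" "A \<in> sets borel"
    and f: "integrable lborel (\<lambda>x. cmod (f x) powr p)"
    and d: "d > 0" "\<And>x. x \<in> A \<Longrightarrow> cmod (strip_curve s 0 x - w\<^sub>0) \<ge> d"
  shows "isCont (cauchy_part s A f) w\<^sub>0"
proof -
  let ?k = "\<lambda>w x. f x * (indicator A x *\<^sub>R (strip_dir s x / (strip_curve s 0 x - w)))"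
  define I where "I = (LINT x|lborel. cmod (?k w\<^sub>0 x))"
  have int0: "integrable lborel (?k w\<^sub>0)" by (rule integrable_cauchy_part[OF pq s _ _ f d]) auto
  have le: "cmod (cauchy_part s A f w - cauchy_part s A f w\<^sub>0) \<le> 2 / d * I * dist w w\<^sub>0" if w: "dist w w\<^sub>0 \<le> d / 2" for w
  proof -
    have far: "cmod (strip_curve s 0 x - w) \<ge> d / 2" if "x \<in> A" for x
      using d(2)[OF that] w norm_triangle_ineq[of "strip_curve s 0 x - w" "w - w\<^sub>0"] by (simp add: dist_norm)
    have int: "integrable lborel (?k w)" by (rule integrable_cauchy_part[OF pq s _ _ f _ far]) (use d in auto)
    have eq: "cauchy_part s A f w - cauchy_part s A f w\<^sub>0 = (LINT x|lborel. ?k w x - ?k w\<^sub>0 x)"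
      unfolding cauchy_part_def using int int0 by simp
    have "cmod (cauchy_part s A f w - cauchy_part s A f w\<^sub>0) \<le> (LINT x|lborel. cmod (?k w x - ?k w\<^sub>0 x))"
      unfolding eq by (rule integral_norm_bound)
    also have "\<dots> \<le> (LINT x|lborel. 2 / d * dist w w\<^sub>0 * cmod (?k w\<^sub>0 x))"
    proof (rule integral_mono)
      fix x
      show "cmod (?k w x - ?k w\<^sub>0 x) \<le> 2 / d * dist w w\<^sub>0 * cmod (?k w\<^sub>0 x)"
      proof (cases "x \<in> A")
        case True
        let ?z = "strip_curve s 0 x"
        have nz: "?z - w \<noteq> 0" "?z - w\<^sub>0 \<noteq> 0" using far[OF True] d(1) d(2)[OF True] by auto
        have "?k w x - ?k w\<^sub>0 x = ?k w\<^sub>0 x * ((w - w\<^sub>0) / (?z - w))"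
          using True nz by (simp add: field_simps)
        then have "cmod (?k w x - ?k w\<^sub>0 x) = cmod (?k w\<^sub>0 x) * (dist w w\<^sub>0 / cmod (?z - w))"
          by (simp only: norm_mult norm_divide dist_norm)
        also have "\<dots> \<le> cmod (?k w\<^sub>0 x) * (dist w w\<^sub>0 / (d / 2))"
          using far[OF True] d(1) nz by (intro mult_left_mono divide_left_mono mult_pos_pos) auto
        finally show ?thesis by (simp add: field_simps)
      qed (use d in auto)
    qed (intro integrable_norm Bochner_Integration.integrable_diff integrable_mult_right int int0)+
    also have "\<dots> = 2 / d * I * dist w w\<^sub>0" by (simp add: I_def)
    finally show ?thesis .
  qed
  have "((\<lambda>w. cauchy_part s A f w - cauchy_part s A f w\<^sub>0) \<longlongrightarrow> 0) (at w\<^sub>0)"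
  proof (rule Lim_null_comparison)
    have "eventually (\<lambda>w. dist w w\<^sub>0 < d / 2) (at w\<^sub>0)" using d(1) by (auto simp: eventually_at intro!: exI[of _ "d / 2"])
    then show "eventually (\<lambda>w. norm (cauchy_part s A f w - cauchy_part s A f w\<^sub>0) \<le> 2 / d * I * dist w w\<^sub>0) (at w\<^sub>0)"
      by eventually_elim (rule le, simp)
    have "((\<lambda>w. 2 / d * I * dist w w\<^sub>0) \<longlongrightarrow> 2 / d * I * dist w\<^sub>0 w\<^sub>0) (at w\<^sub>0)" by (intro tendsto_intros)
    then show "((\<lambda>w. 2 / d * I * dist w w\<^sub>0) \<longlongrightarrow> 0) (at w\<^sub>0)" by simp
  qed
  then show ?thesis by (simp add: isCont_def LIM_zero_iff)
qed

context strip_Hp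
begin

lemma half_strip_eq_complement: "- bdry \<sigma> 0 = half_strip \<sigma> 0 \<union> - closure (half_strip \<sigma> 0)"
  using frontier_half_strip[OF \<sigma>, of 0] open_half_strip[of \<sigma> 0] closure_subset[of "half_strip \<sigma> 0"]
  by (auto simp: frontier_def interior_open)

text \<open>
  The values that the Cauchy integral of the boundary function has to take.
\<close>

definition cauchy_value :: "complex \<Rightarrow> complex" where
  "cauchy_value w = (if w \<in> half_strip \<sigma> 0 then 2 * pi * \<i> * F w else 0)"

lemma isCont_cauchy_value:
  assumes "w \<notin> bdry \<sigma> 0"
  shows "isCont cauchy_value w"
proof (cases "w \<in> half_strip \<sigma> 0")
  case True
  have "continuous_on (half_strip \<sigma> 0) (\<lambda>w. 2 * pi * \<i> * F w)"
    by (intro continuous_intros continuous_F order_refl)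
  then have "continuous_on (half_strip \<sigma> 0) cauchy_value"
    by (rule continuous_on_eq) (simp add: cauchy_value_def)
  then show ?thesis using True open_half_strip by (simp add: continuous_on_eq_continuous_at)
next
  case False
  then have w: "w \<in> - closure (half_strip \<sigma> 0)" using assms half_strip_eq_complement by blast
  have "continuous_on (- closure (half_strip \<sigma> 0)) (\<lambda>w. 0 :: complex)" by (rule continuous_on_const)
  then have "continuous_on (- closure (half_strip \<sigma> 0)) cauchy_value"
    by (rule continuous_on_eq) (use closure_subset in \<open>auto simp: cauchy_value_def\<close>)
  then show ?thesis using w by (simp add: continuous_on_eq_continuous_at open_Compl)
qed

text \<open>Any null sequence in the open interval from \<open>0\<close> to \<open>\<sigma>\<close> would serve.\<close>

definition \<tau> :: "nat \<Rightarrow> real" where "\<tau> n = \<sigma> / (real n + 2)"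

lemma \<tau>: "0 < \<tau> n" "\<tau> n < \<sigma>" "\<tau> \<longlonglongrightarrow> 0"
proof -
  show "0 < \<tau> n" using \<sigma> by (simp add: \<tau>_def)
  show "\<tau> n < \<sigma>" 
    using \<sigma> mult_strict_left_mono[of 1 "real n + 2" \<sigma>] by (simp add: \<tau>_def pos_divide_less_eq)
  show "\<tau> \<longlonglongrightarrow> 0" unfolding \<tau>_def by real_asymp
qed

text \<open>
  The tangents of the two curves differ near the corners, on sets that shrink but do not vanish; so
  the kernels converge only pointwise almost everywhere, and in \<open>L\<^sup>q\<close> by domination.
\<close>

lemma cauchy_kernel_converges:
  assumes w: "w \<notin> bdry \<sigma> 0"
  defines "g \<equiv> \<lambda>n x. strip_dir (\<sigma> - \<tau> n) x / (strip_curve (\<sigma> - \<tau> n) (\<tau> n) x - w) - strip_dir \<sigma> x / (strip_curve \<sigma> 0 x - w)"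
  shows "\<exists>N. (\<forall>n\<ge>N. integrable lborel (\<lambda>x. cmod (g n x) powr q)) \<and> (\<lambda>n. LINT x|lborel. cmod (g (n + N) x) powr q) \<longlonglongrightarrow> 0"
proof -
  obtain d where d: "d > 0" "\<And>x. cmod (strip_curve \<sigma> 0 x - w) \<ge> d" using bdry_dist_pos[OF \<sigma> w] by blast
  let ?k = "\<lambda>x. strip_dir \<sigma> x / (strip_curve \<sigma> 0 x - w)"
  have [measurable]: "g n \<in> borel_measurable borel" for n unfolding g_def by measurable
  have kq: "integrable lborel (\<lambda>x. cmod (?k x) powr q)"
    using cauchy_kernel_Lq[OF \<sigma> d(1), of UNIV 0 w q] d(2) q by simp
  have curve: "dist (strip_curve (\<sigma> - \<tau> n) (\<tau> n) x) (strip_curve \<sigma> 0 x) \<le> 3 * \<tau> n" for n x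
    using dist_strip_curve[of "\<sigma> - \<tau> n" "\<tau> n" x \<sigma> 0] \<tau>(1)[of n] by simp
  have "eventually (\<lambda>n. \<tau> n < d / 6) sequentially" using \<tau>(3) by (rule order_tendstoD) (use d in simp)
  then obtain N where N: "\<And>n. n \<ge> N \<Longrightarrow> \<tau> n < d / 6" by (auto simp: eventually_sequentially)
  have le: "cmod (g n x) \<le> 3 * cmod (?k x)" if n: "n \<ge> N" for n x
  proof -
    let ?z = "strip_curve \<sigma> 0 x" and ?z' = "strip_curve (\<sigma> - \<tau> n) (\<tau> n) x"
    have "cmod (?z - ?z') \<le> d / 2" using curve[of n x] N[OF n] by (simp add: dist_norm norm_minus_commute)
    then have "cmod (?z - w) / 2 \<le> cmod (?z' - w)"
      using d(2)[of x] norm_triangle_ineq[of "?z - ?z'" "?z' - w"] by simp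
    then have "cmod (strip_dir (\<sigma> - \<tau> n) x / (?z' - w)) \<le> 1 / (cmod (?z - w) / 2)"
      unfolding norm_divide cmod_strip_dir using d(1) d(2)[of x] by (intro divide_left_mono mult_pos_pos) linarith+
    also have "\<dots> = 2 * cmod (?k x)" by (simp add: norm_divide)
    finally show ?thesis
      unfolding g_def by (intro order_trans[OF norm_triangle_ineq4]) simp
  qed
  have le_q: "cmod (g n x) powr q \<le> 3 powr q * cmod (?k x) powr q" if n: "n \<ge> N" for n x
  proof -
    have "cmod (g n x) powr q \<le> (3 * cmod (?k x)) powr q" using le[OF n] q by (intro powr_mono2) auto
    then show ?thesis by (simp add: powr_mult)
  qed
  have int: "integrable lborel (\<lambda>x. cmod (g n x) powr q)" if n: "n \<ge> N" for n
    by (rule Bochner_Integration.integrable_bound[where f = "\<lambda>x. 3 powr q * cmod (?k x) powr q"])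
      (use kq le_q[OF n] in auto)
  have "(\<lambda>n. LINT x|lborel. cmod (g (n + N) x) powr q) \<longlonglongrightarrow> (LINT x::real|lborel. (0::real))"
  proof (rule integral_dominated_convergence[where w = "\<lambda>x. 3 powr q * cmod (?k x) powr q"])
    show "integrable lborel (\<lambda>x. 3 powr q * cmod (?k x) powr q)" using kq by simp
    show "AE x in lborel. norm (cmod (g (n + N) x) powr q) \<le> 3 powr q * cmod (?k x) powr q" for n
      using le_q[of "n + N"] by simp
    show "AE x in lborel. (\<lambda>n. cmod (g (n + N) x) powr q) \<longlonglongrightarrow> 0"
      using AE_lborel_singleton[of \<sigma>] AE_lborel_singleton[of "- \<sigma>"]
    proof eventually_elim
      case (elim x)
      have "eventually (\<lambda>n. \<tau> n < \<bar>\<bar>x\<bar> - \<sigma>\<bar>) sequentially" using \<tau>(3) by (rule order_tendstoD) (use elim \<sigma> in auto)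
      then have dir: "eventually (\<lambda>n. strip_dir (\<sigma> - \<tau> n) x = strip_dir \<sigma> x) sequentially"
      proof eventually_elim
        case (elim n)
        then show ?case using \<tau>(1,2)[of n] by (auto simp: strip_dir_def abs_if split: if_splits)
      qed
      have "(\<lambda>n. strip_curve (\<sigma> - \<tau> n) (\<tau> n) x) \<longlonglongrightarrow> strip_curve \<sigma> 0 x"
      proof (rule metric_tendsto_imp_tendsto)
        show "(\<lambda>n. 3 * \<tau> n) \<longlonglongrightarrow> 0" using tendsto_mult_left[OF \<tau>(3), of 3] by simp
        show "eventually (\<lambda>n. dist (strip_curve (\<sigma> - \<tau> n) (\<tau> n) x) (strip_curve \<sigma> 0 x) \<le> dist (3 * \<tau> n) 0) sequentially"
          using curve \<tau>(1) by (simp add: less_imp_le)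
      qed
      then have "(\<lambda>n. strip_dir \<sigma> x / (strip_curve (\<sigma> - \<tau> n) (\<tau> n) x - w) - ?k x) \<longlonglongrightarrow> ?k x - ?k x"
        using d(1) d(2)[of x] by (intro tendsto_intros) auto
      then have "(\<lambda>n. g n x) \<longlonglongrightarrow> 0"
        using dir by (subst tendsto_cong[where g = "\<lambda>n. strip_dir \<sigma> x / (strip_curve (\<sigma> - \<tau> n) (\<tau> n) x - w) - ?k x"])
          (auto simp: g_def elim: eventually_mono)
      then have "(\<lambda>n. cmod (g n x) powr q) \<longlonglongrightarrow> cmod 0 powr q"
        using q by (intro tendsto_powr2 tendsto_norm tendsto_const) auto
      then show ?case by (intro LIMSEQ_ignore_initial_segment) simp
    qed
  qed auto
  then show ?thesis using int by (intro exI[of _ N]) auto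
qed

text \<open>
  On the inner curves Cauchy's formula is exact.  Replacing the kernel of the inner curve by the one of
  the outer curve costs the pairing of a bounded sequence in \<open>L\<^sup>p\<close> with a null sequence in \<open>L\<^sup>q\<close>.
\<close>

lemma weak_limit_against_cauchy_kernel:
  assumes w: "w \<notin> bdry \<sigma> 0"
  shows "(\<lambda>n. LINT x|lborel. F (strip_curve (\<sigma> - \<tau> n) (\<tau> n) x) * (strip_dir \<sigma> x / (strip_curve \<sigma> 0 x - w))) \<longlonglongrightarrow> cauchy_value w"
proof -
  let ?y = "\<lambda>n x. F (strip_curve (\<sigma> - \<tau> n) (\<tau> n) x)"
  let ?k = "\<lambda>x. strip_dir \<sigma> x / (strip_curve \<sigma> 0 x - w)"
  define g where "g n x = strip_dir (\<sigma> - \<tau> n) x / (strip_curve (\<sigma> - \<tau> n) (\<tau> n) x - w) - ?k x" for n x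
  obtain N where N: "\<And>n. n \<ge> N \<Longrightarrow> integrable lborel (\<lambda>x. cmod (g n x) powr q)"
    "(\<lambda>n. LINT x|lborel. cmod (g (n + N) x) powr q) \<longlonglongrightarrow> 0"
    using cauchy_kernel_converges[OF w] unfolding g_def by blast
  have st: "0 < \<sigma> - \<tau> n" "\<sigma> - \<tau> n < \<sigma>" "0 < \<tau> n" for n using \<tau>(1,2)[of n] by auto
  note [measurable] = measurable_F_curve[OF st]
  have [measurable]: "g n \<in> borel_measurable borel" for n unfolding g_def by measurable
  obtain d where d: "d > 0" "\<And>x. cmod (strip_curve \<sigma> 0 x - w) \<ge> d" using bdry_dist_pos[OF \<sigma> w] by blast
  have kq: "integrable lborel (\<lambda>x. cmod (?k x) powr q)"
    using cauchy_kernel_Lq[OF \<sigma> d(1), of UNIV 0 w q] d(2) q by simp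
  have yk: "integrable lborel (\<lambda>x. ?y n x * ?k x)" for n
    by (rule integrable_mult_Lp_Lq(1)[OF p q _ _ Lp[OF st] kq]) auto
  have yg: "integrable lborel (\<lambda>x. ?y n x * g n x)" if "n \<ge> N" for n
    by (rule integrable_mult_Lp_Lq(1)[OF p q _ _ Lp[OF st] N(1)[OF that]]) auto
  have 0: "(\<lambda>n. LINT x|lborel. ?y (n + N) x * g (n + N) x) \<longlonglongrightarrow> 0"
    by (rule Lp_bounded_Lq_null_imp_integral_tendsto_0[OF p q _ _ Lp[OF st] Lp_le[OF st] N(1) N(2)]) auto
  have "eventually (\<lambda>n. w \<in> half_strip (\<sigma> - \<tau> n) (\<tau> n) \<or> w \<notin> closure (half_strip \<sigma> 0)) sequentially"
  proof (cases "w \<in> half_strip \<sigma> 0")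
    case True
    have "eventually (\<lambda>n. \<tau> n < min (\<sigma> - \<bar>Re w\<bar>) (Im w)) sequentially"
      using \<tau>(3) by (rule order_tendstoD) (use True in \<open>auto simp: half_strip_def\<close>)
    then show ?thesis by eventually_elim (auto simp: half_strip_def)
  next
    case False
    then show ?thesis using w half_strip_eq_complement by auto
  qed
  then have "eventually (\<lambda>n. (LINT x|lborel. ?y n x * ?k x) = cauchy_value w - (LINT x|lborel. ?y n x * g n x)) sequentially"
    using eventually_ge_at_top[of N]
  proof eventually_elim
    case (elim n)
    have "(LINT x|lborel. ?y n x * ?k x) + (LINT x|lborel. ?y n x * g n x) = (LINT x|lborel. ?y n x * ?k x + ?y n x * g n x)"
      using yk yg[OF elim(2)] by simp
    also have "\<dots> = cauchy_value w"
      using cauchy_integral_strip_curve[OF st elim(1)] by (simp add: g_def cauchy_value_def algebra_simps)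
    finally show ?case by (simp add: algebra_simps)
  qed
  moreover have "(\<lambda>n. cauchy_value w - (LINT x|lborel. ?y n x * g n x)) \<longlonglongrightarrow> cauchy_value w - 0"
    by (rule LIMSEQ_offset[of _ N]) (intro tendsto_diff tendsto_const 0)
  ultimately show ?thesis by (simp add: tendsto_cong)
qed

text \<open>
  Weak compactness is applied with the Cauchy kernels at countably many dense points; both sides of the
  Cauchy formula are continuous off the boundary, so it extends to all points.
\<close>

theorem boundary_function_exists:
  obtains f where "f \<in> borel_measurable borel" "integrable lborel (\<lambda>x. cmod (f x) powr p)"
    "(LINT x|lborel. cmod (f x) powr p) \<le> B" "\<And>w. w \<notin> bdry \<sigma> 0 \<Longrightarrow> cauchy_part \<sigma> UNIV f w = cauchy_value w"
proof -
  obtain T where T: "countable T" "T \<subseteq> - bdry \<sigma> 0" "- bdry \<sigma> 0 \<subseteq> closure T"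
    using separable[of "- bdry \<sigma> 0"] by blast
  have "Complex 0 (-1) \<in> - bdry \<sigma> 0" by (simp add: bdry_def bdry1_def bdry2_def bdry3_def)
  then have Tne: "T \<noteq> {}" using T(3) by auto
  define w where "w j = from_nat_into T j" for j
  have wT: "w j \<in> T" for j unfolding w_def using Tne by (rule from_nat_into)
  then have w: "w j \<notin> bdry \<sigma> 0" for j using T(2) by auto
  let ?y = "\<lambda>n x. F (strip_curve (\<sigma> - \<tau> n) (\<tau> n) x)"
  let ?k = "\<lambda>w x. strip_dir \<sigma> x / (strip_curve \<sigma> 0 x - w)"
  have st: "0 < \<sigma> - \<tau> n" "\<sigma> - \<tau> n < \<sigma>" "0 < \<tau> n" for n using \<tau>(1,2)[of n] by auto
  note [measurable] = measurable_F_curve[OF st]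
  have kq: "integrable lborel (\<lambda>x. cmod (?k (w j) x) powr q)" for j
  proof -
    obtain d where "d > 0" "\<And>x. cmod (strip_curve \<sigma> 0 x - w j) \<ge> d" using bdry_dist_pos[OF \<sigma> w] by blast
    then show ?thesis using cauchy_kernel_Lq[OF \<sigma>, of d UNIV 0 "w j" q] q by simp
  qed
  obtain f where f: "f \<in> borel_measurable lborel" "integrable lborel (\<lambda>x. cmod (f x) powr p)"
    "(LINT x|lborel. cmod (f x) powr p) \<le> B" "\<And>j. (LINT x|lborel. f x * ?k (w j) x) = cauchy_value (w j)"
    by (rule Lp_weak_compactness[OF lborel.sigma_finite_measure_axioms p q, of ?y "\<lambda>j. ?k (w j)" B "\<lambda>j. cauchy_value (w j)"])
      (use Lp[OF st] Lp_le[OF st] kq weak_limit_against_cauchy_kernel[OF w] in auto)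
  then have [measurable]: "f \<in> borel_measurable borel" by simp
  show ?thesis
  proof (rule that[OF _ f(2,3)])
    fix z assume z: "z \<notin> bdry \<sigma> 0"
    then have "z \<in> closure T" using T(3) by auto
    then obtain u where u: "\<And>n. u n \<in> T" "u \<longlonglongrightarrow> z" unfolding closure_sequential by blast
    have uval: "cauchy_part \<sigma> UNIV f (u n) = cauchy_value (u n)" for n
    proof -
      obtain j where "w j = u n" unfolding w_def using from_nat_into_surj[OF T(1) u(1)] by blast
      then show ?thesis using f(4)[of j] by (simp add: cauchy_part_def)
    qed
    obtain d where d: "d > 0" "\<And>x. cmod (strip_curve \<sigma> 0 x - z) \<ge> d" using bdry_dist_pos[OF \<sigma> z] by blast
    have "isCont (cauchy_part \<sigma> UNIV f) z"
      by (rule isCont_cauchy_part[OF p q \<sigma> _ _ f(2) d]) auto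
    then have "(\<lambda>n. cauchy_part \<sigma> UNIV f (u n)) \<longlonglongrightarrow> cauchy_part \<sigma> UNIV f z" using u(2) by (rule isCont_tendsto_compose)
    moreover have "(\<lambda>n. cauchy_value (u n)) \<longlonglongrightarrow> cauchy_value z"
      using isCont_cauchy_value[OF z] u(2) by (rule isCont_tendsto_compose)
    ultimately show "cauchy_part \<sigma> UNIV f z = cauchy_value z" unfolding uval by (rule LIMSEQ_unique)
  qed simp
qed

end

section \<open>Reflection across a side and non-tangential limits\<close>

text \<open>
  The parameters of the side that contains the point with parameter \<open>x\<close>; the corners are assigned
  to the bottom.
\<close>

definition strip_side :: "real \<Rightarrow> real \<Rightarrow> real set" where
  "strip_side s x = (if x < - s then {..<- s} else if x \<le> s then {- s..s} else {s<..})"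

lemma strip_side_borel [measurable]: "strip_side s x \<in> sets borel"
  by (simp add: strip_side_def)

lemma strip_dir_nonzero [simp]: "strip_dir s x \<noteq> 0"
  by (simp add: strip_dir_def)

lemma self_in_strip_side: "x \<in> strip_side s x"
  by (simp add: strip_side_def)

lemma strip_dir_on_side: "s > 0 \<Longrightarrow> y \<in> strip_side s x \<Longrightarrow> strip_dir s y = strip_dir s x"
  by (auto simp: strip_side_def strip_dir_def split: if_splits)

lemma strip_curve_on_side:
  assumes s: "s > 0" and y: "y \<in> strip_side s x"
  shows "strip_curve s t y = strip_curve s t x + strip_dir s x * of_real (y - x)"
proof -
  consider "x < - s" "y < - s" | "\<bar>x\<bar> \<le> s" "\<bar>y\<bar> \<le> s" | "x > s" "y > s"
    using y by (force simp: strip_side_def split: if_splits)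
  then show ?thesis
    by cases (use s in \<open>auto simp: strip_curve_left strip_curve_right strip_curve_bottom strip_dir_def complex_eq_iff\<close>)
qed

text \<open>
  The heart of the matter: the points \<open>z + e (a + \<i> b)\<close> and \<open>z + e (a - \<i> b)\<close> are reflections of each
  other in the line of the side through \<open>z\<close>, and on this side the difference of their Cauchy kernels is a
  Poisson kernel.
\<close>

lemma reflected_cauchy_kernel:
  fixes s t x y a b :: real
  assumes s: "s > 0" and b: "b > 0" and y: "y \<in> strip_side s x"
  defines "e \<equiv> strip_dir s x" and "z \<equiv> strip_curve s t x"
  shows "strip_dir s y / (strip_curve s t y - (z + e * Complex a b)) - strip_dir s y / (strip_curve s t y - (z + e * Complex a (- b)))
    = 2 * pi * \<i> * of_real (poisson b (y - (x + a)))"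
proof -
  define u where "u = y - (x + a)"
  have e0: "e \<noteq> 0" by (simp add: e_def)
  have 1: "strip_curve s t y - (z + e * Complex a b) = e * Complex u (- b)"
    "strip_curve s t y - (z + e * Complex a (- b)) = e * Complex u b"
    unfolding strip_curve_on_side[OF s y] z_def e_def u_def by (auto simp: complex_eq_iff algebra_simps)
  have nz: "Complex u (- b) \<noteq> 0" "Complex u b \<noteq> 0" using b by (auto simp: complex_eq_iff)
  have p: "u\<^sup>2 + b\<^sup>2 > 0" using b by (simp add: add_nonneg_pos)
  have "1 / Complex u (- b) - 1 / Complex u b = (1 * Complex u b - 1 * Complex u (- b)) / (Complex u (- b) * Complex u b)"
    using nz by (rule diff_frac_eq)
  also have "1 * Complex u b - 1 * Complex u (- b) = Complex 0 (2 * b)" by (simp add: complex_eq_iff)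
  also have "Complex u (- b) * Complex u b = of_real (u\<^sup>2 + b\<^sup>2)" by (simp add: complex_eq_iff power2_eq_square)
  also have "Complex 0 (2 * b) / of_real (u\<^sup>2 + b\<^sup>2) = 2 * pi * \<i> * of_real (poisson b u)"
    using p by (simp add: poisson_def complex_eq_iff add.commute)
  finally have "1 / Complex u (- b) - 1 / Complex u b = 2 * pi * \<i> * of_real (poisson b u)" .
  moreover have "e / (e * Complex u (- b)) - e / (e * Complex u b) = 1 / Complex u (- b) - 1 / Complex u b"
    using e0 by simp
  ultimately show ?thesis unfolding 1 strip_dir_on_side[OF s y] e_def[symmetric] u_def by simp
qed

lemma off_side_distance:
  assumes s: "s > 0" and y: "y \<notin> strip_side s x"
  shows "cmod (strip_curve s t y - strip_curve s t x) \<ge> min \<bar>\<bar>x\<bar> - s\<bar> (2 * s)"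
proof -
  let ?D = "strip_curve s t y - strip_curve s t x"
  consider "x < - s" "\<bar>y\<bar> \<le> s" | "x < - s" "y > s" | "\<bar>x\<bar> \<le> s" "y < - s" | "\<bar>x\<bar> \<le> s" "y > s" | "x > s" "\<bar>y\<bar> \<le> s" | "x > s" "y < - s"
    using y by (force simp: strip_side_def split: if_splits)
  then have "min \<bar>\<bar>x\<bar> - s\<bar> (2 * s) \<le> \<bar>Re ?D\<bar> \<or> min \<bar>\<bar>x\<bar> - s\<bar> (2 * s) \<le> \<bar>Im ?D\<bar>"
    by cases (use s in \<open>auto simp: strip_curve_left strip_curve_right strip_curve_bottom\<close>)
  then show ?thesis using abs_Re_le_cmod[of ?D] abs_Im_le_cmod[of ?D] by linarith
qed

lemma reflected_point_outside:
  assumes s: "s > 0" and b: "b > 0"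
  shows "strip_curve s 0 x + strip_dir s x * Complex a (- b) \<notin> closure (half_strip s 0)"
proof -
  consider "x < - s" | "\<bar>x\<bar> \<le> s" | "x > s" by linarith
  then show ?thesis
    unfolding closure_half_strip[OF s]
    by cases (use s b in \<open>auto simp: strip_curve_left strip_curve_right strip_curve_bottom strip_dir_def\<close>)
qed

text \<open>
  In the frame of tangent and inward normal the three shapes of approach regions are the same cone.
\<close>

lemma approach_regionE:
  assumes s: "s > 0" and x: "\<bar>x\<bar> \<noteq> s" and w: "w \<in> approach_region s \<alpha> (strip_curve s 0 x)"
  obtains a b where "w = strip_curve s 0 x + strip_dir s x * Complex a b" "b > 0" "\<bar>a\<bar> < \<alpha> * b"
proof -
  obtain z where z: "w = strip_curve s 0 x + z"
    "z \<in> (if strip_curve s 0 x \<in> bdry1 s 0 then {z. Re z > 0 \<and> \<bar>Im z\<bar> < \<alpha> * Re z}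
      else if strip_curve s 0 x \<in> bdry3 s 0 then {z. Re z < 0 \<and> \<bar>Im z\<bar> < - \<alpha> * Re z}
      else {z. Im z > 0 \<and> \<bar>Re z\<bar> < \<alpha> * Im z})"
    using w unfolding approach_region_def by auto
  consider "x < - s" | "\<bar>x\<bar> < s" | "x > s" using x by linarith
  then show ?thesis
  proof cases
    case 1
    then have "Re z > 0 \<and> \<bar>Im z\<bar> < \<alpha> * Re z" using z(2) s by (auto simp: strip_curve_left bdry1_def)
    then show ?thesis using 1 z(1) s by (intro that[of "- Im z" "Re z"]) (auto simp: strip_dir_def complex_eq_iff)
  next
    case 2
    then have "Im z > 0 \<and> \<bar>Re z\<bar> < \<alpha> * Im z" using z(2) s by (auto simp: strip_curve_bottom bdry1_def bdry3_def)
    then show ?thesis using 2 z(1) s by (intro that[of "Re z" "Im z"]) (auto simp: strip_dir_def complex_eq_iff)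
  next
    case 3
    then have "Re z < 0 \<and> \<bar>Im z\<bar> < - \<alpha> * Re z" using z(2) s by (auto simp: strip_curve_right bdry1_def bdry3_def)
    then show ?thesis using 3 z(1) s by (intro that[of "Im z" "- Re z"]) (auto simp: strip_dir_def complex_eq_iff)
  qed
qed

lemma normal_in_approach_region:
  assumes s: "s > 0" and x: "\<bar>x\<bar> \<noteq> s" and \<alpha>: "\<alpha> > 0" and b: "0 < b" "b < 2 * s"
  shows "strip_curve s 0 x + strip_dir s x * Complex 0 b \<in> approach_region s \<alpha> (strip_curve s 0 x) \<inter> half_strip s 0"
proof -
  consider "x < - s" | "\<bar>x\<bar> < s" | "x > s" using x by linarith
  then show ?thesis
  proof cases
    case 1
    then show ?thesis using s \<alpha> b
      by (auto simp: approach_region_def strip_curve_left bdry1_def strip_dir_def half_strip_def)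
  next
    case 2
    then show ?thesis using s \<alpha> b
      by (auto simp: approach_region_def strip_curve_bottom bdry1_def bdry3_def strip_dir_def half_strip_def)
  next
    case 3
    then show ?thesis using s \<alpha> b
      by (auto simp: approach_region_def strip_curve_right bdry1_def bdry3_def strip_dir_def half_strip_def)
  qed
qed

text \<open>
  Approach along the inward normal is non-tangential.  In particular, the filter of non-tangential
  approach is proper, so that non-tangential limits are unique.
\<close>

lemma filterlim_normal_approach:
  assumes s: "s > 0" and x: "\<bar>x\<bar> \<noteq> s" and \<alpha>: "\<alpha> > 0"
  shows "filterlim (\<lambda>b. strip_curve s 0 x + strip_dir s x * Complex 0 b)
    (at (strip_curve s 0 x) within approach_region s \<alpha> (strip_curve s 0 x) \<inter> half_strip s 0) (at_right 0)"
  unfolding filterlim_at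
proof
  have ev: "eventually (\<lambda>b. 0 < b \<and> b < 2 * s) (at_right 0)"
    using s by (auto simp: eventually_at_right_field)
  then show "eventually (\<lambda>b. strip_curve s 0 x + strip_dir s x * Complex 0 b \<in>
      approach_region s \<alpha> (strip_curve s 0 x) \<inter> half_strip s 0 \<and>
      strip_curve s 0 x + strip_dir s x * Complex 0 b \<noteq> strip_curve s 0 x) (at_right 0)"
  proof eventually_elim
    case (elim b)
    have "Complex 0 b \<noteq> 0" using elim by (simp add: complex_eq_iff)
    then show ?case using normal_in_approach_region[OF s x \<alpha>, of b] elim by simp
  qed
  have "((\<lambda>b. strip_curve s 0 x + strip_dir s x * (of_real b * \<i>)) \<longlongrightarrow> strip_curve s 0 x + strip_dir s x * (of_real 0 * \<i>)) (at_right 0)"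
    by (intro tendsto_intros)
  then show "((\<lambda>b. strip_curve s 0 x + strip_dir s x * Complex 0 b) \<longlongrightarrow> strip_curve s 0 x) (at_right 0)"
    by (simp add: Complex_eq mult.commute)
qed

lemma nt_limit_eqI:
  assumes s: "s > 0" and x: "\<bar>x\<bar> \<noteq> s" and L: "has_nt_limit s F (strip_curve s 0 x) L"
  shows "nt_limit s F (strip_curve s 0 x) = L"
    and "((\<lambda>b. F (strip_curve s 0 x + strip_dir s x * Complex 0 b)) \<longlongrightarrow> L) (at_right 0)"
proof -
  let ?\<zeta> = "strip_curve s 0 x"
  let ?A = "at ?\<zeta> within approach_region s 1 ?\<zeta> \<inter> half_strip s 0"
  have ne: "?A \<noteq> bot"
  proof
    assume "?A = bot"
    then have "filterlim (\<lambda>b. ?\<zeta> + strip_dir s x * Complex 0 b) bot (at_right (0::real))"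
      using filterlim_normal_approach[OF s x zero_less_one] by simp
    then have "\<forall>P. eventually P (bot :: complex filter) \<longrightarrow> eventually (\<lambda>b. P (?\<zeta> + strip_dir s x * Complex 0 b)) (at_right 0)"
      unfolding filterlim_iff .
    then have "eventually (\<lambda>b::real. False) (at_right 0)"
      by (elim allE[where x = "\<lambda>_. False"]) simp
    then show False using trivial_limit_at_right_real[of 0] by (simp add: eventually_False)
  qed
  have lim: "(F \<longlongrightarrow> L') ?A" if "has_nt_limit s F ?\<zeta> L'" for L'
    using that unfolding has_nt_limit_def by auto
  have "(THE L'. has_nt_limit s F ?\<zeta> L') = L"
    using L tendsto_unique[OF ne lim lim[OF L]] by (rule the_equality)
  then show "nt_limit s F ?\<zeta> = L" unfolding nt_limit_def using L by auto
  show "((\<lambda>b. F (?\<zeta> + strip_dir s x * Complex 0 b)) \<longlongrightarrow> L) (at_right 0)"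
    by (rule filterlim_compose[OF lim[OF L] filterlim_normal_approach[OF s x zero_less_one]])
qed

lemma Lp_integrable_one_plus_square:
  fixes g :: "real \<Rightarrow> complex"
  assumes p: "p > 1" and [measurable]: "g \<in> borel_measurable borel"
    and g: "integrable lborel (\<lambda>x. cmod (g x) powr p)"
  shows "integrable lborel (\<lambda>t. cmod (g t) / (1 + t\<^sup>2))"
proof (rule Bochner_Integration.integrable_bound[where f = "\<lambda>t. 1 / (1 + t\<^sup>2) + cmod (g t) powr p"])
  show "integrable lborel (\<lambda>t. 1 / (1 + t\<^sup>2) + cmod (g t) powr p)"
    by (intro Bochner_Integration.integrable_add integrable_inverse_one_plus_square g)
  show "AE t in lborel. norm (cmod (g t) / (1 + t\<^sup>2)) \<le> norm (1 / (1 + t\<^sup>2) + cmod (g t) powr p)"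
  proof (rule AE_I2)
    fix t :: real
    have "cmod (g t) \<le> 1 + cmod (g t) powr p"
      by (rule le_one_plus_powr) (use p in auto)
    then have "cmod (g t) / (1 + t\<^sup>2) \<le> (1 + cmod (g t) powr p) / (1 + t\<^sup>2)" by (intro divide_right_mono) auto
    also have "\<dots> = 1 / (1 + t\<^sup>2) + cmod (g t) powr p / (1 + t\<^sup>2)" by (rule add_divide_distrib)
    also have "cmod (g t) powr p / (1 + t\<^sup>2) \<le> cmod (g t) powr p / 1"
      by (intro divide_left_mono) (auto intro: add_pos_nonneg)
    finally show "norm (cmod (g t) / (1 + t\<^sup>2)) \<le> norm (1 / (1 + t\<^sup>2) + cmod (g t) powr p)" by simp
  qed
qed auto

text \<open>From here on, \<open>f\<close> is any function in \<open>L\<^sup>p\<close> that satisfies the Cauchy formula over the outer boundary.\<close>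

locale strip_boundary_function = strip_Hp +
  fixes f :: "real \<Rightarrow> complex"
  assumes f_borel [measurable]: "f \<in> borel_measurable borel"
    and f_Lp: "integrable lborel (\<lambda>x. cmod (f x) powr p)"
    and f_cauchy: "\<And>w. w \<notin> bdry \<sigma> 0 \<Longrightarrow> cauchy_part \<sigma> UNIV f w = cauchy_value w"
begin

lemma integrable_cauchy:
  assumes "w \<notin> bdry \<sigma> 0" and [measurable]: "A \<in> sets borel"
  shows "integrable lborel (\<lambda>x. f x * (indicator A x *\<^sub>R (strip_dir \<sigma> x / (strip_curve \<sigma> 0 x - w))))"
proof -
  obtain d where d: "d > 0" "\<And>x. cmod (strip_curve \<sigma> 0 x - w) \<ge> d" using bdry_dist_pos[OF \<sigma> assms(1)] by blast
  show ?thesis by (rule integrable_cauchy_part[OF p q \<sigma> _ _ f_Lp d]) auto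
qed

lemma integrable_restricted_f:
  assumes [measurable]: "A \<in> sets borel"
  shows "integrable lborel (\<lambda>t. cmod (indicator A t *\<^sub>R f t) / (1 + t\<^sup>2))"
proof (rule Lp_integrable_one_plus_square[OF p])
  show "integrable lborel (\<lambda>y. cmod (indicator A y *\<^sub>R f y) powr p)"
    by (rule Bochner_Integration.integrable_bound[OF f_Lp]) (use p in \<open>auto simp: indicator_def\<close>)
qed measurable

lemma half_strip_disjoint_bdry: "w \<in> half_strip \<sigma> 0 \<Longrightarrow> w \<notin> bdry \<sigma> 0"
  and outside_disjoint_bdry: "w \<notin> closure (half_strip \<sigma> 0) \<Longrightarrow> w \<notin> bdry \<sigma> 0"
  using half_strip_eq_complement by auto

text \<open>
  The reflected point lies outside the closed half-strip, where the Cauchy integral of \<open>f\<close> vanishes, so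
  its kernel may be subtracted.
\<close>

lemma F_eq_reflected_integral:
  fixes x a b :: real
  defines "e \<equiv> strip_dir \<sigma> x" and "z \<equiv> strip_curve \<sigma> 0 x"
  assumes b: "b > 0" and w: "z + e * Complex a b \<in> half_strip \<sigma> 0"
  shows "2 * pi * \<i> * F (z + e * Complex a b) = (LINT y|lborel. f y * (strip_dir \<sigma> y / (strip_curve \<sigma> 0 y - (z + e * Complex a b)) -
      strip_dir \<sigma> y / (strip_curve \<sigma> 0 y - (z + e * Complex a (- b)))))"
proof -
  let ?w = "z + e * Complex a b" and ?w' = "z + e * Complex a (- b)"
  have w': "?w' \<notin> closure (half_strip \<sigma> 0)" unfolding z_def e_def by (rule reflected_point_outside[OF \<sigma> b])
  then have "?w' \<notin> half_strip \<sigma> 0" using closure_subset by auto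
  then have "2 * pi * \<i> * F ?w = cauchy_value ?w - cauchy_value ?w'" using w by (simp add: cauchy_value_def)
  also have "\<dots> = cauchy_part \<sigma> UNIV f ?w - cauchy_part \<sigma> UNIV f ?w'"
    using f_cauchy half_strip_disjoint_bdry[OF w] outside_disjoint_bdry[OF w'] by simp
  also have "\<dots> = (LINT y|lborel. f y * (strip_dir \<sigma> y / (strip_curve \<sigma> 0 y - ?w)) - f y * (strip_dir \<sigma> y / (strip_curve \<sigma> 0 y - ?w')))"
    unfolding cauchy_part_def
    using integrable_cauchy[OF half_strip_disjoint_bdry[OF w], of UNIV] integrable_cauchy[OF outside_disjoint_bdry[OF w'], of UNIV]
    by (simp add: Bochner_Integration.integral_diff)
  finally show ?thesis by (simp only: right_diff_distrib)
qed

lemma F_eq_poisson_plus_remainder: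
  fixes x a b :: real
  defines "e \<equiv> strip_dir \<sigma> x" and "z \<equiv> strip_curve \<sigma> 0 x" and "A \<equiv> strip_side \<sigma> x"
  assumes b: "b > 0" and w: "z + e * Complex a b \<in> half_strip \<sigma> 0"
  shows "2 * pi * \<i> * F (z + e * Complex a b) =
    2 * pi * \<i> * (LINT y|lborel. of_real (poisson b (y - (x + a))) * (indicator A y *\<^sub>R f y)) +
    (cauchy_part \<sigma> (- A) f (z + e * Complex a b) - cauchy_part \<sigma> (- A) f (z + e * Complex a (- b)))"
proof -
  let ?w = "z + e * Complex a b" and ?w' = "z + e * Complex a (- b)"
  have w': "?w' \<notin> closure (half_strip \<sigma> 0)" unfolding z_def e_def by (rule reflected_point_outside[OF \<sigma> b])
  have [measurable]: "A \<in> sets borel" by (simp add: A_def)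
  let ?k = "\<lambda>w y. strip_dir \<sigma> y / (strip_curve \<sigma> 0 y - w)"
  have i1: "integrable lborel (\<lambda>y. of_real (poisson b (y - (x + a))) * (indicator A y *\<^sub>R f y))"
    by (rule integrable_poisson_mult[OF _ integrable_restricted_f b]) auto
  have i2: "integrable lborel (\<lambda>y. f y * (indicator (- A) y *\<^sub>R ?k ?w y))"
    using half_strip_disjoint_bdry[OF w] by (intro integrable_cauchy) auto
  have i3: "integrable lborel (\<lambda>y. f y * (indicator (- A) y *\<^sub>R ?k ?w' y))"
    using outside_disjoint_bdry[OF w'] by (intro integrable_cauchy) auto
  have "2 * pi * \<i> * F ?w = (LINT y|lborel. f y * (?k ?w y - ?k ?w' y))"
    using F_eq_reflected_integral[OF b] w unfolding e_def z_def by blast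
  also have "\<dots> = (LINT y|lborel. 2 * pi * \<i> * (of_real (poisson b (y - (x + a))) * (indicator A y *\<^sub>R f y)) +
     (f y * (indicator (- A) y *\<^sub>R ?k ?w y) - f y * (indicator (- A) y *\<^sub>R ?k ?w' y)))"
  proof (rule Bochner_Integration.integral_cong[OF refl])
    fix y
    show "f y * (?k ?w y - ?k ?w' y) = 2 * pi * \<i> * (of_real (poisson b (y - (x + a))) * (indicator A y *\<^sub>R f y)) +
     (f y * (indicator (- A) y *\<^sub>R ?k ?w y) - f y * (indicator (- A) y *\<^sub>R ?k ?w' y))"
    proof (cases "y \<in> A")
      case True
      then have "?k ?w y - ?k ?w' y = 2 * pi * \<i> * of_real (poisson b (y - (x + a)))"
        unfolding e_def z_def A_def by (rule reflected_cauchy_kernel[OF \<sigma> b])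
      then show ?thesis using True by simp
    qed (simp add: right_diff_distrib)
  qed
  also have "\<dots> = 2 * pi * \<i> * (LINT y|lborel. of_real (poisson b (y - (x + a))) * (indicator A y *\<^sub>R f y)) +
    (cauchy_part \<sigma> (- A) f ?w - cauchy_part \<sigma> (- A) f ?w')"
    unfolding cauchy_part_def
    by (simp only: Bochner_Integration.integral_add[OF integrable_mult_right[OF i1] Bochner_Integration.integrable_diff[OF i2 i3]]
      integral_mult_right_zero Bochner_Integration.integral_diff[OF i2 i3])
  finally show ?thesis .
qed

text \<open>
  The Poisson term converges by Fatou's theorem, applied to the restrictions of \<open>f\<close> to the three sides.
  The other two sides keep a positive distance from a boundary point that is not a corner, so their Cauchy
  integral is continuous there and takes nearly equal values at \<open>w\<close> and at its reflection.
\<close>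

theorem AE_has_nt_limit: "AE x in lborel. \<bar>x\<bar> \<noteq> \<sigma> \<and> has_nt_limit \<sigma> F (strip_curve \<sigma> 0 x) (f x)"
proof -
  define P where "P A x \<longleftrightarrow> (\<forall>\<alpha>>0. \<forall>\<epsilon>>0. \<exists>\<delta>>0. \<forall>a b. 0 < b \<and> b < \<delta> \<and> \<bar>a\<bar> \<le> \<alpha> * b \<longrightarrow>
    cmod ((LINT t|lborel. of_real (poisson b (t - (x + a))) * (indicator A t *\<^sub>R f t)) - indicator A x *\<^sub>R f x) \<le> \<epsilon>)" for A x
  have "AE x in lborel. P A x" if [measurable]: "A \<in> sets borel" for A
    unfolding P_def by (rule poisson_nontangential[OF _ integrable_restricted_f]) auto
  then have "AE x in lborel. P {..<- \<sigma>} x" "AE x in lborel. P {- \<sigma>..\<sigma>} x" "AE x in lborel. P {\<sigma><..} x"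
    by simp_all
  then show ?thesis
    using AE_lborel_singleton[of \<sigma>] AE_lborel_singleton[of "- \<sigma>"]
  proof eventually_elim
    case (elim x)
    define e where "e = strip_dir \<sigma> x"
    define z where "z = strip_curve \<sigma> 0 x"
    define A where "A = strip_side \<sigma> x"
    have x: "\<bar>x\<bar> \<noteq> \<sigma>" using elim(4,5) by auto
    have PA: "P A x" using elim(1-3) by (simp add: A_def strip_side_def)
    have xA: "x \<in> A" unfolding A_def by (rule self_in_strip_side)
    have cont: "isCont (cauchy_part \<sigma> (- A) f) z"
    proof (rule isCont_cauchy_part[OF p q \<sigma> _ _ f_Lp])
      show "min \<bar>\<bar>x\<bar> - \<sigma>\<bar> (2 * \<sigma>) > 0" using x \<sigma> by auto
      show "min \<bar>\<bar>x\<bar> - \<sigma>\<bar> (2 * \<sigma>) \<le> cmod (strip_curve \<sigma> 0 y - z)" if "y \<in> - A" for y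
        using that off_side_distance[OF \<sigma>, of y x 0] by (simp add: A_def z_def)
    qed (auto simp: A_def)
    have "has_nt_limit \<sigma> F z (f x)"
      unfolding has_nt_limit_def
    proof (intro conjI allI impI)
      have "z \<in> bdry \<sigma> 0" unfolding z_def using \<sigma> by (rule strip_curve_in_bdry)
      moreover have "z \<noteq> of_real \<sigma>" "z \<noteq> - of_real \<sigma>"
        using x \<sigma> by (auto simp: z_def strip_curve_def complex_eq_iff)
      ultimately show "z \<in> bdry \<sigma> 0 - {- complex_of_real \<sigma>, complex_of_real \<sigma>}" by blast
      fix \<alpha> :: real assume \<alpha>: "\<alpha> > 0"
      show "(F \<longlongrightarrow> f x) (at z within approach_region \<sigma> \<alpha> z \<inter> half_strip \<sigma> 0)"
      proof (rule tendstoI)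
        fix \<epsilon> :: real assume \<epsilon>: "\<epsilon> > 0"
        define \<epsilon>' where "\<epsilon>' = \<epsilon> / 4"
        have \<epsilon>': "\<epsilon>' > 0" using \<epsilon> by (simp add: \<epsilon>'_def)
        obtain \<delta> where \<delta>: "\<delta> > 0" "\<And>a b. 0 < b \<Longrightarrow> b < \<delta> \<Longrightarrow> \<bar>a\<bar> \<le> \<alpha> * b \<Longrightarrow>
            cmod ((LINT t|lborel. of_real (poisson b (t - (x + a))) * (indicator A t *\<^sub>R f t)) - f x) \<le> \<epsilon>'"
          using PA[unfolded P_def, rule_format, OF \<alpha> \<epsilon>'] xA by auto
        obtain \<eta> where \<eta>: "\<eta> > 0" "\<And>w. dist w z < \<eta> \<Longrightarrow> dist (cauchy_part \<sigma> (- A) f w) (cauchy_part \<sigma> (- A) f z) < \<epsilon>'"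
          using cont[unfolded continuous_at_eps_delta] \<epsilon>' by blast
        have "dist (F w) (f x) < \<epsilon>" if w: "w \<in> approach_region \<sigma> \<alpha> z" "w \<in> half_strip \<sigma> 0" "dist w z < min \<delta> \<eta>" for w
        proof -
          obtain a b where ab: "w = z + e * Complex a b" "b > 0" "\<bar>a\<bar> < \<alpha> * b"
            using approach_regionE[OF \<sigma> x w(1)[unfolded z_def]] unfolding z_def e_def by blast
          define w' where "w' = z + e * Complex a (- b)"
          have dw: "dist w z = cmod (Complex a b)" "dist w' z = cmod (Complex a b)"
            by (simp_all add: ab(1) w'_def dist_norm norm_mult e_def) (simp add: cmod_def)
          have "b \<le> cmod (Complex a b)" using abs_Im_le_cmod[of "Complex a b"] by simp
          then have b\<delta>: "b < \<delta>" using w(3) dw(1) by simp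
          let ?I = "LINT t|lborel. of_real (poisson b (t - (x + a))) * (indicator A t *\<^sub>R f t)"
          let ?C = "cauchy_part \<sigma> (- A) f"
          have "2 * pi * \<i> * F w = 2 * pi * \<i> * ?I + (?C w - ?C w')"
            unfolding ab(1) w'_def e_def z_def A_def
            by (rule F_eq_poisson_plus_remainder) (use ab(1,2) w(2) in \<open>simp_all add: e_def z_def\<close>)
          then have eq: "2 * pi * \<i> * (F w - f x) = 2 * pi * \<i> * (?I - f x) + ((?C w - ?C z) - (?C w' - ?C z))"
            by (simp add: algebra_simps)
          have "cmod (2 * pi * \<i> * (F w - f x)) \<le> cmod (2 * pi * \<i> * (?I - f x)) + (cmod (?C w - ?C z) + cmod (?C w' - ?C z))"
            unfolding eq by (rule order_trans[OF norm_triangle_ineq add_left_mono[OF norm_triangle_ineq4]])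
          then have "2 * pi * cmod (F w - f x) \<le> 2 * pi * cmod (?I - f x) + (cmod (?C w - ?C z) + cmod (?C w' - ?C z))"
            by (simp add: norm_mult)
          also have "\<dots> \<le> 2 * pi * \<epsilon>' + (\<epsilon>' + \<epsilon>')"
            using \<delta>(2)[OF ab(2) b\<delta>, of a] ab(3) \<eta>(2)[of w] \<eta>(2)[of w'] w(3) dw
            by (intro add_mono mult_left_mono) (auto simp: dist_norm)
          also have "\<dots> \<le> 2 * pi * \<epsilon>' + 2 * pi * \<epsilon>'"
            using \<epsilon>' pi_ge_two by (intro add_left_mono) (simp add: mult_le_cancel_right)
          also have "\<dots> = 2 * pi * (2 * \<epsilon>')" by simp
          finally have "cmod (F w - f x) \<le> 2 * \<epsilon>'" by simp
          then show ?thesis using \<epsilon> by (simp add: dist_norm \<epsilon>'_def)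
        qed
        then show "eventually (\<lambda>w. dist (F w) (f x) < \<epsilon>) (at z within approach_region \<sigma> \<alpha> z \<inter> half_strip \<sigma> 0)"
          using \<delta>(1) \<eta>(1) unfolding eventually_at by (intro exI[of _ "min \<delta> \<eta>"]) auto
      qed
    qed
    then show ?case using x by (simp add: z_def)
  qed
qed

end

section \<open>Convergence in \<open>L\<^sup>p\<close>\<close>

text \<open>
  Dominated convergence with a majorant that varies with \<open>n\<close>, provided that the integrals of the
  majorants converge too.  Split \<open>u\<^sub>n \<le> min u\<^sub>n G' + (G\<^sub>n - G') + max 0 (G' - G\<^sub>n)\<close>; the outer terms are
  dominated by \<open>G'\<close> itself.
\<close>

lemma generalized_dominated_convergence_null:
  fixes u G :: "nat \<Rightarrow> 'a \<Rightarrow> real" and G' :: "'a \<Rightarrow> real"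
  assumes mu[measurable]: "\<And>n. u n \<in> borel_measurable M"
    and G: "\<And>n. integrable M (G n)" "integrable M G'"
    and u: "\<And>n x. 0 \<le> u n x" "\<And>n x. u n x \<le> G n x" and G'0: "\<And>x. 0 \<le> G' x"
    and lim: "AE x in M. (\<lambda>n. u n x) \<longlonglongrightarrow> 0" "AE x in M. (\<lambda>n. G n x) \<longlonglongrightarrow> G' x"
    and limint: "(\<lambda>n. LINT x|M. G n x) \<longlonglongrightarrow> (LINT x|M. G' x)"
  shows "(\<lambda>n. LINT x|M. u n x) \<longlonglongrightarrow> 0"
proof -
  have [measurable]: "\<And>n. G n \<in> borel_measurable M" "G' \<in> borel_measurable M" using G by auto
  have G0: "0 \<le> G n x" for n x using u order_trans by blast
  have ui: "integrable M (u n)" for n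
    by (rule Bochner_Integration.integrable_bound[OF G(1)[of n]]) (use u G0 in auto)
  have mi: "integrable M (\<lambda>x. min (u n x) (G' x))" "integrable M (\<lambda>x. max 0 (G' x - G n x))" for n
    using ui G by (auto intro!: integrable_min integrable_max)
  have 1: "(\<lambda>n. LINT x|M. min (u n x) (G' x)) \<longlonglongrightarrow> (LINT x|M. 0)"
  proof (rule integral_dominated_convergence[where w = G'])
    show "AE x in M. (\<lambda>n. min (u n x) (G' x)) \<longlonglongrightarrow> 0"
      using lim(1)
    proof eventually_elim
      case (elim x)
      have "(\<lambda>n. min (u n x) (G' x)) \<longlonglongrightarrow> min 0 (G' x)" by (intro tendsto_min elim tendsto_const)
      then show ?case using G'0[of x] by simp
    qed
  qed (use u G G'0 in \<open>auto simp: min_def\<close>)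
  have 2: "(\<lambda>n. LINT x|M. max 0 (G' x - G n x)) \<longlonglongrightarrow> (LINT x|M. 0)"
  proof (rule integral_dominated_convergence[where w = G'])
    show "AE x in M. (\<lambda>n. max 0 (G' x - G n x)) \<longlonglongrightarrow> 0"
      using lim(2)
    proof eventually_elim
      case (elim x)
      have "(\<lambda>n. max 0 (G' x - G n x)) \<longlonglongrightarrow> max 0 (G' x - G' x)" by (intro tendsto_max tendsto_diff elim tendsto_const)
      then show ?case by simp
    qed
  qed (use G0 G G'0 in \<open>auto simp: max_def\<close>)
  have le: "(LINT x|M. u n x) \<le> (LINT x|M. min (u n x) (G' x)) + ((LINT x|M. G n x) - (LINT x|M. G' x)) + (LINT x|M. max 0 (G' x - G n x))" for n
  proof -
    have "(LINT x|M. u n x) \<le> (LINT x|M. min (u n x) (G' x) + (G n x - G' x) + max 0 (G' x - G n x))"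
    proof (rule integral_mono)
      show "u n x \<le> min (u n x) (G' x) + (G n x - G' x) + max 0 (G' x - G n x)" for x
        using u(2)[of n x] by (auto simp: min_def max_def)
    qed (use ui mi G in auto)
    also have "\<dots> = (LINT x|M. min (u n x) (G' x)) + ((LINT x|M. G n x) - (LINT x|M. G' x)) + (LINT x|M. max 0 (G' x - G n x))"
      using mi G by simp
    finally show ?thesis .
  qed
  have "(\<lambda>n. (LINT x|M. min (u n x) (G' x)) + ((LINT x|M. G n x) - (LINT x|M. G' x)) + (LINT x|M. max 0 (G' x - G n x))) \<longlonglongrightarrow>
     (LINT x|M. 0) + ((LINT x|M. G' x) - (LINT x|M. G' x)) + (LINT x|M. 0)"
    by (intro tendsto_add tendsto_diff 1 2 limint tendsto_const)
  then have lim0: "(\<lambda>n. (LINT x|M. min (u n x) (G' x)) + ((LINT x|M. G n x) - (LINT x|M. G' x)) + (LINT x|M. max 0 (G' x - G n x))) \<longlonglongrightarrow> 0"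
    by simp
  show ?thesis
    by (rule tendsto_sandwich[OF _ _ tendsto_const lim0]) (use le u in \<open>auto intro!: always_eventually\<close>)
qed

definition poisson_mean :: "real \<Rightarrow> (real \<Rightarrow> real) \<Rightarrow> real \<Rightarrow> real" where
  "poisson_mean b \<phi> x = (LINT y|lborel. poisson b (y - x) * \<phi> y)"

lemma integrable_poisson_mult_real:
  assumes [measurable]: "\<phi> \<in> borel_measurable borel"
    and int: "integrable lborel (\<lambda>t. \<bar>\<phi> t\<bar> / (1 + t\<^sup>2))" and b: "b > 0"
  shows "integrable lborel (\<lambda>y. poisson b (y - x) * \<phi> y)"
proof -
  have "integrable lborel (\<lambda>y. of_real (poisson b (y - x)) * (of_real (\<phi> y) :: complex))"
    by (rule integrable_poisson_mult[OF _ _ b]) (use int in auto)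
  then have "integrable lborel (\<lambda>y. Re (of_real (poisson b (y - x)) * (of_real (\<phi> y) :: complex)))" by (rule integrable_Re)
  then show ?thesis by simp
qed

lemma poisson_mean_nonneg: "b > 0 \<Longrightarrow> (\<And>y. \<phi> y \<ge> 0) \<Longrightarrow> poisson_mean b \<phi> x \<ge> 0"
  unfolding poisson_mean_def by (intro Bochner_Integration.integral_nonneg mult_nonneg_nonneg poisson_nonneg) auto

lemma integrable_one_plus_square_bound:
  assumes [measurable]: "\<phi> \<in> borel_measurable borel" and \<phi>: "integrable lborel \<phi>"
  shows "integrable lborel (\<lambda>t. \<bar>\<phi> t\<bar> / (1 + t\<^sup>2 :: real))"
proof (rule Bochner_Integration.integrable_bound[OF \<phi>])
  show "AE t in lborel. norm (\<bar>\<phi> t\<bar> / (1 + t\<^sup>2)) \<le> norm (\<phi> t)"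
  proof (rule AE_I2)
    fix t
    have "\<bar>\<phi> t\<bar> / (1 + t\<^sup>2) \<le> \<bar>\<phi> t\<bar> / 1" by (intro divide_left_mono) (auto intro: add_pos_nonneg)
    then show "norm (\<bar>\<phi> t\<bar> / (1 + t\<^sup>2)) \<le> norm (\<phi> t)" by simp
  qed
qed auto

lemma
  assumes [measurable]: "\<phi> \<in> borel_measurable borel" and \<phi>: "integrable lborel \<phi>" "\<And>y. \<phi> y \<ge> 0" and b: "b > 0"
  shows integrable_poisson_mean: "integrable lborel (poisson_mean b \<phi>)" (is ?A)
    and integral_poisson_mean: "(LINT x|lborel. poisson_mean b \<phi> x) = (LINT x|lborel. \<phi> x)" (is ?B)
proof -
  have i: "integrable lborel (\<lambda>y. poisson b (y - x) * \<phi> y)" for x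
    by (rule integrable_poisson_mult_real[OF _ integrable_one_plus_square_bound b]) (use \<phi> in auto)
  have [measurable]: "poisson_mean b \<phi> \<in> borel_measurable borel"
    unfolding poisson_mean_def[abs_def] using lborel.borel_measurable_lebesgue_integral[of "\<lambda>x y. poisson b (y - x) * \<phi> y" borel] by simp
  have even: "poisson b (y - x) = poisson b (x - y)" for x y by (simp add: poisson_def power2_commute)
  \<comment> \<open>Fubini; the kernel is symmetric and has integral \<open>1\<close> in either variable.\<close>
  have "(\<integral>\<^sup>+x. ennreal (poisson_mean b \<phi> x) \<partial>lborel) = (\<integral>\<^sup>+x. \<integral>\<^sup>+y. ennreal (poisson b (y - x) * \<phi> y) \<partial>lborel \<partial>lborel)"
    unfolding poisson_mean_def using b \<phi>(2)
    by (intro nn_integral_cong nn_integral_eq_integral[symmetric] i AE_I2 mult_nonneg_nonneg poisson_nonneg) auto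
  also have "\<dots> = (\<integral>\<^sup>+y. \<integral>\<^sup>+x. ennreal (poisson b (y - x) * \<phi> y) \<partial>lborel \<partial>lborel)"
    by (rule lborel_pair.Fubini') simp
  also have "\<dots> = (\<integral>\<^sup>+y. ennreal (\<phi> y) \<partial>lborel)"
  proof (rule nn_integral_cong)
    fix y
    have "(\<integral>\<^sup>+x. ennreal (poisson b (y - x) * \<phi> y) \<partial>lborel) = (\<integral>\<^sup>+x. ennreal (\<phi> y) * ennreal (poisson b (x - y)) \<partial>lborel)"
      unfolding even[of y] using b \<phi>(2) by (intro nn_integral_cong) (simp add: ennreal_mult poisson_nonneg mult.commute)
    also have "\<dots> = ennreal (\<phi> y) * (\<integral>\<^sup>+x. ennreal (poisson b (x - y)) \<partial>lborel)" by (rule nn_integral_cmult) measurable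
    finally show "(\<integral>\<^sup>+x. ennreal (poisson b (y - x) * \<phi> y) \<partial>lborel) = ennreal (\<phi> y)" using b by (simp add: nn_integral_poisson)
  qed
  also have "\<dots> = ennreal (LINT x|lborel. \<phi> x)" using \<phi> by (intro nn_integral_eq_integral) auto
  finally have eq: "(\<integral>\<^sup>+x. ennreal (poisson_mean b \<phi> x) \<partial>lborel) = ennreal (LINT x|lborel. \<phi> x)" .
  have pos: "poisson_mean b \<phi> x \<ge> 0" for x using b \<phi>(2) by (rule poisson_mean_nonneg)
  show ?A by (rule integrableI_nonneg) (use eq pos in auto)
  show ?B using eq nn_integral_eq_integral[OF \<open>?A\<close>] pos \<phi>(2) by simp
qed

text \<open>
  Jensen's inequality for the probability density \<open>poisson b (y - x)\<close>: integrate the tangent at the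
  mean.
\<close>

lemma poisson_mean_powr_le:
  assumes p: "p > 1" and b: "b > 0" and [measurable]: "\<phi> \<in> borel_measurable borel" and \<phi>0: "\<And>y. \<phi> y \<ge> 0"
    and \<phi>: "integrable lborel (\<lambda>t. \<phi> t / (1 + t\<^sup>2))" and \<phi>p: "integrable lborel (\<lambda>t. \<phi> t powr p)"
  shows "poisson_mean b \<phi> x powr p \<le> poisson_mean b (\<lambda>y. \<phi> y powr p) x"
proof -
  define m where "m = poisson_mean b \<phi> x"
  have m: "m \<ge> 0" unfolding m_def using b \<phi>0 by (rule poisson_mean_nonneg)
  let ?P = "\<lambda>y. poisson b (y - x)"
  have i1: "integrable lborel (\<lambda>y. ?P y * \<phi> y)"
    by (rule integrable_poisson_mult_real[OF _ _ b]) (use \<phi> \<phi>0 in auto)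
  have i2: "integrable lborel (\<lambda>y. ?P y * \<phi> y powr p)"
    by (rule integrable_poisson_mult_real[OF _ integrable_one_plus_square_bound[OF _ \<phi>p] b]) auto
  have i0: "integrable lborel ?P" by (rule integrable_poisson[OF b])
  define C where "C = p * m powr (p - 1)"
  have le: "?P y * (m powr p - C * m) + C * (?P y * \<phi> y) \<le> ?P y * \<phi> y powr p" for y
  proof -
    have "m powr p + C * (\<phi> y - m) \<le> \<phi> y powr p"
      unfolding C_def using powr_tangent[OF p \<phi>0 m] by simp
    then have "?P y * (m powr p + C * (\<phi> y - m)) \<le> ?P y * \<phi> y powr p"
      using b by (intro mult_left_mono poisson_nonneg)
    then show ?thesis by (simp add: algebra_simps)
  qed
  have "m powr p = (LINT y|lborel. ?P y) * (m powr p - C * m) + C * (LINT y|lborel. ?P y * \<phi> y)"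
    using b by (simp add: integral_poisson m_def poisson_mean_def)
  also have "\<dots> = (LINT y|lborel. ?P y * (m powr p - C * m) + C * (?P y * \<phi> y))"
    using i0 i1 by simp
  also have "\<dots> \<le> (LINT y|lborel. ?P y * \<phi> y powr p)"
    using i0 i1 i2 le by (intro integral_mono) auto
  finally show ?thesis by (simp add: m_def poisson_mean_def)
qed

text \<open>
  The geometry at a corner: two points at distances \<open>a\<close> and \<open>b\<close> from it lie on the two adjacent sides,
  and the first is moved by \<open>h\<close> along the normal of its side.  If \<open>|h| \<le> a\<close>, their distance is
  still at least a fixed multiple of the distance \<open>a + b\<close> along the boundary.
\<close>

lemma corner_distance:
  fixes a b h :: real
  assumes "\<bar>h\<bar> \<le> a"
  shows "(a + b)\<^sup>2 + h\<^sup>2 \<le> 24 * ((b - h)\<^sup>2 + a\<^sup>2)"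
proof -
  have 1: "h\<^sup>2 \<le> a\<^sup>2" using assms by (metis abs_ge_zero power2_abs power_mono)
  have 2: "(a + b)\<^sup>2 \<le> 2 * a\<^sup>2 + 2 * b\<^sup>2" using zero_le_power2[of "a - b"] by (simp add: power2_eq_square algebra_simps)
  have 3: "b\<^sup>2 \<le> 2 * (b - h)\<^sup>2 + 2 * h\<^sup>2" using zero_le_power2[of "b - 2 * h"] by (simp add: power2_eq_square algebra_simps)
  show ?thesis using 1 2 3 zero_le_power2[of "b - h"] zero_le_power2[of a] unfolding distrib_left by linarith
qed

text \<open>
  For points on the same or on adjacent sides, the distance to the shifted point is at least a
  fixed multiple of \<open>sqrt ((y - x)\<^sup>2 + h\<^sup>2)\<close>, by the geometry at the corners.  On opposite vertical sides it is the sum \<open>y + x\<close> that measures the difference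
  in height, and the horizontal distance is at least \<open>\<sigma>\<close>.
\<close>

lemma normal_distance_bound:
  fixes \<sigma> t x y h :: real
  assumes \<sigma>: "\<sigma> > 0" and t: "0 < t" "t < \<sigma>" and x: "\<bar>x\<bar> \<le> \<sigma> - t \<or> \<bar>x\<bar> > \<sigma> + t" and h: "\<bar>h\<bar> = t"
  defines "D \<equiv> (cmod (strip_curve \<sigma> 0 y - (strip_curve \<sigma> 0 x + strip_dir \<sigma> x * Complex 0 h)))\<^sup>2"
  shows "if x < - \<sigma> \<and> y > \<sigma> \<or> x > \<sigma> \<and> y < - \<sigma> then \<sigma>\<^sup>2 + (y + x)\<^sup>2 \<le> D else (y - x)\<^sup>2 + h\<^sup>2 \<le> 24 * D"
proof -
  have same: "(y - x)\<^sup>2 + h\<^sup>2 \<le> 24 * ((y - x)\<^sup>2 + h\<^sup>2)" by (simp add: algebra_simps)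
  have opp: "\<sigma>\<^sup>2 \<le> (2 * \<sigma> - h)\<^sup>2" "\<sigma>\<^sup>2 \<le> (2 * \<sigma> + h)\<^sup>2" using t h by (intro power_mono; auto)+
  have D: "D = (Re (strip_curve \<sigma> 0 y - (strip_curve \<sigma> 0 x + strip_dir \<sigma> x * Complex 0 h)))\<^sup>2 +
     (Im (strip_curve \<sigma> 0 y - (strip_curve \<sigma> 0 x + strip_dir \<sigma> x * Complex 0 h)))\<^sup>2"
    unfolding D_def by (rule cmod_power2)
  have sq: "(u - v)\<^sup>2 = (v - u)\<^sup>2" for u v :: real by (rule power2_commute)
  consider (L) "x < - \<sigma> - t" | (M) "\<bar>x\<bar> \<le> \<sigma> - t" | (R) "x > \<sigma> + t" using x by linarith
  then show ?thesis
  proof cases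
    case L
    then have xl: "x < - \<sigma>" using t by simp
    consider "y < - \<sigma>" | "\<bar>y\<bar> \<le> \<sigma>" | "y > \<sigma>" by linarith
    then show ?thesis
    proof cases
      case 1
      then have "D = (y - x)\<^sup>2 + h\<^sup>2" unfolding D using \<sigma> xl by (simp add: strip_curve_left strip_dir_def power2_commute)
      then show ?thesis using 1 xl \<sigma> same by auto
    next
      case 2
      then have "D = ((y + \<sigma>) - h)\<^sup>2 + (- x - \<sigma>)\<^sup>2"
        unfolding D using \<sigma> xl by (simp add: strip_curve_left strip_curve_bottom strip_dir_def power2_commute algebra_simps)
      moreover have "\<bar>h\<bar> \<le> - x - \<sigma>" using L h by simp
      ultimately show ?thesis using corner_distance[of h "- x - \<sigma>" "y + \<sigma>"] 2 xl \<sigma> by (auto simp: algebra_simps)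
    next
      case 3
      then have "D = (2 * \<sigma> - h)\<^sup>2 + (y + x)\<^sup>2"
        unfolding D using \<sigma> xl by (simp add: strip_curve_left strip_curve_right strip_dir_def algebra_simps)
      then show ?thesis using 3 xl opp by simp
    qed
  next
    case M
    then have xm: "\<bar>x\<bar> \<le> \<sigma>" using t by simp
    then have dir: "strip_dir \<sigma> x = 1" by (auto simp: strip_dir_def)
    consider "y < - \<sigma>" | "\<bar>y\<bar> \<le> \<sigma>" | "y > \<sigma>" by linarith
    then show ?thesis
    proof cases
      case 1
      then have "D = ((- y - \<sigma>) - h)\<^sup>2 + (x + \<sigma>)\<^sup>2"
        unfolding D using \<sigma> xm by (simp add: strip_curve_left strip_curve_bottom dir power2_eq_square algebra_simps)
      moreover have "\<bar>h\<bar> \<le> x + \<sigma>" using M h by linarith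
      ultimately show ?thesis using corner_distance[of h "x + \<sigma>" "- y - \<sigma>"] 1 xm \<sigma> by (auto simp: sq[of y x])
    next
      case 2
      then have "D = (y - x)\<^sup>2 + h\<^sup>2" unfolding D using \<sigma> xm by (simp add: strip_curve_bottom dir)
      then show ?thesis using 2 xm \<sigma> same by auto
    next
      case 3
      then have "D = ((y - \<sigma>) - h)\<^sup>2 + (\<sigma> - x)\<^sup>2"
        unfolding D using \<sigma> xm by (simp add: strip_curve_right strip_curve_bottom dir power2_eq_square algebra_simps)
      moreover have "\<bar>h\<bar> \<le> \<sigma> - x" using M h by linarith
      ultimately show ?thesis using corner_distance[of h "\<sigma> - x" "y - \<sigma>"] 3 xm \<sigma> by auto
    qed
  next
    case R
    then have xr: "x > \<sigma>" using t by simp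
    consider "y < - \<sigma>" | "\<bar>y\<bar> \<le> \<sigma>" | "y > \<sigma>" by linarith
    then show ?thesis
    proof cases
      case 1
      then have "D = (2 * \<sigma> - h)\<^sup>2 + (y + x)\<^sup>2"
        unfolding D using \<sigma> xr by (simp add: strip_curve_left strip_curve_right strip_dir_def power2_eq_square algebra_simps)
      then show ?thesis using 1 xr opp by simp
    next
      case 2
      then have "D = ((\<sigma> - y) - h)\<^sup>2 + (x - \<sigma>)\<^sup>2"
        unfolding D using \<sigma> xr by (simp add: strip_curve_right strip_curve_bottom strip_dir_def power2_eq_square algebra_simps)
      moreover have "\<bar>h\<bar> \<le> x - \<sigma>" using R h by linarith
      ultimately show ?thesis using corner_distance[of h "x - \<sigma>" "\<sigma> - y"] 2 xr \<sigma> by (auto simp: sq[of y x])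
    next
      case 3
      then have "D = (y - x)\<^sup>2 + h\<^sup>2" unfolding D using \<sigma> xr by (simp add: strip_curve_right strip_dir_def)
      then show ?thesis using 3 xr \<sigma> same by auto
    qed
  qed
qed

text \<open>
  The two kernels differ by \<open>2 t\<close> divided by the product of the distances to \<open>w\<close> and to \<open>w'\<close>.  Same and
  adjacent sides are covered by the first Poisson kernel, the opposite side by the second one.
\<close>

lemma reflected_kernel_bound:
  assumes \<sigma>: "\<sigma> > 0" and t: "0 < t" "t < \<sigma>" and x: "\<bar>x\<bar> \<le> \<sigma> - t \<or> \<bar>x\<bar> > \<sigma> + t"
  defines "w \<equiv> strip_curve \<sigma> 0 x + strip_dir \<sigma> x * Complex 0 t" and "w' \<equiv> strip_curve \<sigma> 0 x + strip_dir \<sigma> x * Complex 0 (- t)"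
  shows "cmod (strip_dir \<sigma> y / (strip_curve \<sigma> 0 y - w) - strip_dir \<sigma> y / (strip_curve \<sigma> 0 y - w'))
    \<le> 2 * pi * (24 * poisson t (y - x) + t / \<sigma> * poisson \<sigma> (y - (- x)))"
proof -
  let ?c = "strip_curve \<sigma> 0 y"
  have bound: "cmod (strip_dir \<sigma> y / (?c - w) - strip_dir \<sigma> y / (?c - w')) \<le> 2 * t / m"
    if m: "m > 0" "m \<le> (cmod (?c - w))\<^sup>2" "m \<le> (cmod (?c - w'))\<^sup>2" for m
  proof -
    have nz: "?c - w \<noteq> 0" "?c - w' \<noteq> 0" using m by auto
    have "strip_dir \<sigma> y / (?c - w) - strip_dir \<sigma> y / (?c - w') = (strip_dir \<sigma> y * (?c - w') - strip_dir \<sigma> y * (?c - w)) / ((?c - w) * (?c - w'))"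
      using nz by (rule diff_frac_eq)
    also have "strip_dir \<sigma> y * (?c - w') - strip_dir \<sigma> y * (?c - w) = strip_dir \<sigma> y * (strip_dir \<sigma> x * Complex 0 (2 * t))"
      unfolding w_def w'_def by (simp add: complex_eq_iff algebra_simps)
    finally have eq: "strip_dir \<sigma> y / (?c - w) - strip_dir \<sigma> y / (?c - w') = strip_dir \<sigma> y * (strip_dir \<sigma> x * Complex 0 (2 * t)) / ((?c - w) * (?c - w'))" .
    have "cmod (Complex 0 (2 * t)) = 2 * t" using t by (simp add: Complex_eq norm_mult)
    then have "cmod (strip_dir \<sigma> y / (?c - w) - strip_dir \<sigma> y / (?c - w')) = 2 * t / (cmod (?c - w) * cmod (?c - w'))"
      unfolding eq by (simp add: norm_divide norm_mult)
    also have "\<dots> \<le> 2 * t / m"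
    proof (intro divide_left_mono)
      have "m\<^sup>2 \<le> (cmod (?c - w))\<^sup>2 * (cmod (?c - w'))\<^sup>2" unfolding power2_eq_square[of m] using m by (intro mult_mono) auto
      then have "m\<^sup>2 \<le> (cmod (?c - w) * cmod (?c - w'))\<^sup>2" by (simp add: power_mult_distrib)
      then show "m \<le> cmod (?c - w) * cmod (?c - w')" by (rule power2_le_imp_le) simp
    qed (use m t nz in auto)
    finally show ?thesis .
  qed
  note d = normal_distance_bound[OF \<sigma> t x, of t y] normal_distance_bound[OF \<sigma> t x, of "- t" y]
  have P0: "poisson t (y - x) \<ge> 0" "poisson \<sigma> (y - (- x)) \<ge> 0" using t \<sigma> by (auto intro: poisson_nonneg simp del: diff_minus_eq_add)
  show ?thesis
  proof (cases "x < - \<sigma> \<and> y > \<sigma> \<or> x > \<sigma> \<and> y < - \<sigma>")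
    case True
    have "cmod (strip_dir \<sigma> y / (?c - w) - strip_dir \<sigma> y / (?c - w')) \<le> 2 * t / (\<sigma>\<^sup>2 + (y + x)\<^sup>2)"
      using True d t \<sigma> by (intro bound) (auto simp: w_def w'_def intro: add_pos_nonneg)
    also have "\<dots> = 2 * pi * (t / \<sigma> * poisson \<sigma> (y - (- x)))" using \<sigma> by (simp add: poisson_def)
    also have "\<dots> \<le> 2 * pi * (24 * poisson t (y - x) + t / \<sigma> * poisson \<sigma> (y - (- x)))"
      using P0 by (intro mult_left_mono) auto
    finally show ?thesis .
  next
    case False
    have "cmod (strip_dir \<sigma> y / (?c - w) - strip_dir \<sigma> y / (?c - w')) \<le> 2 * t / (((y - x)\<^sup>2 + t\<^sup>2) / 24)"
      using False d t \<sigma> by (intro bound) (auto simp: w_def w'_def intro: add_nonneg_pos)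
    also have "\<dots> = 2 * pi * (24 * poisson t (y - x))" by (simp add: poisson_def add.commute)
    also have "\<dots> \<le> 2 * pi * (24 * poisson t (y - x) + t / \<sigma> * poisson \<sigma> (y - (- x)))"
      using P0 t \<sigma> by (intro mult_left_mono) auto
    finally show ?thesis .
  qed
qed

text \<open>
  The first form exhibits the shift along the inward normal; the function is \<open>0\<close> for parameters within
  \<open>t\<close> of a corner.  The second form shows that it is Borel, although \<open>F\<close> is arbitrary outside the half-strip.
\<close>

lemma transport_strip_curve:
  assumes \<sigma>: "\<sigma> > 0" and t: "0 < t" "t < \<sigma>"
  shows "transport \<sigma> (\<sigma> - t) t F (strip_curve \<sigma> 0 x) =
      (if \<bar>x\<bar> \<le> \<sigma> - t \<or> \<bar>x\<bar> > \<sigma> + t then F (strip_curve \<sigma> 0 x + strip_dir \<sigma> x * Complex 0 t) else 0)" (is ?A)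
    and "transport \<sigma> (\<sigma> - t) t F (strip_curve \<sigma> 0 x) =
      (if \<bar>x\<bar> \<le> \<sigma> - t then F (strip_curve (\<sigma> - t) t x) else if x > \<sigma> + t then F (strip_curve (\<sigma> - t) t (x - 2 * t))
       else if x < - \<sigma> - t then F (strip_curve (\<sigma> - t) t (x + 2 * t)) else 0)" (is ?B)
proof -
  consider (L) "x < - \<sigma> - t" | (gap1) "- \<sigma> - t \<le> x" "x < - \<sigma> + t" | (M) "\<bar>x\<bar> \<le> \<sigma> - t" | (gap2) "\<sigma> - t < x" "x \<le> \<sigma> + t" | (R) "x > \<sigma> + t"
    by linarith
  then have "?A \<and> ?B"
  proof cases
    case L
    have c: "strip_curve \<sigma> 0 x = Complex (- \<sigma>) (- \<sigma> - x)" using L \<sigma> t by (simp add: strip_curve_left)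
    have c': "strip_curve (\<sigma> - t) t (x + 2 * t) = Complex (- \<sigma> + t) (- \<sigma> - x)" using L \<sigma> t by (simp add: strip_curve_left)
    have d: "strip_curve \<sigma> 0 x + strip_dir \<sigma> x * Complex 0 t = Complex (- \<sigma> + t) (- \<sigma> - x)"
      unfolding c using L \<sigma> t by (auto simp: strip_dir_def complex_eq_iff)
    have "shift \<sigma> (\<sigma> - t) t (strip_curve \<sigma> 0 x) = Complex (- \<sigma> + t) (- \<sigma> - x)"
      unfolding c shift_def using L \<sigma> t by (auto simp: lines1_def lines2_def complex_eq_iff)
    moreover have "strip_curve \<sigma> 0 x \<in> lines1 \<sigma> t \<union> lines2 (\<sigma> - t) \<union> lines3 \<sigma> t"
      unfolding c using L \<sigma> t by (auto simp: lines1_def lines2_def lines3_def)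
    ultimately have "transport \<sigma> (\<sigma> - t) t F (strip_curve \<sigma> 0 x) = F (Complex (- \<sigma> + t) (- \<sigma> - x))" by (simp add: transport_def)
    then show ?thesis using L \<sigma> t unfolding d by (auto simp: c')
  next
    case gap1
    have "strip_curve \<sigma> 0 x = Complex (- \<sigma>) (- \<sigma> - x) \<or> strip_curve \<sigma> 0 x = Complex x 0"
      using gap1 \<sigma> t by (cases "x \<le> - \<sigma>") (auto simp: strip_curve_left strip_curve_bottom)
    then show ?thesis using gap1 \<sigma> t
      by (auto simp: transport_def lines1_def lines2_def lines3_def)
  next
    case M
    have c: "strip_curve \<sigma> 0 x = Complex x 0" using M \<sigma> t by (simp add: strip_curve_bottom)
    have c': "strip_curve (\<sigma> - t) t (x) = Complex x t" using M \<sigma> t by (simp add: strip_curve_bottom)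
    have d: "strip_curve \<sigma> 0 x + strip_dir \<sigma> x * Complex 0 t = Complex x t"
      unfolding c using M \<sigma> t by (auto simp: strip_dir_def complex_eq_iff)
    have "shift \<sigma> (\<sigma> - t) t (strip_curve \<sigma> 0 x) = Complex x t"
      unfolding c shift_def using M \<sigma> t by (auto simp: lines1_def lines2_def complex_eq_iff)
    moreover have "strip_curve \<sigma> 0 x \<in> lines1 \<sigma> t \<union> lines2 (\<sigma> - t) \<union> lines3 \<sigma> t"
      unfolding c using M \<sigma> t by (auto simp: lines1_def lines2_def lines3_def)
    ultimately have "transport \<sigma> (\<sigma> - t) t F (strip_curve \<sigma> 0 x) = F (Complex x t)" by (simp add: transport_def)
    then show ?thesis using M \<sigma> t unfolding d by (auto simp: c')
  next
    case gap2
    have "strip_curve \<sigma> 0 x = Complex \<sigma> (x - \<sigma>) \<or> strip_curve \<sigma> 0 x = Complex x 0"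
      using gap2 \<sigma> t by (cases "x \<ge> \<sigma>") (auto simp: strip_curve_right strip_curve_bottom)
    then show ?thesis using gap2 \<sigma> t
      by (auto simp: transport_def lines1_def lines2_def lines3_def)
  next
    case R
    have c: "strip_curve \<sigma> 0 x = Complex \<sigma> (x - \<sigma>)" using R \<sigma> t by (simp add: strip_curve_right)
    have c': "strip_curve (\<sigma> - t) t (x - 2 * t) = Complex (\<sigma> - t) (x - \<sigma>)" using R \<sigma> t by (simp add: strip_curve_right)
    have d: "strip_curve \<sigma> 0 x + strip_dir \<sigma> x * Complex 0 t = Complex (\<sigma> - t) (x - \<sigma>)"
      unfolding c using R \<sigma> t by (auto simp: strip_dir_def complex_eq_iff)
    have "shift \<sigma> (\<sigma> - t) t (strip_curve \<sigma> 0 x) = Complex (\<sigma> - t) (x - \<sigma>)"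
      unfolding c shift_def using R \<sigma> t by (auto simp: lines1_def lines2_def complex_eq_iff)
    moreover have "strip_curve \<sigma> 0 x \<in> lines1 \<sigma> t \<union> lines2 (\<sigma> - t) \<union> lines3 \<sigma> t"
      unfolding c using R \<sigma> t by (auto simp: lines1_def lines2_def lines3_def)
    ultimately have "transport \<sigma> (\<sigma> - t) t F (strip_curve \<sigma> 0 x) = F (Complex (\<sigma> - t) (x - \<sigma>))" by (simp add: transport_def)
    then show ?thesis using R \<sigma> t unfolding d by (auto simp: c')
  qed
  then show ?A ?B by auto
qed

context strip_boundary_function
begin

text \<open>
  The transported function \<open>F\<^bsub>\<sigma>-t,t\<^esub>\<close> in the arc-length parameter.
\<close>

definition shifted :: "real \<Rightarrow> real \<Rightarrow> complex" where
  "shifted t x = transport \<sigma> (\<sigma> - t) t F (strip_curve \<sigma> 0 x)"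

lemma measurable_shifted:
  assumes t: "0 < t" "t < \<sigma>"
  shows "shifted t \<in> borel_measurable borel"
proof -
  have [measurable]: "(\<lambda>x. F (strip_curve (\<sigma> - t) t x)) \<in> borel_measurable borel"
    using t by (intro measurable_F_curve) auto
  have [measurable]: "(\<lambda>x. F (strip_curve (\<sigma> - t) t (x + c))) \<in> borel_measurable borel"
    "(\<lambda>x. F (strip_curve (\<sigma> - t) t (x - c))) \<in> borel_measurable borel" for c
    by measurable
  have "shifted t = (\<lambda>x. if \<bar>x\<bar> \<le> \<sigma> - t then F (strip_curve (\<sigma> - t) t x) else if x > \<sigma> + t then F (strip_curve (\<sigma> - t) t (x - 2 * t))
       else if x < - \<sigma> - t then F (strip_curve (\<sigma> - t) t (x + 2 * t)) else 0)"
    unfolding shifted_def transport_strip_curve(2)[OF \<sigma> t] by simp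
  then show ?thesis by simp
qed

definition \<phi> :: "real \<Rightarrow> real" where "\<phi> x = cmod (f x)"

lemma \<phi>: "\<phi> \<in> borel_measurable borel" "\<phi> x \<ge> 0" "integrable lborel (\<lambda>x. \<phi> x powr p)" "integrable lborel (\<lambda>t. \<phi> t / (1 + t\<^sup>2))"
  using f_Lp Lp_integrable_one_plus_square[OF p f_borel f_Lp] by (simp_all add: \<phi>_def[abs_def])

text \<open>
  Integrate the bound for the difference of the kernels against \<open>|f|\<close>; within \<open>t\<close> of a corner the
  transported function is \<open>0\<close>.
\<close>

lemma cmod_shifted_le:
  assumes t: "0 < t" "t < \<sigma>"
  shows "cmod (shifted t x) \<le> 24 * poisson_mean t \<phi> x + t / \<sigma> * poisson_mean \<sigma> \<phi> (- x)"
proof (cases "\<bar>x\<bar> \<le> \<sigma> - t \<or> \<bar>x\<bar> > \<sigma> + t")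
  case False
  then have "shifted t x = 0" unfolding shifted_def transport_strip_curve(1)[OF \<sigma> t] by simp
  moreover have "0 \<le> 24 * poisson_mean t \<phi> x + t / \<sigma> * poisson_mean \<sigma> \<phi> (- x)"
    using t \<sigma> \<phi>(2) by (intro add_nonneg_nonneg mult_nonneg_nonneg poisson_mean_nonneg) auto
  ultimately show ?thesis by simp
next
  case True
  note [measurable] = \<phi>(1)
  let ?w = "strip_curve \<sigma> 0 x + strip_dir \<sigma> x * Complex 0 t" and ?w' = "strip_curve \<sigma> 0 x + strip_dir \<sigma> x * Complex 0 (- t)"
  let ?k = "\<lambda>y. strip_dir \<sigma> y / (strip_curve \<sigma> 0 y - ?w) - strip_dir \<sigma> y / (strip_curve \<sigma> 0 y - ?w')"
  have "\<bar>x\<bar> \<noteq> \<sigma>" using True t by auto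
  then have w: "?w \<in> half_strip \<sigma> 0" using normal_in_approach_region[OF \<sigma> _ zero_less_one, of x t] t by auto
  have w': "?w' \<notin> closure (half_strip \<sigma> 0)" by (rule reflected_point_outside[OF \<sigma> t(1)])
  have i1: "integrable lborel (\<lambda>y. poisson t (y - x) * \<phi> y)"
    by (rule integrable_poisson_mult_real[OF _ _ t(1)]) (use \<phi> in auto)
  have i2: "integrable lborel (\<lambda>y. poisson \<sigma> (y - (- x)) * \<phi> y)"
    by (rule integrable_poisson_mult_real[OF _ _ \<sigma>]) (use \<phi> in auto)
  have ik: "integrable lborel (\<lambda>y. f y * ?k y)"
    using Bochner_Integration.integrable_diff[OF integrable_cauchy[OF half_strip_disjoint_bdry[OF w], of UNIV] integrable_cauchy[OF outside_disjoint_bdry[OF w'], of UNIV]]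
    by (simp add: right_diff_distrib)
  have "2 * pi * cmod (F ?w) = cmod (2 * pi * \<i> * F ?w)" by (simp add: norm_mult)
  also have "\<dots> = cmod (LINT y|lborel. f y * ?k y)" using F_eq_reflected_integral[OF t(1) w] by simp
  also have "\<dots> \<le> (LINT y|lborel. cmod (f y * ?k y))" by (rule integral_norm_bound)
  also have "\<dots> \<le> (LINT y|lborel. 2 * pi * (24 * (poisson t (y - x) * \<phi> y) + t / \<sigma> * (poisson \<sigma> (y - (- x)) * \<phi> y)))"
  proof (rule integral_mono)
    fix y
    have "cmod (f y * ?k y) = cmod (?k y) * \<phi> y" by (simp add: norm_mult \<phi>_def)
    also have "\<dots> \<le> (2 * pi * (24 * poisson t (y - x) + t / \<sigma> * poisson \<sigma> (y - (- x)))) * \<phi> y"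
      by (rule mult_right_mono[OF reflected_kernel_bound[OF \<sigma> t True] \<phi>(2)])
    finally show "cmod (f y * ?k y) \<le> 2 * pi * (24 * (poisson t (y - x) * \<phi> y) + t / \<sigma> * (poisson \<sigma> (y - (- x)) * \<phi> y))"
      by (simp add: algebra_simps)
  qed (intro integrable_norm ik integrable_mult_right Bochner_Integration.integrable_add i1 i2)+
  also have "\<dots> = 2 * pi * (24 * poisson_mean t \<phi> x + t / \<sigma> * poisson_mean \<sigma> \<phi> (- x))"
    unfolding poisson_mean_def
    by (simp only: integral_mult_right_zero Bochner_Integration.integral_add[OF integrable_mult_right[OF i1] integrable_mult_right[OF i2]])
  finally have "cmod (F ?w) \<le> 24 * poisson_mean t \<phi> x + t / \<sigma> * poisson_mean \<sigma> \<phi> (- x)" by simp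
  then show ?thesis using True unfolding shifted_def transport_strip_curve(1)[OF \<sigma> t] by simp
qed

text \<open>
  The majorant of \<open>|F\<^bsub>\<sigma>-t,t\<^esub> - f|\<^sup>p\<close> that results from Jensen's inequality.
\<close>

definition majorant :: "real \<Rightarrow> real \<Rightarrow> real" where
  "majorant t x = 2 powr p * (2 powr p * (24 powr p * poisson_mean t (\<lambda>y. \<phi> y powr p) x +
     (t / \<sigma>) powr p * poisson_mean \<sigma> (\<lambda>y. \<phi> y powr p) (- x)) + \<phi> x powr p)"

lemma cmod_shifted_diff_le:
  assumes t: "0 < t" "t < \<sigma>"
  shows "cmod (shifted t x - f x) powr p \<le> majorant t x"
proof -
  note [measurable] = \<phi>(1)
  have m0: "poisson_mean t \<phi> x \<ge> 0" "poisson_mean \<sigma> \<phi> (- x) \<ge> 0"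
    using t \<sigma> \<phi>(2) by (auto intro: poisson_mean_nonneg)
  have "cmod (shifted t x) powr p \<le> (24 * poisson_mean t \<phi> x + t / \<sigma> * poisson_mean \<sigma> \<phi> (- x)) powr p"
    using cmod_shifted_le[OF t] p by (intro powr_mono2) auto
  also have "\<dots> \<le> 2 powr p * ((24 * poisson_mean t \<phi> x) powr p + (t / \<sigma> * poisson_mean \<sigma> \<phi> (- x)) powr p)"
    using p m0 t \<sigma> by (intro powr_add_le) auto
  also have "\<dots> = 2 powr p * (24 powr p * poisson_mean t \<phi> x powr p + (t / \<sigma>) powr p * poisson_mean \<sigma> \<phi> (- x) powr p)"
    using m0 t \<sigma> by (simp only: powr_mult)
  also have "\<dots> \<le> 2 powr p * (24 powr p * poisson_mean t (\<lambda>y. \<phi> y powr p) x + (t / \<sigma>) powr p * poisson_mean \<sigma> (\<lambda>y. \<phi> y powr p) (- x))"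
    using t \<sigma> p \<phi> by (intro mult_left_mono add_mono poisson_mean_powr_le) auto
  finally have 1: "cmod (shifted t x) powr p \<le> \<dots>" .
  have "cmod (shifted t x - f x) powr p \<le> (cmod (shifted t x) + cmod (f x)) powr p"
    using p by (intro powr_mono2 norm_triangle_ineq4) auto
  also have "\<dots> \<le> 2 powr p * (cmod (shifted t x) powr p + cmod (f x) powr p)"
    using p by (intro powr_add_le) auto
  also have "\<dots> \<le> majorant t x"
    unfolding majorant_def \<phi>_def[of x] using 1 by (intro mult_left_mono add_mono) auto
  finally show ?thesis .
qed

lemma
  assumes t: "0 < t" "t < \<sigma>"
  shows integrable_majorant: "integrable lborel (majorant t)" (is ?A)
    and integral_majorant: "(LINT x|lborel. majorant t x) =
      2 powr p * (2 powr p * (24 powr p * (LINT x|lborel. \<phi> x powr p) + (t / \<sigma>) powr p * (LINT x|lborel. \<phi> x powr p)) + (LINT x|lborel. \<phi> x powr p))" (is ?B)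
proof -
  note [measurable] = \<phi>(1)
  let ?\<Phi> = "\<lambda>y. \<phi> y powr p"
  have m: "integrable lborel (poisson_mean b ?\<Phi>)" "(LINT x|lborel. poisson_mean b ?\<Phi> x) = (LINT x|lborel. ?\<Phi> x)" if "b > 0" for b
    using that \<phi>(3) by (intro integrable_poisson_mean integral_poisson_mean; simp)+
  have r: "integrable lborel (\<lambda>x. poisson_mean \<sigma> ?\<Phi> (- x))"
    using lborel_integrable_real_affine[OF m(1)[OF \<sigma>], of "-1" 0] by simp
  have r': "(LINT x|lborel. poisson_mean \<sigma> ?\<Phi> (- x)) = (LINT x|lborel. ?\<Phi> x)"
    using lborel_integral_real_affine[of "-1" "poisson_mean \<sigma> ?\<Phi>" 0] m(2)[OF \<sigma>] by simp
  show ?A unfolding majorant_def[abs_def]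
    by (intro integrable_mult_right Bochner_Integration.integrable_add m r t \<phi>)
  show ?B unfolding majorant_def
    by (simp only: integral_mult_right_zero r' m(2)[OF t(1)]
      Bochner_Integration.integral_add[OF integrable_mult_right[OF m(1)[OF t(1)]] integrable_mult_right[OF r]]
      Bochner_Integration.integral_add[OF integrable_mult_right[OF Bochner_Integration.integrable_add[OF integrable_mult_right[OF m(1)[OF t(1)]] integrable_mult_right[OF r]]] \<phi>(3)])
qed


lemma AE_poisson_mean_tendsto:
  "AE x in lborel. ((\<lambda>t. poisson_mean t (\<lambda>y. \<phi> y powr p) x) \<longlongrightarrow> \<phi> x powr p) (at_right 0)"
proof -
  note [measurable] = \<phi>(1)
  let ?g = "\<lambda>y. complex_of_real (\<phi> y powr p)"
  have int: "integrable lborel (\<lambda>t. cmod (?g t) / (1 + t\<^sup>2))"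
    using integrable_one_plus_square_bound[OF _ \<phi>(3)] by simp
  have "AE x in lborel. \<forall>\<alpha>>0. \<forall>\<epsilon>>0. \<exists>\<delta>>0. \<forall>a b. 0 < b \<and> b < \<delta> \<and> \<bar>a\<bar> \<le> \<alpha> * b \<longrightarrow>
    cmod ((LINT t|lborel. of_real (poisson b (t - (x + a))) * ?g t) - ?g x) \<le> \<epsilon>"
    by (rule poisson_nontangential[OF _ int]) simp
  then show ?thesis
  proof eventually_elim
    case (elim x)
    have eq: "(LINT y|lborel. of_real (poisson b (y - (x + 0))) * ?g y) = of_real (poisson_mean b (\<lambda>y. \<phi> y powr p) x)" for b
      unfolding poisson_mean_def by (simp flip: of_real_mult)
    show ?case
    proof (rule tendstoI)
      fix e :: real assume e: "e > 0"
      obtain \<delta> where \<delta>: "\<delta> > 0" "\<And>a b. 0 < b \<and> b < \<delta> \<and> \<bar>a\<bar> \<le> 1 * b \<Longrightarrow>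
        cmod ((LINT t|lborel. of_real (poisson b (t - (x + a))) * ?g t) - ?g x) \<le> e / 2"
        using elim[rule_format, of 1 "e / 2"] e by auto
      have "dist (poisson_mean b (\<lambda>y. \<phi> y powr p) x) (\<phi> x powr p) < e" if b: "0 < b" "b < \<delta>" for b
      proof -
        have "cmod (of_real (poisson_mean b (\<lambda>y. \<phi> y powr p) x) - ?g x) \<le> e / 2"
          using \<delta>(2)[of b 0] b unfolding eq by simp
        then have "\<bar>poisson_mean b (\<lambda>y. \<phi> y powr p) x - \<phi> x powr p\<bar> \<le> e / 2"
          by (simp only: norm_of_real flip: of_real_diff)
        then show ?thesis using e by (simp add: dist_real_def)
      qed
      then show "eventually (\<lambda>b. dist (poisson_mean b (\<lambda>y. \<phi> y powr p) x) (\<phi> x powr p) < e) (at_right 0)"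
        using \<delta>(1) by (auto simp: eventually_at_right_field)
    qed
  qed
qed

lemma AE_shifted_tendsto: "AE x in lborel. ((\<lambda>t. shifted t x) \<longlongrightarrow> f x) (at_right 0)"
  using AE_has_nt_limit
proof eventually_elim
  case (elim x)
  have "((\<lambda>t. F (strip_curve \<sigma> 0 x + strip_dir \<sigma> x * Complex 0 t)) \<longlongrightarrow> f x) (at_right 0)"
    using nt_limit_eqI(2)[OF \<sigma>] elim by blast
  moreover have "eventually (\<lambda>t. F (strip_curve \<sigma> 0 x + strip_dir \<sigma> x * Complex 0 t) = shifted t x) (at_right 0)"
  proof -
    have "\<bar>\<bar>x\<bar> - \<sigma>\<bar> > 0" using elim by simp
    then have "eventually (\<lambda>t. 0 < t \<and> t < min \<sigma> \<bar>\<bar>x\<bar> - \<sigma>\<bar>) (at_right 0)"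
      using \<sigma> by (auto simp: eventually_at_right_field intro!: exI[of _ "min \<sigma> \<bar>\<bar>x\<bar> - \<sigma>\<bar>"])
    then show ?thesis
    proof eventually_elim
      case (elim t)
      then have "\<bar>x\<bar> \<le> \<sigma> - t \<or> \<bar>x\<bar> > \<sigma> + t" by linarith
      then show ?case using elim unfolding shifted_def by (subst transport_strip_curve(1)[OF \<sigma>]) auto
    qed
  qed
  ultimately show ?case by (rule Lim_transform_eventually)
qed

text \<open>
  As \<open>t \<rightarrow> 0\<close>, the majorants converge almost everywhere, and their integrals are explicit constants that
  converge to the integral of the limit, because Poisson means preserve integrals.
\<close>

theorem shifted_tendsto_Lp:
  "((\<lambda>t. LINT x|lborel. cmod (shifted t x - f x) powr p) \<longlongrightarrow> 0) (at_right 0)"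
proof (rule tendsto_at_right_sequentially[OF \<sigma>])
  fix S :: "nat \<Rightarrow> real" assume S: "\<And>n. 0 < S n" "\<And>n. S n < \<sigma>" "S \<longlonglongrightarrow> 0"
  note [measurable] = \<phi>(1) measurable_shifted[OF S(1,2)]
  have Sr: "filterlim S (at_right 0) sequentially"
  proof -
    have "S n \<in> {0<..} \<and> S n \<noteq> 0" for n using S(1)[of n] by simp
    then show ?thesis unfolding filterlim_at using S(3) by simp
  qed
  define G' where "G' x = 2 powr p * (2 powr p * (24 powr p * \<phi> x powr p) + \<phi> x powr p)" for x
  have S0: "(\<lambda>n. (S n / \<sigma>) powr p) \<longlonglongrightarrow> 0"
  proof -
    have "(\<lambda>n. S n / \<sigma>) \<longlonglongrightarrow> 0 / \<sigma>" using S(3) \<sigma> by (intro tendsto_divide tendsto_const) auto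
    then have lim: "(\<lambda>n. S n / \<sigma>) \<longlonglongrightarrow> 0" by simp
    have "(\<lambda>n. (S n / \<sigma>) powr p) \<longlonglongrightarrow> 0 powr p"
      by (rule tendsto_powr2[OF lim tendsto_const]) (use S(1) \<sigma> p in \<open>auto simp: less_imp_le\<close>)
    then show ?thesis by simp
  qed
  show "(\<lambda>n. LINT x|lborel. cmod (shifted (S n) x - f x) powr p) \<longlonglongrightarrow> 0"
  proof (rule generalized_dominated_convergence_null[where G = "\<lambda>n. majorant (S n)" and G' = G'])
    show "integrable lborel (majorant (S n))" for n by (rule integrable_majorant[OF S(1,2)])
    show "integrable lborel G'"
      unfolding G'_def by (intro integrable_mult_right Bochner_Integration.integrable_add \<phi>)
    show "cmod (shifted (S n) x - f x) powr p \<le> majorant (S n) x" for n x by (rule cmod_shifted_diff_le[OF S(1,2)])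
    show "0 \<le> G' x" for x by (simp add: G'_def)
    show "AE x in lborel. (\<lambda>n. cmod (shifted (S n) x - f x) powr p) \<longlonglongrightarrow> 0"
      using AE_shifted_tendsto
    proof eventually_elim
      case (elim x)
      have "(\<lambda>n. shifted (S n) x) \<longlonglongrightarrow> f x" by (rule filterlim_compose[OF elim Sr])
      then have "(\<lambda>n. cmod (shifted (S n) x - f x)) \<longlonglongrightarrow> 0" using tendsto_norm_zero LIM_zero by blast
      then have "(\<lambda>n. cmod (shifted (S n) x - f x) powr p) \<longlonglongrightarrow> 0 powr p" using p by (intro tendsto_powr2 tendsto_const) auto
      then show ?case by simp
    qed
    show "AE x in lborel. (\<lambda>n. majorant (S n) x) \<longlonglongrightarrow> G' x"
      using AE_poisson_mean_tendsto
    proof eventually_elim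
      case (elim x)
      have "(\<lambda>n. poisson_mean (S n) (\<lambda>y. \<phi> y powr p) x) \<longlonglongrightarrow> \<phi> x powr p" by (rule filterlim_compose[OF elim Sr])
      then have "(\<lambda>n. majorant (S n) x) \<longlonglongrightarrow>
        2 powr p * (2 powr p * (24 powr p * \<phi> x powr p + 0 * poisson_mean \<sigma> (\<lambda>y. \<phi> y powr p) (- x)) + \<phi> x powr p)"
        unfolding majorant_def by (intro tendsto_mult tendsto_add tendsto_const S0)
      then show ?case by (simp add: G'_def)
    qed
    let ?I = "LINT x|lborel. \<phi> x powr p"
    have "(\<lambda>n. LINT x|lborel. majorant (S n) x) \<longlonglongrightarrow> 2 powr p * (2 powr p * (24 powr p * ?I + 0 * ?I) + ?I)"
      unfolding integral_majorant[OF S(1,2)] by (intro tendsto_mult tendsto_add tendsto_const S0)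
    moreover have "(LINT x|lborel. G' x) = 2 powr p * (2 powr p * (24 powr p * ?I) + ?I)"
      unfolding G'_def using \<phi>(3) by simp
    ultimately show "(\<lambda>n. LINT x|lborel. majorant (S n) x) \<longlonglongrightarrow> (LINT x|lborel. G' x)" by simp
  qed auto
qed

end

section \<open>Hardy functions on the half-strip\<close>

lemma Lp_norm_arc_length:
  fixes k :: "complex \<Rightarrow> complex"
  assumes s: "s > 0" and [measurable]: "u \<in> borel_measurable borel"
    and k: "AE x in lborel. k (strip_curve s t x) = u x" and u: "integrable lborel (\<lambda>x. cmod (u x) powr p)"
  shows "Lp_norm (arc_length s t) p k = ennreal ((LINT x|lborel. cmod (u x) powr p) powr (1 / p))"
proof -
  have "(\<integral>\<^sup>+\<zeta>. ennreal (cmod (k \<zeta>) powr p) \<partial>arc_length s t) = (\<integral>\<^sup>+x. ennreal (cmod (u x) powr p) \<partial>lborel)"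
    by (rule nn_integral_arc_length_AE[OF s]) (use k in auto)
  also have "\<dots> = ennreal (LINT x|lborel. cmod (u x) powr p)" by (rule nn_integral_eq_integral[OF u]) simp
  finally show ?thesis by (simp add: Lp_norm_def)
qed

lemma Lp_norm_three_lines:
  assumes p: "p > 0" and k: "\<And>\<zeta>. \<zeta> \<notin> bdry s t \<Longrightarrow> k \<zeta> = 0"
  shows "Lp_norm (three_lines s t) p k = Lp_norm (arc_length s t) p k"
proof -
  have "(\<integral>\<^sup>+\<zeta>. ennreal (cmod (k \<zeta>) powr p) \<partial>three_lines s t) = (\<integral>\<^sup>+\<zeta>. ennreal (cmod (k \<zeta>) powr p) \<partial>arc_length s t)"
    unfolding nn_integral_arc_length_eq_three_lines using p k by (intro nn_integral_cong) (auto simp: indicator_def)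
  then show ?thesis by (simp add: Lp_norm_def)
qed

lemma Lp_norm_cong: "(\<And>\<zeta>. \<zeta> \<in> space M \<Longrightarrow> k \<zeta> = l \<zeta>) \<Longrightarrow> Lp_norm M p k = Lp_norm M p l"
  unfolding Lp_norm_def by (simp cong: nn_integral_cong)

lemma transport_outside_bdry:
  assumes "0 < t" "t < \<sigma>" "\<zeta> \<notin> bdry \<sigma> 0"
  shows "transport \<sigma> (\<sigma> - t) t F \<zeta> = 0"
  using assms by (auto simp: transport_def lines1_def lines2_def lines3_def bdry_def bdry1_def bdry2_def bdry3_def)

lemma Hp_space_strip_Hp:
  assumes \<sigma>: "\<sigma> > 0" and p: "p > 1" and F: "F \<in> Hp_space \<sigma> p"
  shows "strip_Hp \<sigma> p (enn2real (Hp_norm \<sigma> p F) powr p) F"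
proof
  show "\<sigma> > 0" "p > 1" by fact+
  show an: "F analytic_on half_strip \<sigma> 0" using F by (simp add: Hp_space_def)
  define m where "m = enn2real (Hp_norm \<sigma> p F)"
  have m: "m \<ge> 0" "Hp_norm \<sigma> p F = ennreal m" using F by (auto simp: Hp_space_def m_def less_top)
  fix s t :: real assume st: "0 < s" "s < \<sigma>" "0 < t"
  have le: "Lp_norm (arc_length s t) p F \<le> ennreal m"
    unfolding m(2)[symmetric] Hp_norm_def by (rule SUP_upper2[of "(s, t)"]) (use st in auto)
  have sub: "strip_curve s t x \<in> half_strip \<sigma> 0" for x
    using strip_curve_in_bdry[OF st(1), of t x] st by (auto simp: bdry_def bdry1_def bdry2_def bdry3_def half_strip_def)
  have [measurable]: "(\<lambda>x. F (strip_curve s t x)) \<in> borel_measurable borel"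
    by (rule borel_measurable_continuous_onI,
      rule continuous_on_compose2[OF holomorphic_on_imp_continuous_on[OF analytic_imp_holomorphic[OF an]] continuous_strip_curve])
      (use sub in auto)
  have nn: "(\<integral>\<^sup>+\<zeta>. ennreal (cmod (F \<zeta>) powr p) \<partial>arc_length s t) = (\<integral>\<^sup>+x. ennreal (cmod (F (strip_curve s t x)) powr p) \<partial>lborel)"
    by (rule nn_integral_arc_length_AE[OF st(1)]) auto
  have "(\<integral>\<^sup>+x. ennreal (cmod (F (strip_curve s t x)) powr p) \<partial>lborel) \<noteq> \<infinity>"
  proof
    assume "(\<integral>\<^sup>+x. ennreal (cmod (F (strip_curve s t x)) powr p) \<partial>lborel) = \<infinity>"
    then have "Lp_norm (arc_length s t) p F = \<infinity>" by (simp add: Lp_norm_def nn)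
    then show False using le by (simp add: top_unique)
  qed
  then show int: "integrable lborel (\<lambda>x. cmod (F (strip_curve s t x)) powr p)"
    by (intro integrableI_nonneg) (auto simp: less_top)
  let ?L = "LINT x|lborel. cmod (F (strip_curve s t x)) powr p"
  have "Lp_norm (arc_length s t) p F = ennreal (?L powr (1 / p))"
    by (rule Lp_norm_arc_length[OF st(1) _ _ int]) auto
  then have "?L powr (1 / p) \<le> m" using le m by simp
  then have "(?L powr (1 / p)) powr p \<le> m powr p" using p by (intro powr_mono2) auto
  moreover have "(?L powr (1 / p)) powr p = ?L" using p by (simp add: powr_powr)
  ultimately show "?L \<le> enn2real (Hp_norm \<sigma> p F) powr p" by (simp add: m_def)
qed

context strip_boundary_function
begin

lemma AE_nt_limit: "AE x in lborel. nt_limit \<sigma> F (strip_curve \<sigma> 0 x) = f x"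
  using AE_has_nt_limit by eventually_elim (use nt_limit_eqI(1)[OF \<sigma>] in blast)

lemma AE_arc_length_has_nt_limit: "AE \<zeta> in arc_length \<sigma> 0. \<exists>L. has_nt_limit \<sigma> F \<zeta> L"
proof (rule AE_arc_length[OF \<sigma>])
  show "AE x in lborel. \<exists>L. has_nt_limit \<sigma> F (strip_curve \<sigma> 0 x) L"
    using AE_has_nt_limit by eventually_elim blast
qed

lemma Lp_norm_nt_limit: "Lp_norm (arc_length \<sigma> 0) p (nt_limit \<sigma> F) = ennreal ((LINT x|lborel. cmod (f x) powr p) powr (1 / p))"
  by (rule Lp_norm_arc_length[OF \<sigma> f_borel AE_nt_limit f_Lp])

lemma nt_limit_in_Lp: "nt_limit \<sigma> F \<in> Lp_space (arc_length \<sigma> 0) p"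
  unfolding Lp_space_def using measurable_arc_length[OF \<sigma> f_borel AE_nt_limit] by (simp add: Lp_norm_nt_limit)

lemma
  assumes w: "w \<in> half_strip \<sigma> 0 \<union> - closure (half_strip \<sigma> 0)"
  shows bdry_integrable_cauchy: "bdry_integrable \<sigma> 0 (\<lambda>\<zeta>. nt_limit \<sigma> F \<zeta> / (\<zeta> - w))"
    and bdry_integral_cauchy: "1 / (2 * of_real pi * \<i>) * bdry_integral \<sigma> 0 (\<lambda>\<zeta>. nt_limit \<sigma> F \<zeta> / (\<zeta> - w)) =
         (if w \<in> half_strip \<sigma> 0 then F w else 0)"
proof -
  have wb: "w \<notin> bdry \<sigma> 0" using w half_strip_eq_complement by blast
  have AE: "AE x in lborel. nt_limit \<sigma> F (strip_curve \<sigma> 0 x) / (strip_curve \<sigma> 0 x - w) * tangent \<sigma> 0 (strip_curve \<sigma> 0 x) =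
      f x * (strip_dir \<sigma> x / (strip_curve \<sigma> 0 x - w))"
    using AE_nt_limit by eventually_elim (simp add: tangent_strip_curve \<sigma>)
  have m: "(\<lambda>x. f x * (strip_dir \<sigma> x / (strip_curve \<sigma> 0 x - w))) \<in> borel_measurable borel" by measurable
  show "bdry_integrable \<sigma> 0 (\<lambda>\<zeta>. nt_limit \<sigma> F \<zeta> / (\<zeta> - w))"
    unfolding bdry_integrable_def integrable_arc_length[OF \<sigma> m AE] using integrable_cauchy[OF wb, of UNIV] by simp
  have "bdry_integral \<sigma> 0 (\<lambda>\<zeta>. nt_limit \<sigma> F \<zeta> / (\<zeta> - w)) = cauchy_part \<sigma> UNIV f w"
    unfolding bdry_integral_def integral_arc_length[OF \<sigma> m AE] by (simp add: cauchy_part_def)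
  then show "1 / (2 * of_real pi * \<i>) * bdry_integral \<sigma> 0 (\<lambda>\<zeta>. nt_limit \<sigma> F \<zeta> / (\<zeta> - w)) =
         (if w \<in> half_strip \<sigma> 0 then F w else 0)"
    using f_cauchy[OF wb] by (simp add: cauchy_value_def)
qed

lemma transport_tendsto_Lp:
  "((\<lambda>t. Lp_norm (arc_length \<sigma> 0) p (\<lambda>\<zeta>. transport \<sigma> (\<sigma> - t) t F \<zeta> - nt_limit \<sigma> F \<zeta>)) \<longlongrightarrow> 0) (at_right 0)"
proof -
  have ev: "eventually (\<lambda>t. 0 < t \<and> t < \<sigma>) (at_right 0)" using \<sigma> by (auto simp: eventually_at_right_field)
  have "((\<lambda>t. (LINT x|lborel. cmod (shifted t x - f x) powr p) powr (1 / p)) \<longlongrightarrow> 0 powr (1 / p)) (at_right 0)"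
    by (rule tendsto_powr2[OF shifted_tendsto_Lp tendsto_const]) (use p in auto)
  then have "((\<lambda>t. ennreal ((LINT x|lborel. cmod (shifted t x - f x) powr p) powr (1 / p))) \<longlongrightarrow> ennreal 0) (at_right 0)"
    by (intro tendsto_ennrealI) simp
  moreover have "eventually (\<lambda>t. ennreal ((LINT x|lborel. cmod (shifted t x - f x) powr p) powr (1 / p)) =
     Lp_norm (arc_length \<sigma> 0) p (\<lambda>\<zeta>. transport \<sigma> (\<sigma> - t) t F \<zeta> - nt_limit \<sigma> F \<zeta>)) (at_right 0)"
    using ev
  proof eventually_elim
    case (elim t)
    then have t: "0 < t" "t < \<sigma>" by auto
    note [measurable] = measurable_shifted[OF t]
    have "integrable lborel (\<lambda>x. cmod (shifted t x - f x) powr p)"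
    proof (rule Bochner_Integration.integrable_bound[OF integrable_majorant[OF t]])
      show "AE x in lborel. norm (cmod (shifted t x - f x) powr p) \<le> norm (majorant t x)"
      proof (rule AE_I2)
        show "norm (cmod (shifted t x - f x) powr p) \<le> norm (majorant t x)" for x
          using order_trans[OF cmod_shifted_diff_le[OF t] abs_ge_self, of x] by simp
      qed
    qed measurable
    moreover have "AE x in lborel. transport \<sigma> (\<sigma> - t) t F (strip_curve \<sigma> 0 x) - nt_limit \<sigma> F (strip_curve \<sigma> 0 x) = shifted t x - f x"
      using AE_nt_limit by eventually_elim (simp add: shifted_def)
    ultimately show ?case by (intro Lp_norm_arc_length[OF \<sigma>, symmetric]) auto
  qed
  ultimately show ?thesis by (simp add: Lim_transform_eventually)
qed

lemma transport_tendsto_Lp_three_lines: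
  "((\<lambda>t. Lp_norm (three_lines \<sigma> 0) p (\<lambda>\<zeta>. transport \<sigma> (\<sigma> - t) t F \<zeta> - extend_by_zero \<sigma> (nt_limit \<sigma> F) \<zeta>)) \<longlongrightarrow> 0) (at_right 0)"
proof (rule Lim_transform_eventually[OF transport_tendsto_Lp])
  have "eventually (\<lambda>t. 0 < t \<and> t < \<sigma>) (at_right 0)" using \<sigma> by (auto simp: eventually_at_right_field)
  then show "eventually (\<lambda>t. Lp_norm (arc_length \<sigma> 0) p (\<lambda>\<zeta>. transport \<sigma> (\<sigma> - t) t F \<zeta> - nt_limit \<sigma> F \<zeta>) =
     Lp_norm (three_lines \<sigma> 0) p (\<lambda>\<zeta>. transport \<sigma> (\<sigma> - t) t F \<zeta> - extend_by_zero \<sigma> (nt_limit \<sigma> F) \<zeta>)) (at_right 0)"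
  proof eventually_elim
    case (elim t)
    have "Lp_norm (three_lines \<sigma> 0) p (\<lambda>\<zeta>. transport \<sigma> (\<sigma> - t) t F \<zeta> - extend_by_zero \<sigma> (nt_limit \<sigma> F) \<zeta>) =
      Lp_norm (arc_length \<sigma> 0) p (\<lambda>\<zeta>. transport \<sigma> (\<sigma> - t) t F \<zeta> - extend_by_zero \<sigma> (nt_limit \<sigma> F) \<zeta>)"
      using p elim by (intro Lp_norm_three_lines) (auto simp: transport_outside_bdry extend_by_zero_def)
    also have "\<dots> = Lp_norm (arc_length \<sigma> 0) p (\<lambda>\<zeta>. transport \<sigma> (\<sigma> - t) t F \<zeta> - nt_limit \<sigma> F \<zeta>)"
      by (rule Lp_norm_cong) (simp add: extend_by_zero_def)
    finally show ?case by (rule sym)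
  qed
qed

end

theorem theorem5p7:
  fixes \<sigma> p :: real and F :: "complex \<Rightarrow> complex"
  assumes "\<sigma> > 0" and "1 < p" and "F \<in> Hp_space \<sigma> p"
  shows "(AE \<zeta> in arc_length \<sigma> 0. \<exists>L. has_nt_limit \<sigma> F \<zeta> L) \<and>
    nt_limit \<sigma> F \<in> Lp_space (arc_length \<sigma> 0) p \<and>
    Lp_norm (arc_length \<sigma> 0) p (nt_limit \<sigma> F) \<le> Hp_norm \<sigma> p F \<and>
    (\<forall>w \<in> half_strip \<sigma> 0 \<union> - closure (half_strip \<sigma> 0).
       bdry_integrable \<sigma> 0 (\<lambda>\<zeta>. nt_limit \<sigma> F \<zeta> / (\<zeta> - w)) \<and>
       1 / (2 * of_real pi * \<i>) * bdry_integral \<sigma> 0 (\<lambda>\<zeta>. nt_limit \<sigma> F \<zeta> / (\<zeta> - w)) =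
         (if w \<in> half_strip \<sigma> 0 then F w else 0)) \<and>
    ((\<lambda>\<tau>. Lp_norm (three_lines \<sigma> 0) p
        (\<lambda>\<zeta>. transport \<sigma> (\<sigma> - \<tau>) \<tau> F \<zeta> - extend_by_zero \<sigma> (nt_limit \<sigma> F) \<zeta>))
      \<longlongrightarrow> 0) (at_right 0) \<and>
    ((\<lambda>\<tau>. Lp_norm (arc_length \<sigma> 0) p
        (\<lambda>\<zeta>. transport \<sigma> (\<sigma> - \<tau>) \<tau> F \<zeta> - nt_limit \<sigma> F \<zeta>))
      \<longlongrightarrow> 0) (at_right 0)"
proof -
  define B where "B = enn2real (Hp_norm \<sigma> p F) powr p"
  interpret H: strip_Hp \<sigma> p B F unfolding B_def by (rule Hp_space_strip_Hp[OF assms])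
  obtain f where f: "f \<in> borel_measurable borel" "integrable lborel (\<lambda>x. cmod (f x) powr p)"
    "(LINT x|lborel. cmod (f x) powr p) \<le> B" "\<And>w. w \<notin> bdry \<sigma> 0 \<Longrightarrow> cauchy_part \<sigma> UNIV f w = H.cauchy_value w"
    using H.boundary_function_exists by blast
  interpret strip_boundary_function \<sigma> p B F f
    by unfold_locales (use f in auto)
  have "(LINT x|lborel. cmod (f x) powr p) powr (1 / p) \<le> B powr (1 / p)"
    using f(3) assms(2) by (intro powr_mono2) auto
  also have "B powr (1 / p) = enn2real (Hp_norm \<sigma> p F)"
    using assms(2) by (simp add: B_def powr_powr)
  finally have "Lp_norm (arc_length \<sigma> 0) p (nt_limit \<sigma> F) \<le> ennreal (enn2real (Hp_norm \<sigma> p F))"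
    unfolding Lp_norm_nt_limit by (rule ennreal_leI)
  also have "\<dots> = Hp_norm \<sigma> p F" using assms(3) by (simp add: Hp_space_def)
  finally show ?thesis
    using AE_arc_length_has_nt_limit nt_limit_in_Lp bdry_integrable_cauchy bdry_integral_cauchy
      transport_tendsto_Lp transport_tendsto_Lp_three_lines by blast
qed

end
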